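(* Let $2\mathcal{C}$ be a topological $2$-category such that: 1. $2\mathcal{C}$ is a $2$-groupoid; 2. the source and target maps $2\mathcal{C}_1\to2\mathcal{C}_0$ are Serre fibrations; 3. the source and target maps $2\mathcal{C}_2\to2\mathcal{C}_1$ of $2$-morphisms are Serre fibrations; 4. the map $2\mathcal{C}_2\to2\mathcal{C}_2$ sending a $2$-morphism to its vertical inverse is continuous; 5. the map $\pi\colon\operatorname{AdEq}(2\mathcal{C})\to2\mathcal{C}_1$, $(f,g,\eta,\epsilon)\mapsto f$, is a Serre fibration. Then the geometric nerve $\Delta2\mathcal{C}$ satisfies the topological Kan condition.
   Context: A $2$-category means a bicategory. It is topological if internal to topological spaces, with spaces $2\mathcal{C}_0,2\mathcal{C}_1,2\mathcal{C}_2$ of objects, $1$-morphisms, $2$-morphisms and continuous structure maps. $2\mathcal{C}(x,y)$ is the category of $1$-morphisms $x\to y$ and $2$-morphisms between them. Horizontal composition is $*$, vertical composition is juxtaposition, and $\underline{\alpha}$ is the associativity isomorphism. **$2$-groupoid.** A $2$-groupoid is a $2$-category all of whose $2$-morphisms are (vertical) isomorphisms and such that every $1$-morphism $f\colon x_0\to x_1$ induces equivalences of categories $-*f\colon2\mathcal{C}(x_1,y)\to2\mathcal{C}(x_0,y)$ and $f*-\colon2\mathcal{C}(y,x_0)\to2\mathcal{C}(y,x_1)$ for all objects $y$. **$\operatorname{AdEq}(2\mathcal{C})$** is the subspace of $2\mathcal{C}_1\times2\mathcal{C}_1\times2\mathcal{C}_2\times2\mathcal{C}_2$ of tuples $(f,g,\eta,\epsilon)$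 with $f\colon x_0\to x_1$, $g\colon x_1\to x_0$, and isomorphisms $\eta\colon\mathrm{id}_{x_0}\Rightarrow g*f$, $\epsilon\colon f*g\Rightarrow\mathrm{id}_{x_1}$ satisfying (with associativity and unit isomorphisms suppressed) $(\epsilon*f)(f*\eta)=\mathrm{id}_f$ and $(g*\epsilon)(\eta*g)=\mathrm{id}_g$. **Geometric nerve.** $\Delta2\mathcal{C}$ is the simplicial space whose $n$-simplices consist of objects $x_i$ ($0\le i\le n$), $1$-morphisms $x_{ij}\colon x_i\to x_j$ ($i<j$), $2$-morphisms $x_{ijk}\colon x_{ik}\Rightarrow x_{jk}*x_{ij}$ ($i<j<k$) with $\underline{\alpha}(x_{kl}*x_{ijk})x_{ikl}=(x_{jkl}*x_{ij})x_{ijl}$ for $i<j<k<l$, with the subspace topology. **Topological Kan condition.** For a simplicial space $Z_\bullet$, $n\ge1$, $0\le k\le n$, put $\Lambda^n_k(Z_\bullet)=\{(z_i)_{0\le i\le n,\,i\ne k}\in Z_{n-1}^{\,n}\mid d_i(z_j)=d_{j-1}(z_i)\text{ for }i<j,\ i\ne k\ne j\}$ with the subspace topology, and let $c^n_k\colon Z_n\to\Lambda^n_k(Z_\bullet)$ be induced by the faces $d_i$, $i\neq k$. The condition says that all $c^n_k$ are surjective Serre fibrations. *)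

theory Defs
  imports "HOL-Analysis.Analysis"
begin

section \<open>Serre fibrations\<close>

definition cube :: "nat \<Rightarrow> (nat \<Rightarrow> real) topology" where
  "cube n = product_topology (\<lambda>_. top_of_set {0..1}) {..<n}"

definition Serre_fibration :: "'a topology \<Rightarrow> 'b topology \<Rightarrow> ('a \<Rightarrow> 'b) \<Rightarrow> bool" where
  "Serre_fibration E B p \<longleftrightarrow>
     continuous_map E B p \<and>
     (\<forall>n f H. continuous_map (cube n) E f \<longrightarrow>
        continuous_map (prod_topology (cube n) (top_of_set {0..1::real})) B H \<longrightarrow>
        (\<forall>s \<in> topspace (cube n). H (s, 0) = p (f s)) \<longrightarrow>
        (\<exists>K. continuous_map (prod_topology (cube n) (top_of_set {0..1::real})) E K \<and>
             (\<forall>s \<in> topspace (cube n). K (s, 0) = f s) \<and>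
             (\<forall>s \<in> topspace (cube n). \<forall>t \<in> {0..1}. p (K (s, t)) = H (s, t))))"


section \<open>Categories and equivalences of categories\<close>

record ('a, 'b) category_data =
  Obj :: "'a set"
  Arr :: "'b set"
  cdom :: "'b \<Rightarrow> 'a"
  ccod :: "'b \<Rightarrow> 'a"
  cid :: "'a \<Rightarrow> 'b"
  ccomp :: "'b \<Rightarrow> 'b \<Rightarrow> 'b"  (* ccomp A v u is v after u *)

definition is_iso :: "('a, 'b) category_data \<Rightarrow> 'b \<Rightarrow> bool" where
  "is_iso A u \<longleftrightarrow> u \<in> Arr A \<and>
     (\<exists>v \<in> Arr A. cdom A v = ccod A u \<and> ccod A v = cdom A u \<and>
        ccomp A v u = cid A (cdom A u) \<and> ccomp A u v = cid A (ccod A u))"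

definition is_functor ::
  "('a, 'b) category_data \<Rightarrow> ('c, 'd) category_data \<Rightarrow> ('a \<Rightarrow> 'c) \<Rightarrow> ('b \<Rightarrow> 'd) \<Rightarrow> bool" where
  "is_functor A B F0 F1 \<longleftrightarrow>
     (\<forall>x \<in> Obj A. F0 x \<in> Obj B) \<and>
     (\<forall>u \<in> Arr A. F1 u \<in> Arr B \<and> cdom B (F1 u) = F0 (cdom A u) \<and> ccod B (F1 u) = F0 (ccod A u)) \<and>
     (\<forall>x \<in> Obj A. F1 (cid A x) = cid B (F0 x)) \<and>
     (\<forall>u \<in> Arr A. \<forall>v \<in> Arr A. cdom A v = ccod A u \<longrightarrow>
        F1 (ccomp A v u) = ccomp B (F1 v) (F1 u))"

definition naturally_isomorphic ::
  "('a, 'b) category_data \<Rightarrow> ('c, 'd) category_data \<Rightarrow>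
   ('a \<Rightarrow> 'c) \<Rightarrow> ('b \<Rightarrow> 'd) \<Rightarrow> ('a \<Rightarrow> 'c) \<Rightarrow> ('b \<Rightarrow> 'd) \<Rightarrow> bool" where
  "naturally_isomorphic A B F0 F1 G0 G1 \<longleftrightarrow>
     (\<exists>\<tau>. (\<forall>x \<in> Obj A. is_iso B (\<tau> x) \<and> cdom B (\<tau> x) = F0 x \<and> ccod B (\<tau> x) = G0 x) \<and>
          (\<forall>u \<in> Arr A. ccomp B (\<tau> (ccod A u)) (F1 u) = ccomp B (G1 u) (\<tau> (cdom A u))))"

definition is_equivalence ::
  "('a, 'b) category_data \<Rightarrow> ('c, 'd) category_data \<Rightarrow> ('a \<Rightarrow> 'c) \<Rightarrow> ('b \<Rightarrow> 'd) \<Rightarrow> bool" where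
  "is_equivalence A B F0 F1 \<longleftrightarrow>
     is_functor A B F0 F1 \<and>
     (\<exists>G0 G1. is_functor B A G0 G1 \<and>
        naturally_isomorphic A A (G0 \<circ> F0) (G1 \<circ> F1) id id \<and>
        naturally_isomorphic B B (F0 \<circ> G0) (F1 \<circ> G1) id id)"


section \<open>Topological bicategories\<close>

text \<open>
  All compositions are written in the order of functions: \<open>g \<odot> f\<close> (of 1-morphisms),
  \<open>b \<star> a\<close> (horizontal, of 2-morphisms) and \<open>b \<cdot> a\<close> (vertical) all have the
  morphism that comes first on the right.  Values outside the topological spaces, and of
  compositions outside the composable tuples, are irrelevant.  The associator is directed
  \<open>h \<odot> (g \<odot> f) \<Rightarrow> (h \<odot> g) \<odot> f\<close>, as required by the cocycle condition in the nerve.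
\<close>

record ('o, 'm, 'c) bicat =
  Ob :: "'o topology"
  Mor :: "'m topology"
  Cell :: "'c topology"
  src :: "'m \<Rightarrow> 'o"
  tgt :: "'m \<Rightarrow> 'o"
  src2 :: "'c \<Rightarrow> 'm"
  tgt2 :: "'c \<Rightarrow> 'm"
  one :: "'o \<Rightarrow> 'm"
  one2 :: "'m \<Rightarrow> 'c"
  comp1 :: "'m \<Rightarrow> 'm \<Rightarrow> 'm"  (infixr \<open>\<odot>\<index>\<close> 70)
  hcomp :: "'c \<Rightarrow> 'c \<Rightarrow> 'c"  (infixr \<open>\<star>\<index>\<close> 70)
  vcomp :: "'c \<Rightarrow> 'c \<Rightarrow> 'c"  (infixr \<open>\<cdot>\<index>\<close> 65)
  assoc :: "'m \<Rightarrow> 'm \<Rightarrow> 'm \<Rightarrow> 'c"  (* assoc h g f : h (g f) => (h g) f *)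
  lunit :: "'m \<Rightarrow> 'c"  (* lunit f : id f => f *)
  runit :: "'m \<Rightarrow> 'c"  (* runit f : f id => f *)

definition mor :: "('o, 'm, 'c) bicat \<Rightarrow> 'm \<Rightarrow> 'o \<Rightarrow> 'o \<Rightarrow> bool" where
  "mor C f x y \<longleftrightarrow> f \<in> topspace (Mor C) \<and> src C f = x \<and> tgt C f = y"

definition cell :: "('o, 'm, 'c) bicat \<Rightarrow> 'c \<Rightarrow> 'm \<Rightarrow> 'm \<Rightarrow> bool" where
  "cell C a f g \<longleftrightarrow> a \<in> topspace (Cell C) \<and> src2 C a = f \<and> tgt2 C a = g"

definition inverse_cells :: "('o, 'm, 'c) bicat \<Rightarrow> 'c \<Rightarrow> 'c \<Rightarrow> bool" where
  "inverse_cells C a b \<longleftrightarrow>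
     a \<in> topspace (Cell C) \<and> cell C b (tgt2 C a) (src2 C a) \<and>
     b \<cdot>\<^bsub>C\<^esub> a = one2 C (src2 C a) \<and> a \<cdot>\<^bsub>C\<^esub> b = one2 C (tgt2 C a)"

definition iso_cell :: "('o, 'm, 'c) bicat \<Rightarrow> 'c \<Rightarrow> bool" where
  "iso_cell C a \<longleftrightarrow> (\<exists>b. inverse_cells C a b)"

definition inv_cell :: "('o, 'm, 'c) bicat \<Rightarrow> 'c \<Rightarrow> 'c" where
  "inv_cell C a = (THE b. inverse_cells C a b)"

locale bicategory =
  fixes C :: "('o, 'm, 'c) bicat" (structure)
  assumes src_tgt: "f \<in> topspace (Mor C) \<Longrightarrow> src C f \<in> topspace (Ob C) \<and> tgt C f \<in> topspace (Ob C)"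
    and src2_tgt2: "a \<in> topspace (Cell C) \<Longrightarrow>
        src2 C a \<in> topspace (Mor C) \<and> tgt2 C a \<in> topspace (Mor C)"
    and globular: "a \<in> topspace (Cell C) \<Longrightarrow>
        src C (src2 C a) = src C (tgt2 C a) \<and> tgt C (src2 C a) = tgt C (tgt2 C a)"
    \<comment> \<open>the categories of 1-morphisms between two objects\<close>
    and one2: "f \<in> topspace (Mor C) \<Longrightarrow> cell C (one2 C f) f f"
    and vcomp: "\<lbrakk>cell C a f g; cell C b g h\<rbrakk> \<Longrightarrow> cell C (b \<cdot> a) f h"
    and vcomp_one2_left: "cell C a f g \<Longrightarrow> one2 C g \<cdot> a = a"
    and vcomp_one2_right: "cell C a f g \<Longrightarrow> a \<cdot> one2 C f = a"
    and vcomp_assoc: "\<lbrakk>cell C a f g; cell C b g h; cell C c h k\<rbrakk> \<Longrightarrow> c \<cdot> (b \<cdot> a) = (c \<cdot> b) \<cdot> a"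
    \<comment> \<open>identities, and horizontal composition as a functor\<close>
    and one: "x \<in> topspace (Ob C) \<Longrightarrow> mor C (one C x) x x"
    and comp1: "\<lbrakk>mor C f x y; mor C g y z\<rbrakk> \<Longrightarrow> mor C (g \<odot> f) x z"
    and hcomp: "\<lbrakk>cell C a f f'; cell C b g g'; src C g = tgt C f\<rbrakk> \<Longrightarrow>
        cell C (b \<star> a) (g \<odot> f) (g' \<odot> f')"
    and hcomp_one2: "\<lbrakk>mor C f x y; mor C g y z\<rbrakk> \<Longrightarrow> one2 C g \<star> one2 C f = one2 C (g \<odot> f)"
    and interchange: "\<lbrakk>cell C a f f'; cell C a' f' f''; cell C b g g'; cell C b' g' g'';
        src C g = tgt C f\<rbrakk> \<Longrightarrow> (b' \<cdot> b) \<star> (a' \<cdot> a) = (b' \<star> a') \<cdot> (b \<star> a)"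
    \<comment> \<open>associativity and unit isomorphisms\<close>
    and assoc: "\<lbrakk>mor C f x y; mor C g y z; mor C h z w\<rbrakk> \<Longrightarrow>
        cell C (assoc C h g f) (h \<odot> (g \<odot> f)) ((h \<odot> g) \<odot> f) \<and> iso_cell C (assoc C h g f)"
    and assoc_natural: "\<lbrakk>cell C a f f'; cell C b g g'; cell C c h h';
        src C g = tgt C f; src C h = tgt C g\<rbrakk> \<Longrightarrow>
        assoc C h' g' f' \<cdot> (c \<star> (b \<star> a)) = ((c \<star> b) \<star> a) \<cdot> assoc C h g f"
    and lunit: "mor C f x y \<Longrightarrow> cell C (lunit C f) (one C y \<odot> f) f \<and> iso_cell C (lunit C f)"
    and lunit_natural: "\<lbrakk>cell C a f f'; mor C f x y\<rbrakk> \<Longrightarrow>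
        lunit C f' \<cdot> (one2 C (one C y) \<star> a) = a \<cdot> lunit C f"
    and runit: "mor C f x y \<Longrightarrow> cell C (runit C f) (f \<odot> one C x) f \<and> iso_cell C (runit C f)"
    and runit_natural: "\<lbrakk>cell C a f f'; mor C f x y\<rbrakk> \<Longrightarrow>
        runit C f' \<cdot> (a \<star> one2 C (one C x)) = a \<cdot> runit C f"
    and pentagon: "\<lbrakk>mor C f x y; mor C g y z; mor C h z w; mor C k w v\<rbrakk> \<Longrightarrow>
        assoc C (k \<odot> h) g f \<cdot> assoc C k h (g \<odot> f) =
        (assoc C k h g \<star> one2 C f) \<cdot> (assoc C k (h \<odot> g) f \<cdot> (one2 C k \<star> assoc C h g f))"
    and triangle: "\<lbrakk>mor C f x y; mor C g y z\<rbrakk> \<Longrightarrow>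
        (runit C g \<star> one2 C f) \<cdot> assoc C g (one C y) f = one2 C g \<star> lunit C f"

definition composable1 :: "('o, 'm, 'c) bicat \<Rightarrow> ('m \<times> 'm) topology" where
  "composable1 C = subtopology (prod_topology (Mor C) (Mor C)) {(g, f). src C g = tgt C f}"

definition composable1_3 :: "('o, 'm, 'c) bicat \<Rightarrow> ('m \<times> 'm \<times> 'm) topology" where
  "composable1_3 C = subtopology (prod_topology (Mor C) (prod_topology (Mor C) (Mor C)))
     {(h, g, f). src C h = tgt C g \<and> src C g = tgt C f}"

definition vcomposable :: "('o, 'm, 'c) bicat \<Rightarrow> ('c \<times> 'c) topology" where
  "vcomposable C = subtopology (prod_topology (Cell C) (Cell C)) {(b, a). src2 C b = tgt2 C a}"

definition hcomposable :: "('o, 'm, 'c) bicat \<Rightarrow> ('c \<times> 'c) topology" where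
  "hcomposable C = subtopology (prod_topology (Cell C) (Cell C))
     {(b, a). src C (src2 C b) = tgt C (src2 C a)}"

text \<open>
  Since the associativity and unit transformations are internal natural isomorphisms, their
  inverses are structure maps as well.
\<close>

locale topological_bicategory = bicategory +
  assumes continuous_src: "continuous_map (Mor C) (Ob C) (src C)"
    and continuous_tgt: "continuous_map (Mor C) (Ob C) (tgt C)"
    and continuous_src2: "continuous_map (Cell C) (Mor C) (src2 C)"
    and continuous_tgt2: "continuous_map (Cell C) (Mor C) (tgt2 C)"
    and continuous_one: "continuous_map (Ob C) (Mor C) (one C)"
    and continuous_one2: "continuous_map (Mor C) (Cell C) (one2 C)"
    and continuous_comp1: "continuous_map (composable1 C) (Mor C) (\<lambda>(g, f). g \<odot> f)"
    and continuous_hcomp: "continuous_map (hcomposable C) (Cell C) (\<lambda>(b, a). b \<star> a)"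
    and continuous_vcomp: "continuous_map (vcomposable C) (Cell C) (\<lambda>(b, a). b \<cdot> a)"
    and continuous_assoc: "continuous_map (composable1_3 C) (Cell C) (\<lambda>(h, g, f). assoc C h g f)"
    and continuous_lunit: "continuous_map (Mor C) (Cell C) (lunit C)"
    and continuous_runit: "continuous_map (Mor C) (Cell C) (runit C)"
    and continuous_inv_assoc:
      "continuous_map (composable1_3 C) (Cell C) (\<lambda>(h, g, f). inv_cell C (assoc C h g f))"
    and continuous_inv_lunit: "continuous_map (Mor C) (Cell C) (\<lambda>f. inv_cell C (lunit C f))"
    and continuous_inv_runit: "continuous_map (Mor C) (Cell C) (\<lambda>f. inv_cell C (runit C f))"


section \<open>2-groupoids and adjoint equivalences\<close>

definition hom_category :: "('o, 'm, 'c) bicat \<Rightarrow> 'o \<Rightarrow> 'o \<Rightarrow> ('m, 'c) category_data" where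
  "hom_category C x y =
     \<lparr>Obj = {f. mor C f x y}, Arr = {a \<in> topspace (Cell C). mor C (src2 C a) x y},
      cdom = src2 C, ccod = tgt2 C, cid = one2 C, ccomp = vcomp C\<rparr>"

definition two_groupoid :: "('o, 'm, 'c) bicat \<Rightarrow> bool" where
  "two_groupoid C \<longleftrightarrow>
     bicategory C \<and>
     (\<forall>a \<in> topspace (Cell C). iso_cell C a) \<and>
     (\<forall>f x0 x1. mor C f x0 x1 \<longrightarrow> (\<forall>y \<in> topspace (Ob C).
        is_equivalence (hom_category C x1 y) (hom_category C x0 y)
          (\<lambda>h. h \<odot>\<^bsub>C\<^esub> f) (\<lambda>a. a \<star>\<^bsub>C\<^esub> one2 C f) \<and>
        is_equivalence (hom_category C y x0) (hom_category C y x1)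
          (\<lambda>h. f \<odot>\<^bsub>C\<^esub> h) (\<lambda>a. one2 C f \<star>\<^bsub>C\<^esub> a)))"

text \<open>
  The triangle identities, with the associativity and unit isomorphisms put in, say that the
  composites
  \<open>f \<Rightarrow> f \<odot> id \<Rightarrow> f \<odot> (g \<odot> f) \<Rightarrow> (f \<odot> g) \<odot> f \<Rightarrow> id \<odot> f \<Rightarrow> f\<close> and
  \<open>g \<Rightarrow> id \<odot> g \<Rightarrow> (g \<odot> f) \<odot> g \<Rightarrow> g \<odot> (f \<odot> g) \<Rightarrow> g \<odot> id \<Rightarrow> g\<close>
  are identities.
\<close>

definition adjoint_equivalence :: "('o, 'm, 'c) bicat \<Rightarrow> 'm \<Rightarrow> 'm \<Rightarrow> 'c \<Rightarrow> 'c \<Rightarrow> bool" where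
  "adjoint_equivalence C f g \<eta> \<epsilon> \<longleftrightarrow>
     f \<in> topspace (Mor C) \<and> mor C g (tgt C f) (src C f) \<and>
     cell C \<eta> (one C (src C f)) (g \<odot>\<^bsub>C\<^esub> f) \<and> iso_cell C \<eta> \<and>
     cell C \<epsilon> (f \<odot>\<^bsub>C\<^esub> g) (one C (tgt C f)) \<and> iso_cell C \<epsilon> \<and>
     lunit C f \<cdot>\<^bsub>C\<^esub> (\<epsilon> \<star>\<^bsub>C\<^esub> one2 C f) \<cdot>\<^bsub>C\<^esub> assoc C f g f \<cdot>\<^bsub>C\<^esub> (one2 C f \<star>\<^bsub>C\<^esub> \<eta>)
       \<cdot>\<^bsub>C\<^esub> inv_cell C (runit C f) = one2 C f \<and>
     runit C g \<cdot>\<^bsub>C\<^esub> (one2 C g \<star>\<^bsub>C\<^esub> \<epsilon>) \<cdot>\<^bsub>C\<^esub> inv_cell C (assoc C g f g) \<cdot>\<^bsub>C\<^esub> (\<eta> \<star>\<^bsub>C\<^esub> one2 C g)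
       \<cdot>\<^bsub>C\<^esub> inv_cell C (lunit C g) = one2 C g"

definition AdEq :: "('o, 'm, 'c) bicat \<Rightarrow> ('m \<times> 'm \<times> 'c \<times> 'c) topology" where
  "AdEq C =
     subtopology (prod_topology (Mor C) (prod_topology (Mor C) (prod_topology (Cell C) (Cell C))))
       {(f, g, \<eta>, \<epsilon>). adjoint_equivalence C f g \<eta> \<epsilon>}"


section \<open>Simplicial spaces and the topological Kan condition\<close>

text \<open>
  \<open>act Z m n \<theta>\<close> is the map from the space of \<open>n\<close>-simplices to the space of
  \<open>m\<close>-simplices induced by a monotone map \<open>\<theta>\<close> from \<open>{0..m}\<close> to \<open>{0..n}\<close>.
\<close>

record 'a simplicial_data =
  simplices :: "nat \<Rightarrow> 'a topology"
  act :: "nat \<Rightarrow> nat \<Rightarrow> (nat \<Rightarrow> nat) \<Rightarrow> 'a \<Rightarrow> 'a"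

definition coface :: "nat \<Rightarrow> nat \<Rightarrow> nat" where
  "coface i j = (if j < i then j else Suc j)"

text \<open>\<open>face Z n i\<close> is the face map \<open>d\<^sub>i\<close> on \<open>n\<close>-simplices, for \<open>n \<ge> 1\<close>.\<close>

definition face :: "'a simplicial_data \<Rightarrow> nat \<Rightarrow> nat \<Rightarrow> 'a \<Rightarrow> 'a" where
  "face Z n i = act Z (n - 1) n (coface i)"

text \<open>
  For \<open>n = 1\<close> the compatibility condition in the definition of the horn is void, so that
  the undefined faces of 0-simplices do not occur.
\<close>

definition horn :: "'a simplicial_data \<Rightarrow> nat \<Rightarrow> nat \<Rightarrow> (nat \<Rightarrow> 'a) topology" where
  "horn Z n k =
     subtopology (product_topology (\<lambda>_. simplices Z (n - 1)) ({0..n} - {k}))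
       {z. \<forall>i \<in> {0..n} - {k}. \<forall>j \<in> {0..n} - {k}. i < j \<longrightarrow>
             face Z (n - 1) i (z j) = face Z (n - 1) (j - 1) (z i)}"

definition horn_map :: "'a simplicial_data \<Rightarrow> nat \<Rightarrow> nat \<Rightarrow> 'a \<Rightarrow> (nat \<Rightarrow> 'a)" where
  "horn_map Z n k z = (\<lambda>i \<in> {0..n} - {k}. face Z n i z)"

definition topological_Kan :: "'a simplicial_data \<Rightarrow> bool" where
  "topological_Kan Z \<longleftrightarrow>
     (\<forall>n \<ge> 1. \<forall>k \<le> n.
        Serre_fibration (simplices Z n) (horn Z n k) (horn_map Z n k) \<and>
        horn_map Z n k ` topspace (simplices Z n) = topspace (horn Z n k))"


section \<open>The geometric nerve\<close>

type_synonym ('o, 'm, 'c) nerve_simplex =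
  "(nat \<Rightarrow> 'o) \<times> (nat \<times> nat \<Rightarrow> 'm) \<times> (nat \<times> nat \<times> nat \<Rightarrow> 'c)"

definition pairs :: "nat \<Rightarrow> (nat \<times> nat) set" where
  "pairs n = {(i, j). i < j \<and> j \<le> n}"

definition triples :: "nat \<Rightarrow> (nat \<times> nat \<times> nat) set" where
  "triples n = {(i, j, k). i < j \<and> j < k \<and> k \<le> n}"

definition is_nerve_simplex ::
  "('o, 'm, 'c) bicat \<Rightarrow> nat \<Rightarrow> ('o, 'm, 'c) nerve_simplex \<Rightarrow> bool" where
  "is_nerve_simplex C n = (\<lambda>(x, u, w).
     (\<forall>i j. i < j \<and> j \<le> n \<longrightarrow> mor C (u (i, j)) (x i) (x j)) \<and>
     (\<forall>i j k. i < j \<and> j < k \<and> k \<le> n \<longrightarrow>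
        cell C (w (i, j, k)) (u (i, k)) (u (j, k) \<odot>\<^bsub>C\<^esub> u (i, j))) \<and>
     (\<forall>i j k l. i < j \<and> j < k \<and> k < l \<and> l \<le> n \<longrightarrow>
        assoc C (u (k, l)) (u (j, k)) (u (i, j)) \<cdot>\<^bsub>C\<^esub> (one2 C (u (k, l)) \<star>\<^bsub>C\<^esub> w (i, j, k))
          \<cdot>\<^bsub>C\<^esub> w (i, k, l) =
        (w (j, k, l) \<star>\<^bsub>C\<^esub> one2 C (u (i, j))) \<cdot>\<^bsub>C\<^esub> w (i, j, l)))"

definition nerve_space ::
  "('o, 'm, 'c) bicat \<Rightarrow> nat \<Rightarrow> ('o, 'm, 'c) nerve_simplex topology" where
  "nerve_space C n =
     subtopology
       (prod_topology (product_topology (\<lambda>_. Ob C) {0..n})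
         (prod_topology (product_topology (\<lambda>_. Mor C) (pairs n))
           (product_topology (\<lambda>_. Cell C) (triples n))))
       {s. is_nerve_simplex C n s}"

text \<open>
  On strictly monotone maps (in particular on faces) the simplicial structure is reindexing.
  In general, identities and inverse unit isomorphisms are inserted at repeated indices.
\<close>

definition nerve_act ::
  "('o, 'm, 'c) bicat \<Rightarrow> nat \<Rightarrow> nat \<Rightarrow> (nat \<Rightarrow> nat) \<Rightarrow>
   ('o, 'm, 'c) nerve_simplex \<Rightarrow> ('o, 'm, 'c) nerve_simplex" where
  "nerve_act C m n \<theta> = (\<lambda>(x, u, w).
     let u' = (\<lambda>i j. if \<theta> i = \<theta> j then one C (x (\<theta> i)) else u (\<theta> i, \<theta> j)) in
     (\<lambda>i \<in> {0..m}. x (\<theta> i),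
      \<lambda>(i, j) \<in> pairs m. u' i j,
      \<lambda>(i, j, k) \<in> triples m.
         if \<theta> i = \<theta> j then inv_cell C (runit C (u' i k))
         else if \<theta> j = \<theta> k then inv_cell C (lunit C (u' i k))
         else w (\<theta> i, \<theta> j, \<theta> k)))"

definition geometric_nerve ::
  "('o, 'm, 'c) bicat \<Rightarrow> ('o, 'm, 'c) nerve_simplex simplicial_data" where
  "geometric_nerve C = \<lparr>simplices = nerve_space C, act = nerve_act C\<rparr>"

end

(*
  A map into a space of horns or simplices is a tuple of maps into the spaces of objects,
  1-morphisms and 2-morphisms, so homotopies are lifted componentwise.  For n = 1 lift along the
  source or target map.  For n = 2 and an inner horn, lift the 2-morphism along its target.  For an
  outer horn, with a given 1-morphism f, lift f to an adjoint equivalence (f, g, eta, epsilon):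
  transposition turns the missing 2-morphism into one whose source u g or g u is prescribed by the
  horn, and this one is lifted along its source.  For n >= 3 fillers are unique.  For n = 3 the
  cocycle condition is solved for the missing 2-morphism; at the outer horns this inverts whiskering
  by a 1-morphism f, which is done continuously with the unit or counit of a lift of f to AdEq.
  For n = 4 the missing cocycle condition follows from the other four and the pentagon.

  AdEq(C) -> C_1 is surjective because in a 2-groupoid an equivalence can be improved to an adjoint
  one, so its lifts exist over every cube.
*)
theory Submission
  imports Defs
begin

section \<open>Equivalences of categories\<close>

text \<open>\<open>is_equivalence\<close> merely asserts, for each 1-morphism separately, that some
  quasi-inverse functor exists, so nothing obtained from it is continuous. It serves pointwise
  statements: whiskering is fully faithful. Wherever a cell must vary continuously, it is written as
  an explicit composite of structure maps, vertical inverses and the unit or counit of a lift to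
  \<open>AdEq\<close>; fullness of whiskering then shows that this composite does solve the equation
  in question. The outer horns of dimension two are the reason for asking for adjoint equivalences
  rather than for pairs of quasi-inverse 1-morphisms. There the lift has to start at a given 2-cell,
  while the lifting takes place for a transposed cell; the triangle identity guarantees that
  transposing back at time 0 returns the given cell itself. The faces of a horn are merged into one
  family of cells indexed by vertex sets. A cell belongs to the horn if and only if some index other
  than k avoids its vertex set, so counting indices tells which cells a filler has to
  supply.\<close>

locale category =
  fixes A :: "('a, 'b) category_data"
  assumes dom_cod: "u \<in> Arr A \<Longrightarrow> cdom A u \<in> Obj A \<and> ccod A u \<in> Obj A"
    and ident: "x \<in> Obj A \<Longrightarrow> cid A x \<in> Arr A \<and> cdom A (cid A x) = x \<and> ccod A (cid A x) = x"
    and comp: "\<lbrakk>u \<in> Arr A; v \<in> Arr A; cdom A v = ccod A u\<rbrakk> \<Longrightarrow>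
      ccomp A v u \<in> Arr A \<and> cdom A (ccomp A v u) = cdom A u \<and> ccod A (ccomp A v u) = ccod A v"
    and ident_left: "u \<in> Arr A \<Longrightarrow> ccomp A (cid A (ccod A u)) u = u"
    and ident_right: "u \<in> Arr A \<Longrightarrow> ccomp A u (cid A (cdom A u)) = u"
    and comp_assoc: "\<lbrakk>u \<in> Arr A; v \<in> Arr A; w \<in> Arr A; cdom A v = ccod A u; cdom A w = ccod A v\<rbrakk>
      \<Longrightarrow> ccomp A w (ccomp A v u) = ccomp A (ccomp A w v) u"
begin

lemma iso_cancel_right:
  assumes "is_iso A t" "u \<in> Arr A" "v \<in> Arr A" "cdom A u = ccod A t" "cdom A v = ccod A t"
    and eq: "ccomp A u t = ccomp A v t"
  shows "u = v"
proof -
  from assms(1) obtain s where s: "t \<in> Arr A" "s \<in> Arr A" "cdom A s = ccod A t" "ccod A s = cdom A t"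
    "ccomp A t s = cid A (ccod A t)" unfolding is_iso_def by blast
  have "u = ccomp A u (ccomp A t s)" using s assms ident_right[of u] by simp
  also have "\<dots> = ccomp A (ccomp A u t) s" using comp_assoc[of s t u] s assms(2-5) by simp
  also have "\<dots> = ccomp A (ccomp A v t) s" using eq by simp
  also have "\<dots> = ccomp A v (ccomp A t s)" using comp_assoc[of s t v] s assms(2-5) by simp
  also have "\<dots> = v" using s assms ident_right[of v] by simp
  finally show ?thesis .
qed

lemma iso_cancel_left:
  assumes "is_iso A t" "u \<in> Arr A" "v \<in> Arr A" "ccod A u = cdom A t" "ccod A v = cdom A t"
    and eq: "ccomp A t u = ccomp A t v"
  shows "u = v"
proof -
  from assms(1) obtain s where s: "t \<in> Arr A" "s \<in> Arr A" "cdom A s = ccod A t" "ccod A s = cdom A t"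
    "ccomp A s t = cid A (cdom A t)" unfolding is_iso_def by blast
  have "u = ccomp A (ccomp A s t) u" using s assms ident_left[of u] by simp
  also have "\<dots> = ccomp A s (ccomp A t u)" using comp_assoc[of u t s] s assms(2-5) by simp
  also have "\<dots> = ccomp A s (ccomp A t v)" using eq by simp
  also have "\<dots> = ccomp A (ccomp A s t) v" using comp_assoc[of v t s] s assms(2-5) by simp
  also have "\<dots> = v" using s assms ident_left[of v] by simp
  finally show ?thesis .
qed

text \<open>Naturality turns \<open>F1 u = F1 v\<close> into equality of the composites of
  \<open>u\<close> and \<open>v\<close> with an invertible component, which can be cancelled. Just
  one of the two natural isomorphisms of an equivalence is assumed, so the lemma applies to a
  functor and, with roles exchanged, to its quasi-inverse.\<close>

lemma faithful_of_retraction: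
  assumes nat: "naturally_isomorphic A A (G0 \<circ> F0) (G1 \<circ> F1) id id"
    and uv: "u \<in> Arr A" "v \<in> Arr A" "cdom A u = cdom A v" "ccod A u = ccod A v" and eq: "F1 u = F1 v"
  shows "u = v"
proof -
  from nat obtain t where t: "\<forall>x \<in> Obj A. is_iso A (t x) \<and> cdom A (t x) = (G0 \<circ> F0) x \<and> ccod A (t x) = id x"
    and n: "\<forall>u \<in> Arr A. ccomp A (t (ccod A u)) ((G1 \<circ> F1) u) = ccomp A (id u) (t (cdom A u))"
    unfolding naturally_isomorphic_def by (elim exE conjE)
  have "ccomp A u (t (cdom A u)) = ccomp A v (t (cdom A u))"
    using bspec[OF n uv(1)] bspec[OF n uv(2)] uv(3,4) eq by simp
  then show ?thesis
    using bspec[OF t, of "cdom A u"] uv dom_cod[of u] by (intro iso_cancel_right[of "t (cdom A u)" u v]) simp_all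
qed

end

lemma equivalence_faithful:
  assumes "category A" "is_equivalence A B F0 F1"
    and "u \<in> Arr A" "v \<in> Arr A" "cdom A u = cdom A v" "ccod A u = ccod A v" "F1 u = F1 v"
  shows "u = v"
proof -
  from assms(2) obtain G0 G1 where "naturally_isomorphic A A (G0 \<circ> F0) (G1 \<circ> F1) id id"
    unfolding is_equivalence_def by blast
  from category.faithful_of_retraction[OF assms(1) this assms(3-7)] show ?thesis .
qed

lemma is_functor_arr:
  assumes "is_functor A B F0 F1" "u \<in> Arr A"
  shows "F1 u \<in> Arr B" "cdom B (F1 u) = F0 (cdom A u)" "ccod B (F1 u) = F0 (ccod A u)"
  using assms unfolding is_functor_def by blast+

text \<open>The preimage is \<open>G1 c\<close> conjugated with the natural isomorphism
  \<open>t\<close>, as naturality of \<open>t\<close> at a preimage dictates. Naturality at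
  \<open>u\<close> gives \<open>G1 (F1 u) = G1 c\<close>, and the quasi-inverse is faithful
  too.\<close>

lemma equivalence_full:
  assumes A: "category A" and B: "category B" and e: "is_equivalence A B F0 F1"
    and x: "x \<in> Obj A" and y: "y \<in> Obj A"
    and c: "c \<in> Arr B" "cdom B c = F0 x" "ccod B c = F0 y"
  obtains u where "u \<in> Arr A" "cdom A u = x" "ccod A u = y" "F1 u = c"
proof -
  interpret A: category A by fact
  interpret B: category B by fact
  from e obtain G0 G1 where F: "is_functor A B F0 F1" and G: "is_functor B A G0 G1"
    and nA: "naturally_isomorphic A A (G0 \<circ> F0) (G1 \<circ> F1) id id"
    and nB: "naturally_isomorphic B B (F0 \<circ> G0) (F1 \<circ> G1) id id"
    unfolding is_equivalence_def by blast
  from nA obtain t where t: "\<And>x. x \<in> Obj A \<Longrightarrow> is_iso A (t x) \<and> cdom A (t x) = G0 (F0 x) \<and> ccod A (t x) = x"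
    and n: "\<And>u. u \<in> Arr A \<Longrightarrow> ccomp A (t (ccod A u)) (G1 (F1 u)) = ccomp A u (t (cdom A u))"
    unfolding naturally_isomorphic_def o_def id_def by (elim exE conjE) blast
  from t[OF x] obtain s where s: "t x \<in> Arr A" "s \<in> Arr A" "cdom A s = x" "ccod A s = G0 (F0 x)"
    "ccomp A s (t x) = cid A (G0 (F0 x))" unfolding is_iso_def by metis
  have Gc: "G1 c \<in> Arr A" "cdom A (G1 c) = G0 (F0 x)" "ccod A (G1 c) = G0 (F0 y)"
    using is_functor_arr[OF G c(1)] c by simp_all
  have ty: "t y \<in> Arr A" "cdom A (t y) = G0 (F0 y)" "ccod A (t y) = y"
    using t[OF y] unfolding is_iso_def by blast+
  define u where "u = ccomp A (ccomp A (t y) (G1 c)) s"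
  have p: "ccomp A (t y) (G1 c) \<in> Arr A" "cdom A (ccomp A (t y) (G1 c)) = G0 (F0 x)"
    "ccod A (ccomp A (t y) (G1 c)) = y"
    using A.comp[of "G1 c" "t y"] Gc ty by simp_all
  have u: "u \<in> Arr A" "cdom A u = x" "ccod A u = y"
    unfolding u_def using A.comp[of s "ccomp A (t y) (G1 c)"] p s by simp_all
  have Fu: "F1 u \<in> Arr B" "cdom B (F1 u) = F0 x" "ccod B (F1 u) = F0 y"
    using is_functor_arr[OF F u(1)] u by simp_all
  have GFu: "G1 (F1 u) \<in> Arr A" "cdom A (G1 (F1 u)) = G0 (F0 x)" "ccod A (G1 (F1 u)) = G0 (F0 y)"
    using is_functor_arr[OF G Fu(1)] Fu by simp_all
  have "ccomp A (t y) (G1 (F1 u)) = ccomp A u (t x)" using n[OF u(1)] u by simp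
  also have "\<dots> = ccomp A (ccomp A (t y) (G1 c)) (ccomp A s (t x))"
    unfolding u_def using p s(1-4) t[OF x] A.comp_assoc[of "t x" s "ccomp A (t y) (G1 c)"] by simp
  also have "\<dots> = ccomp A (t y) (G1 c)"
    using s(5) A.ident_right[OF p(1)] p by simp
  finally have "G1 (F1 u) = G1 c"
    using t[OF y] GFu Gc by (intro A.iso_cancel_left[of "t y" "G1 (F1 u)" "G1 c"]) simp_all
  then have "F1 u = c"
    using B.faithful_of_retraction[OF nB Fu(1) c(1)] Fu c by simp
  with u that show thesis by blast
qed

lemma equivalence_essentially_surjective:
  assumes "is_equivalence A B F0 F1" "y \<in> Obj B"
  obtains x t where "x \<in> Obj A" "is_iso B t" "cdom B t = F0 x" "ccod B t = y"
proof -
  from assms(1) obtain G0 G1 where G: "is_functor B A G0 G1"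
    and nB: "naturally_isomorphic B B (F0 \<circ> G0) (F1 \<circ> G1) id id"
    unfolding is_equivalence_def by blast
  from nB assms(2) obtain t where "is_iso B t" "cdom B t = F0 (G0 y)" "ccod B t = y"
    unfolding naturally_isomorphic_def by auto
  moreover have "G0 y \<in> Obj A" using G assms(2) unfolding is_functor_def by blast
  ultimately show thesis using that by blast
qed

section \<open>Calculus of 2-cells\<close>

context bicategory
begin

abbreviation M where "M \<equiv> topspace (Mor C)"
abbreviation D where "D \<equiv> topspace (Cell C)"

lemma cell_iff: "cell C a f g \<longleftrightarrow> a \<in> D \<and> src2 C a = f \<and> tgt2 C a = g"
  by (simp add: cell_def)

lemma mor_iff: "mor C f x y \<longleftrightarrow> f \<in> M \<and> src C f = x \<and> tgt C f = y"
  by (simp add: mor_def)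

lemma src2_tgt2_simps [simp]:
  assumes "a \<in> D"
  shows "src2 C a \<in> M" "tgt2 C a \<in> M"
    "src C (tgt2 C a) = src C (src2 C a)" "tgt C (tgt2 C a) = tgt C (src2 C a)"
  using src2_tgt2[OF assms] globular[OF assms] by auto

lemma src_tgt_simps [simp]:
  assumes "f \<in> M"
  shows "src C f \<in> topspace (Ob C)" "tgt C f \<in> topspace (Ob C)"
  using src_tgt[OF assms] by auto

lemma one2_simps [simp]:
  assumes "f \<in> M"
  shows "one2 C f \<in> D" "src2 C (one2 C f) = f" "tgt2 C (one2 C f) = f"
  using one2[OF assms] by (auto simp: cell_def)

lemma vcomp_simps [simp]:
  assumes "a \<in> D" "b \<in> D" "src2 C b = tgt2 C a"
  shows "b \<cdot> a \<in> D" "src2 C (b \<cdot> a) = src2 C a" "tgt2 C (b \<cdot> a) = tgt2 C b"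
  using vcomp[of a "src2 C a" "tgt2 C a" b "tgt2 C b"] assms by (auto simp: cell_def)

lemma vcomp_one2_simps [simp]:
  assumes "a \<in> D"
  shows "tgt2 C a = g \<Longrightarrow> one2 C g \<cdot> a = a" "src2 C a = f \<Longrightarrow> a \<cdot> one2 C f = a"
  using vcomp_one2_left[of a] vcomp_one2_right[of a] assms by (auto simp: cell_def)

lemma vcomp_assoc_simp [simp]:
  assumes "a \<in> D" "b \<in> D" "c \<in> D" "src2 C b = tgt2 C a" "src2 C c = tgt2 C b"
  shows "(c \<cdot> b) \<cdot> a = c \<cdot> (b \<cdot> a)"
  using vcomp_assoc[of a _ _ b _ c] assms by (simp add: cell_def)

lemma one_simps [simp]:
  assumes "x \<in> topspace (Ob C)"
  shows "one C x \<in> M" "src C (one C x) = x" "tgt C (one C x) = x"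
  using one[OF assms] by (auto simp: mor_def)

lemma comp1_simps [simp]:
  assumes "f \<in> M" "g \<in> M" "src C g = tgt C f"
  shows "g \<odot> f \<in> M" "src C (g \<odot> f) = src C f" "tgt C (g \<odot> f) = tgt C g"
  using comp1[of f _ _ g] assms by (auto simp: mor_def)

lemma hcomp_simps [simp]:
  assumes "a \<in> D" "b \<in> D" "src C (src2 C b) = tgt C (src2 C a)"
  shows "b \<star> a \<in> D" "src2 C (b \<star> a) = src2 C b \<odot> src2 C a" "tgt2 C (b \<star> a) = tgt2 C b \<odot> tgt2 C a"
  using hcomp[of a _ _ b] assms by (auto simp: cell_def)

lemma hcomp_one2_simp [simp]:
  assumes "f \<in> M" "g \<in> M" "src C g = tgt C f"
  shows "one2 C g \<star> one2 C f = one2 C (g \<odot> f)"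
  using hcomp_one2[of f _ _ g] assms by (auto simp: mor_def)

lemma assoc_simps [simp]:
  assumes "f \<in> M" "g \<in> M" "h \<in> M" "src C g = tgt C f" "src C h = tgt C g"
  shows "assoc C h g f \<in> D" "src2 C (assoc C h g f) = h \<odot> (g \<odot> f)"
    "tgt2 C (assoc C h g f) = (h \<odot> g) \<odot> f"
  using assoc[of f _ _ g _ h] assms by (auto simp: mor_def cell_def)

lemma unit_simps [simp]:
  assumes "f \<in> M"
  shows "lunit C f \<in> D" "src2 C (lunit C f) = one C (tgt C f) \<odot> f" "tgt2 C (lunit C f) = f"
    "runit C f \<in> D" "src2 C (runit C f) = f \<odot> one C (src C f)" "tgt2 C (runit C f) = f"
  using lunit[of f] runit[of f] assms by (auto simp: mor_def cell_def)

abbreviation whisker_left (infixr \<open>\<rhd>\<close> 70) where "f \<rhd> a \<equiv> one2 C f \<star> a"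
abbreviation whisker_right (infixr \<open>\<lhd>\<close> 70) where "a \<lhd> f \<equiv> a \<star> one2 C f"

lemma whisker_right_vcomp:
  assumes "a \<in> D" "b \<in> D" "src2 C b = tgt2 C a" "f \<in> M" "src C (src2 C a) = tgt C f"
  shows "(b \<cdot> a) \<lhd> f = (b \<lhd> f) \<cdot> (a \<lhd> f)"
  using interchange[of "one2 C f" f f "one2 C f" f a _ _ b] assms by (simp add: cell_def)

lemma whisker_left_vcomp:
  assumes "a \<in> D" "b \<in> D" "src2 C b = tgt2 C a" "f \<in> M" "src C f = tgt C (src2 C a)"
  shows "f \<rhd> (b \<cdot> a) = (f \<rhd> b) \<cdot> (f \<rhd> a)"
  using interchange[of a _ _ b _ "one2 C f" f f "one2 C f" f] assms by (simp add: cell_def)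

text \<open>By interchange with identities inserted on either side, both composites equal
  \<open>b \<star> a\<close>.\<close>

lemma whisker_exchange:
  assumes "a \<in> D" "b \<in> D" "src2 C a = f" "tgt2 C a = f'" "src2 C b = g" "tgt2 C b = g'"
    "src C g = tgt C f"
  shows "(g' \<rhd> a) \<cdot> (b \<lhd> f) = (b \<lhd> f') \<cdot> (g \<rhd> a)"
  using interchange[of "one2 C f" f f a f' b g g' "one2 C g'" g']
    interchange[of a f f' "one2 C f'" f' "one2 C g" g g b g'] assms
  by (auto simp: cell_def)

lemma assoc_natural_left:
  assumes "c \<in> D" "f \<in> M" "g \<in> M" "src C g = tgt C f" "src C h = tgt C g" "src2 C c = h" "tgt2 C c = h'"
  shows "assoc C h' g f \<cdot> (c \<lhd> (g \<odot> f)) = ((c \<lhd> g) \<lhd> f) \<cdot> assoc C h g f"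
  using assoc_natural[of "one2 C f" f f "one2 C g" g g c h h'] assms by (auto simp: cell_def)

lemma assoc_natural_middle:
  assumes "b \<in> D" "f \<in> M" "h \<in> M" "src C g = tgt C f" "src C h = tgt C g" "src2 C b = g" "tgt2 C b = g'"
  shows "assoc C h g' f \<cdot> (h \<rhd> (b \<lhd> f)) = ((h \<rhd> b) \<lhd> f) \<cdot> assoc C h g f"
  using assoc_natural[of "one2 C f" f f b g g' "one2 C h" h h] assms by (auto simp: cell_def)

lemma assoc_natural_right:
  assumes "a \<in> D" "g \<in> M" "h \<in> M" "src C g = tgt C f" "src C h = tgt C g" "src2 C a = f" "tgt2 C a = f'"
  shows "assoc C h g f' \<cdot> (h \<rhd> (g \<rhd> a)) = ((h \<odot> g) \<rhd> a) \<cdot> assoc C h g f"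
  using assoc_natural[of a f f' "one2 C g" g g "one2 C h" h h] assms by (auto simp: cell_def)

lemma lunit_nat:
  assumes "a \<in> D" "src2 C a = f" "tgt2 C a = f'" "y = tgt C f"
  shows "lunit C f' \<cdot> ((one C y) \<rhd> a) = a \<cdot> lunit C f"
  using lunit_natural[of a f f' "src C f" y] assms by (auto simp: cell_def mor_def)

lemma runit_nat:
  assumes "a \<in> D" "src2 C a = f" "tgt2 C a = f'" "x = src C f"
  shows "runit C f' \<cdot> (a \<lhd> (one C x)) = a \<cdot> runit C f"
  using runit_natural[of a f f' x "tgt C f"] assms by (auto simp: cell_def mor_def)

lemma pentagon_simp:
  assumes "f \<in> M" "g \<in> M" "h \<in> M" "k \<in> M" "src C g = tgt C f" "src C h = tgt C g" "src C k = tgt C h"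
  shows "assoc C (k \<odot> h) g f \<cdot> assoc C k h (g \<odot> f) =
        (assoc C k h g \<lhd> f) \<cdot> (assoc C k (h \<odot> g) f \<cdot> (k \<rhd> assoc C h g f))"
  using pentagon[of f _ _ g _ h _ k] assms by (auto simp: mor_def)

lemma triangle_simp:
  assumes "f \<in> M" "g \<in> M" "src C g = y" "tgt C f = y"
  shows "(runit C g \<lhd> f) \<cdot> assoc C g (one C y) f = g \<rhd> lunit C f"
  using triangle[of f _ y g] assms by (auto simp: mor_def)

lemma inverse_cells_unique:
  assumes "inverse_cells C a b" "inverse_cells C a b'"
  shows "b = b'"
proof -
  have a: "a \<in> D" "b \<in> D" "b' \<in> D" "src2 C b = tgt2 C a" "src2 C b' = tgt2 C a"
    "tgt2 C b = src2 C a" "tgt2 C b' = src2 C a" "b' \<cdot> a = one2 C (src2 C a)" "a \<cdot> b = one2 C (tgt2 C a)"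
    using assms unfolding inverse_cells_def by (auto simp: cell_def)
  have "b = (b' \<cdot> a) \<cdot> b" using a by (simp del: vcomp_assoc_simp)
  also have "\<dots> = b' \<cdot> (a \<cdot> b)" using a(1-7) by simp
  also have "\<dots> = b'" using a by simp
  finally show ?thesis .
qed

lemma inv_cell_eqI: "inverse_cells C a b \<Longrightarrow> inv_cell C a = b"
  unfolding inv_cell_def by (rule the_equality) (auto dest: inverse_cells_unique)

lemma inverse_cells_inv_cell: "iso_cell C a \<Longrightarrow> inverse_cells C a (inv_cell C a)"
  unfolding iso_cell_def using inv_cell_eqI by metis

lemma hom_category: "category (hom_category C x y)"
  by unfold_locales (simp_all add: hom_category_def mor_def)

end

section \<open>Cancellation of 2-cells and full faithfulness of whiskering in a 2-groupoid\<close>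

locale bigroupoid = bicategory +
  assumes two_gpd: "two_groupoid C"
begin

abbreviation vinv where "vinv \<equiv> inv_cell C"

lemma iso: "a \<in> D \<Longrightarrow> iso_cell C a"
  using two_gpd[unfolded two_groupoid_def, THEN conjunct2, THEN conjunct1] by (rule bspec)

lemma inv_simps [simp]:
  assumes "a \<in> D"
  shows "vinv a \<in> D" "src2 C (vinv a) = tgt2 C a" "tgt2 C (vinv a) = src2 C a"
    "vinv a \<cdot> a = one2 C (src2 C a)" "a \<cdot> vinv a = one2 C (tgt2 C a)"
  using inverse_cells_inv_cell[OF iso[OF assms]] unfolding inverse_cells_def cell_def by auto

lemma inv_cancel [simp]:
  assumes "a \<in> D" "b \<in> D"
  shows "tgt2 C b = src2 C a \<Longrightarrow> vinv a \<cdot> (a \<cdot> b) = b" "tgt2 C b = tgt2 C a \<Longrightarrow> a \<cdot> (vinv a \<cdot> b) = b"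
proof -
  assume b: "tgt2 C b = src2 C a"
  have "vinv a \<cdot> (a \<cdot> b) = (vinv a \<cdot> a) \<cdot> b"
    using assms b by (intro vcomp_assoc_simp[symmetric]) simp_all
  also have "\<dots> = b" unfolding inv_simps(4)[OF assms(1)] using assms b by simp
  finally show "vinv a \<cdot> (a \<cdot> b) = b" .
next
  assume b: "tgt2 C b = tgt2 C a"
  have "a \<cdot> (vinv a \<cdot> b) = (a \<cdot> vinv a) \<cdot> b"
    using assms b by (intro vcomp_assoc_simp[symmetric]) simp_all
  also have "\<dots> = b" unfolding inv_simps(5)[OF assms(1)] using assms b by simp
  finally show "a \<cdot> (vinv a \<cdot> b) = b" .
qed

lemma cancel_left:
  assumes "a \<in> D" "b \<in> D" "c \<in> D" "tgt2 C a = src2 C c" "tgt2 C b = src2 C c" "c \<cdot> a = c \<cdot> b"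
  shows "a = b"
proof -
  have "a = vinv c \<cdot> (c \<cdot> a)" using assms(1-5) by simp
  also have "\<dots> = vinv c \<cdot> (c \<cdot> b)" by (simp only: assms(6))
  also have "\<dots> = b" using assms(1-5) by simp
  finally show ?thesis .
qed

lemma cancel_right:
  assumes "a \<in> D" "b \<in> D" "c \<in> D" "src2 C a = tgt2 C c" "src2 C b = tgt2 C c" "a \<cdot> c = b \<cdot> c"
  shows "a = b"
proof -
  have "a = (a \<cdot> c) \<cdot> vinv c" using assms(1-5) by simp
  also have "\<dots> = (b \<cdot> c) \<cdot> vinv c" by (simp only: assms(6))
  also have "\<dots> = b" using assms(1-5) by simp
  finally show ?thesis .
qed

lemma precompose_equivalence:
  assumes "f \<in> M" "tgt C f = x" "src C f = x'" "y \<in> topspace (Ob C)"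
  shows "is_equivalence (hom_category C x y) (hom_category C x' y) (\<lambda>h. h \<odot> f) (\<lambda>a. a \<lhd> f)"
  using two_gpd[unfolded two_groupoid_def, THEN conjunct2, THEN conjunct2,
      rule_format, of f x' x y, THEN conjunct1] assms by (simp add: mor_def)

lemma postcompose_equivalence:
  assumes "f \<in> M" "src C f = x" "tgt C f = x'" "y \<in> topspace (Ob C)"
  shows "is_equivalence (hom_category C y x) (hom_category C y x') (\<lambda>h. f \<odot> h) (\<lambda>a. f \<rhd> a)"
  using two_gpd[unfolded two_groupoid_def, THEN conjunct2, THEN conjunct2,
      rule_format, of f x x' y, THEN conjunct2] assms by (simp add: mor_def)

lemma whisker_right_faithful:
  assumes "a \<in> D" "b \<in> D" "src2 C a = src2 C b" "tgt2 C a = tgt2 C b" "f \<in> M" "tgt C f = src C (src2 C a)"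
    "a \<lhd> f = b \<lhd> f"
  shows "a = b"
proof -
  have "is_equivalence (hom_category C (tgt C f) (tgt C (src2 C a))) (hom_category C (src C f) (tgt C (src2 C a)))
          (\<lambda>h. h \<odot> f) (\<lambda>a. a \<lhd> f)"
    using assms by (intro precompose_equivalence) auto
  from equivalence_faithful[OF hom_category this] show ?thesis
    using assms by (auto simp: hom_category_def mor_def)
qed

lemma whisker_left_faithful:
  assumes "a \<in> D" "b \<in> D" "src2 C a = src2 C b" "tgt2 C a = tgt2 C b" "f \<in> M" "src C f = tgt C (src2 C a)"
    "f \<rhd> a = f \<rhd> b"
  shows "a = b"
proof -
  have "is_equivalence (hom_category C (src C (src2 C a)) (src C f)) (hom_category C (src C (src2 C a)) (tgt C f))
          (\<lambda>h. f \<odot> h) (\<lambda>a. f \<rhd> a)"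
    using assms by (intro postcompose_equivalence) auto
  from equivalence_faithful[OF hom_category this] show ?thesis
    using assms by (auto simp: hom_category_def mor_def)
qed

lemma whisker_right_full:
  assumes "h \<in> M" "h' \<in> M" "f \<in> M" "src C h = tgt C f" "src C h' = tgt C f" "tgt C h = tgt C h'"
    "c \<in> D" "src2 C c = h \<odot> f" "tgt2 C c = h' \<odot> f"
  obtains a where "a \<in> D" "src2 C a = h" "tgt2 C a = h'" "a \<lhd> f = c"
proof -
  have "is_equivalence (hom_category C (tgt C f) (tgt C h)) (hom_category C (src C f) (tgt C h))
          (\<lambda>h. h \<odot> f) (\<lambda>a. a \<lhd> f)"
    using assms by (intro precompose_equivalence) auto
  from equivalence_full[OF hom_category hom_category this, of h h' c] show ?thesis
    using assms that by (auto simp: hom_category_def mor_def)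
qed

lemma whisker_left_full:
  assumes "h \<in> M" "h' \<in> M" "f \<in> M" "src C f = tgt C h" "src C f = tgt C h'" "src C h = src C h'"
    "c \<in> D" "src2 C c = f \<odot> h" "tgt2 C c = f \<odot> h'"
  obtains a where "a \<in> D" "src2 C a = h" "tgt2 C a = h'" "f \<rhd> a = c"
proof -
  have "is_equivalence (hom_category C (src C h) (src C f)) (hom_category C (src C h) (tgt C f))
          (\<lambda>h. f \<odot> h) (\<lambda>a. f \<rhd> a)"
    using assms by (intro postcompose_equivalence) auto
  from equivalence_full[OF hom_category hom_category this, of h h' c] show ?thesis
    using assms that by (auto simp: hom_category_def mor_def)
qed

text \<open>Essential surjectivity of precomposition with \<open>f\<close>, applied to an identity
  1-morphism. This yields just a unit; a counit adapted to it is constructed in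
  \<open>adjoint_equivalence_exists\<close>.\<close>

lemma left_quasi_inverse:
  assumes "f \<in> M"
  obtains g e where "g \<in> M" "src C g = tgt C f" "tgt C g = src C f"
    "e \<in> D" "src2 C e = one C (src C f)" "tgt2 C e = g \<odot> f"
proof -
  have e: "is_equivalence (hom_category C (tgt C f) (src C f)) (hom_category C (src C f) (src C f))
          (\<lambda>h. h \<odot> f) (\<lambda>a. a \<lhd> f)"
    using assms by (intro precompose_equivalence) auto
  have "one C (src C f) \<in> Obj (hom_category C (src C f) (src C f))"
    using assms by (simp add: hom_category_def mor_def)
  from equivalence_essentially_surjective[OF e this] obtain g t
    where g: "g \<in> Obj (hom_category C (tgt C f) (src C f))" "is_iso (hom_category C (src C f) (src C f)) t"
      "cdom (hom_category C (src C f) (src C f)) t = g \<odot> f"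
      "ccod (hom_category C (src C f) (src C f)) t = one C (src C f)" .
  then have "g \<in> M" "src C g = tgt C f" "tgt C g = src C f" "t \<in> D" "tgt2 C t = one C (src C f)" "src2 C t = g \<odot> f"
    by (simp_all add: hom_category_def mor_def is_iso_def)
  then show thesis using that[of g "vinv t"] by simp
qed

end

context bicategory
begin

text \<open>Composites are kept nested to the right, so a composite of two cells is no longer a
  subterm once a tail \<open>r\<close> follows. This form rewrites the head of such a composite;
  \<open>vcomp_extend1\<close> does so when one side is a single cell.\<close>

lemma vcomp_extend:
  assumes "a \<cdot> b = c \<cdot> d" "a \<in> D" "b \<in> D" "c \<in> D" "d \<in> D" "r \<in> D"
    "src2 C a = tgt2 C b" "src2 C c = tgt2 C d" "src2 C b = tgt2 C r" "src2 C d = tgt2 C r"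
  shows "a \<cdot> (b \<cdot> r) = c \<cdot> (d \<cdot> r)"
  using vcomp_assoc_simp[OF assms(6,3,2,9,7)] vcomp_assoc_simp[OF assms(6,5,4,10,8)]
  by (simp only: assms(1))

lemma vcomp_extend1:
  assumes "a \<cdot> b = c" "a \<in> D" "b \<in> D" "r \<in> D"
    "src2 C a = tgt2 C b" "src2 C b = tgt2 C r"
  shows "a \<cdot> (b \<cdot> r) = c \<cdot> r"
  using vcomp_assoc_simp[OF assms(4,3,2,6,5)] by (simp only: assms(1))

end

section \<open>Inverse 2-cells and coherence of the unit isomorphisms\<close>

context bigroupoid
begin

text \<open>Every cell of a 2-groupoid is invertible, so a one-sided inverse is the inverse.\<close>

lemma vinv_eqI:
  assumes "a \<in> D" "b \<in> D" "src2 C b = tgt2 C a" "b \<cdot> a = one2 C (src2 C a)"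
  shows "vinv a = b"
proof -
  have "tgt2 C b = src2 C a" using vcomp_simps(3)[OF assms(1-3)] assms by simp
  moreover have "vinv a \<cdot> a = b \<cdot> a" using assms by simp
  ultimately show ?thesis using assms(1-3) by - (rule cancel_right[of "vinv a" b a], simp_all)
qed

lemma vinv_whisker_right:
  assumes "a \<in> D" "f \<in> M" "src C (src2 C a) = tgt C f"
  shows "vinv (a \<lhd> f) = vinv a \<lhd> f"
  using assms by (intro vinv_eqI) (simp_all add: whisker_right_vcomp[symmetric])

lemma vinv_whisker_left:
  assumes "a \<in> D" "f \<in> M" "tgt C (src2 C a) = src C f"
  shows "vinv (f \<rhd> a) = f \<rhd> vinv a"
  using assms by (intro vinv_eqI) (simp_all add: whisker_left_vcomp[symmetric])

lemma move_inv_left: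
  assumes "a \<cdot> b = c" "a \<in> D" "b \<in> D" "src2 C a = tgt2 C b"
  shows "b = vinv a \<cdot> c"
  using assms(2-4) unfolding assms(1)[symmetric] by simp

text \<open>Carries a commuting square over to the inverses of two of its sides. In this way
  naturality and coherence equations are transferred to inverse associators and inverse unit
  isomorphisms.\<close>

lemma move_inv_square:
  assumes "a \<cdot> b = c \<cdot> d" "a \<in> D" "b \<in> D" "c \<in> D" "d \<in> D" "src2 C a = tgt2 C b" "src2 C c = tgt2 C d"
  shows "b \<cdot> vinv d = vinv a \<cdot> c"
proof -
  have t: "src2 C b = src2 C d" "tgt2 C a = tgt2 C c"
    using vcomp_simps(2,3)[OF assms(3,2,6)] vcomp_simps(2,3)[OF assms(5,4,7)] assms(1) by simp_all
  have "b = vinv a \<cdot> (c \<cdot> d)" using move_inv_left[OF assms(1-3,6)] .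
  then have "b \<cdot> vinv d = (vinv a \<cdot> (c \<cdot> d)) \<cdot> vinv d" by simp
  also have "\<dots> = vinv a \<cdot> c" using assms(2-7) t by simp
  finally show ?thesis .
qed

text \<open>Kelly's argument: this coherence law is not an axiom, but it follows from pentagon and
  triangle after both sides are whiskered by the identity \<open>i\<close>, and whiskering by
  \<open>i\<close> is faithful.\<close>

lemma lunit_comp:
  assumes "f \<in> M" "h \<in> M" "src C f = tgt C h" "tgt C f = y"
  shows "(lunit C f \<lhd> h) \<cdot> assoc C (one C y) f h = lunit C (f \<odot> h)"
proof -
  define i where "i = one C y"
  have i: "i \<in> M" "src C i = y" "tgt C i = y" "one C y = i" using assms unfolding i_def by auto
  note si = assms i
  have "assoc C i f h \<cdot> (i \<rhd> lunit C (f \<odot> h))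
      = assoc C i f h \<cdot> ((runit C i \<lhd> (f \<odot> h)) \<cdot> assoc C i i (f \<odot> h))"
    using triangle_simp[of "f \<odot> h" i y] si by simp
  also have "\<dots> = ((runit C i \<lhd> f) \<lhd> h) \<cdot> (assoc C (i \<odot> i) f h \<cdot> assoc C i i (f \<odot> h))"
    using si by (intro vcomp_extend[OF assoc_natural_left]) simp_all
  also have "\<dots> = ((runit C i \<lhd> f) \<lhd> h) \<cdot> ((assoc C i i f \<lhd> h) \<cdot> (assoc C i (i \<odot> f) h \<cdot> (i \<rhd> assoc C i f h)))"
    using si by (subst pentagon_simp) simp_all
  also have "\<dots> = ((i \<rhd> lunit C f) \<lhd> h) \<cdot> (assoc C i (i \<odot> f) h \<cdot> (i \<rhd> assoc C i f h))"
    using si triangle_simp[of f i y]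
    by (intro vcomp_extend1) (simp_all add: whisker_right_vcomp[symmetric])
  also have "\<dots> = assoc C i f h \<cdot> ((i \<rhd> (lunit C f \<lhd> h)) \<cdot> (i \<rhd> assoc C i f h))"
    using si by (intro vcomp_extend[OF assoc_natural_middle[symmetric]]) simp_all
  also have "\<dots> = assoc C i f h \<cdot> (i \<rhd> ((lunit C f \<lhd> h) \<cdot> assoc C i f h))"
    using si by (subst whisker_left_vcomp) simp_all
  finally have "i \<rhd> lunit C (f \<odot> h) = i \<rhd> ((lunit C f \<lhd> h) \<cdot> assoc C i f h)"
    by (rule cancel_left[rotated 5]) (use si in simp_all)
  then have "lunit C (f \<odot> h) = (lunit C f \<lhd> h) \<cdot> assoc C i f h"
    by (rule whisker_left_faithful[rotated 6]) (use si in simp_all)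
  then show ?thesis unfolding i_def by simp
qed

text \<open>Mirror image of \<open>lunit_comp\<close>: both sides are whiskered by the identity on
  the right, and the pentagon is used for \<open>h\<close>, \<open>f\<close>, \<open>i\<close>,
  \<open>i\<close>.\<close>

lemma runit_comp:
  assumes "f \<in> M" "h \<in> M" "src C h = tgt C f" "src C f = x"
  shows "runit C (h \<odot> f) \<cdot> assoc C h f (one C x) = h \<rhd> runit C f"
proof -
  define i where "i = one C x"
  have i: "i \<in> M" "src C i = x" "tgt C i = x" "one C x = i" using assms unfolding i_def by auto
  note si = assms i
  have "((h \<rhd> runit C f) \<lhd> i) \<cdot> (assoc C h (f \<odot> i) i \<cdot> (h \<rhd> assoc C f i i))
     = assoc C h f i \<cdot> ((h \<rhd> (runit C f \<lhd> i)) \<cdot> (h \<rhd> assoc C f i i))"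
    using si by (intro vcomp_extend[OF assoc_natural_middle[symmetric]]) simp_all
  also have "\<dots> = assoc C h f i \<cdot> (h \<rhd> ((runit C f \<lhd> i) \<cdot> assoc C f i i))"
    using si by (subst whisker_left_vcomp) simp_all
  also have "\<dots> = assoc C h f i \<cdot> (h \<rhd> (f \<rhd> lunit C i))"
    using si triangle_simp[of i f x] by simp
  also have "\<dots> = ((h \<odot> f) \<rhd> lunit C i) \<cdot> assoc C h f (i \<odot> i)"
    using si by (intro assoc_natural_right) simp_all
  also have "\<dots> = ((runit C (h \<odot> f) \<lhd> i) \<cdot> assoc C (h \<odot> f) i i) \<cdot> assoc C h f (i \<odot> i)"
    using si triangle_simp[of i "h \<odot> f" x] by simp
  also have "\<dots> = (runit C (h \<odot> f) \<lhd> i) \<cdot> (assoc C (h \<odot> f) i i \<cdot> assoc C h f (i \<odot> i))"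
    using si by simp
  also have "\<dots> = (runit C (h \<odot> f) \<lhd> i) \<cdot> ((assoc C h f i \<lhd> i) \<cdot> (assoc C h (f \<odot> i) i \<cdot> (h \<rhd> assoc C f i i)))"
    using si by (subst pentagon_simp) simp_all
  also have "\<dots> = ((runit C (h \<odot> f) \<cdot> assoc C h f i) \<lhd> i) \<cdot> (assoc C h (f \<odot> i) i \<cdot> (h \<rhd> assoc C f i i))"
    using si by (intro vcomp_extend1) (simp_all add: whisker_right_vcomp[symmetric])
  finally have "(h \<rhd> runit C f) \<lhd> i = (runit C (h \<odot> f) \<cdot> assoc C h f i) \<lhd> i"
    by (rule cancel_right[rotated 5]) (use si in simp_all)
  then have "h \<rhd> runit C f = runit C (h \<odot> f) \<cdot> assoc C h f i"
    by (rule whisker_right_faithful[rotated 6]) (use si in simp_all)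
  then show ?thesis unfolding i_def by simp
qed

text \<open>Naturality of \<open>lunit\<close> at \<open>lunit C i\<close> itself identifies
  \<open>i \<rhd> lunit C i\<close> with \<open>lunit C (i \<odot> i)\<close>. The triangle and
  \<open>lunit_comp\<close> then express this cell through \<open>runit C i \<lhd> i\<close> and
  \<open>lunit C i \<lhd> i\<close> with the same associator.\<close>

lemma lunit_one:
  assumes "x \<in> topspace (Ob C)"
  shows "lunit C (one C x) = runit C (one C x)"
proof -
  define i where "i = one C x"
  have i: "i \<in> M" "src C i = x" "tgt C i = x" "one C x = i" using assms unfolding i_def by auto
  have "lunit C i \<cdot> (i \<rhd> lunit C i) = lunit C i \<cdot> lunit C (i \<odot> i)"
    unfolding i(4)[symmetric] by (rule lunit_nat) (use i assms in simp_all)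
  then have "i \<rhd> lunit C i = lunit C (i \<odot> i)"
    by (rule cancel_left[rotated 5]) (use i in simp_all)
  then have "(lunit C i \<lhd> i) \<cdot> assoc C i i i = (runit C i \<lhd> i) \<cdot> assoc C i i i"
    using triangle_simp[of i i x, unfolded i(4)] lunit_comp[of i i x, unfolded i(4)] i(1-3) by (simp only:)
  then have "lunit C i \<lhd> i = runit C i \<lhd> i"
    by (rule cancel_right[rotated 5]) (use i in simp_all)
  then have "lunit C i = runit C i"
    by (rule whisker_right_faithful[rotated 6]) (use i in simp_all)
  then show ?thesis unfolding i_def .
qed

end

section \<open>Adjoint equivalences\<close>

context bigroupoid
begin

text \<open>Read from the right, the cell runs through h, h id, h (f g), (h f) g, (h' f) g, h' (f
  g), h' id, h'. It inverts whiskering by \<open>f\<close> and is made of operations that are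
  continuous in families.\<close>

definition unwhisker_right where
  "unwhisker_right h h' f g e c = runit C h' \<cdot> (h' \<rhd> e) \<cdot> vinv (assoc C h' f g) \<cdot> (c \<lhd> g)
     \<cdot> assoc C h f g \<cdot> (h \<rhd> vinv e) \<cdot> vinv (runit C h)"

text \<open>The counterpart on the other side, with a unit \<open>n\<close> from the identity to
  \<open>g \<odot> f\<close> in place of a counit.\<close>

definition unwhisker_left where
  "unwhisker_left h h' f g n c = lunit C h' \<cdot> (vinv n \<lhd> h') \<cdot> assoc C g f h' \<cdot> (g \<rhd> c)
     \<cdot> vinv (assoc C g f h) \<cdot> (n \<lhd> h) \<cdot> vinv (lunit C h)"

text \<open>Naturality carries \<open>a\<close> through the associator, exchange carries it past
  \<open>e\<close>, and naturality of \<open>runit\<close> frees it from the identity; the cells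
  around it cancel in pairs. This shows that the formula is a left inverse; that it solves the
  whiskering equation for every cell of the right type needs fullness and is
  \<open>whisker_right_solve\<close>.\<close>

lemma unwhisker_right:
  assumes "a \<in> D" "src2 C a = h" "tgt2 C a = h'" "h \<in> M" "h' \<in> M" "src C h = x" "src C h' = x"
    and "f \<in> M" "g \<in> M" "src C g = x" "tgt C f = x" "tgt C g = src C f"
    and "e \<in> D" "src2 C e = f \<odot> g" "tgt2 C e = one C x"
  shows "unwhisker_right h h' f g e (a \<lhd> f) = a"
proof -
  have x: "x \<in> topspace (Ob C)" using assms(4,6) by auto
  note si = assms x
  have 1: "((a \<lhd> f) \<lhd> g) \<cdot> assoc C h f g = assoc C h' f g \<cdot> (a \<lhd> (f \<odot> g))"
    using si by (intro assoc_natural_left[symmetric]) simp_all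
  have 2: "(h' \<rhd> e) \<cdot> (a \<lhd> (f \<odot> g)) = (a \<lhd> (one C x)) \<cdot> (h \<rhd> e)"
    using si by (intro whisker_exchange) simp_all
  have 3: "(h \<rhd> e) \<cdot> (h \<rhd> vinv e) = one2 C (h \<odot> one C x)"
    using si by (subst whisker_left_vcomp[symmetric]) simp_all
  have 4: "runit C h' \<cdot> (a \<lhd> (one C x)) = a \<cdot> runit C h"
    using si by (intro runit_nat) simp_all
  have "unwhisker_right h h' f g e (a \<lhd> f) = runit C h' \<cdot> (h' \<rhd> e) \<cdot> vinv (assoc C h' f g)
     \<cdot> assoc C h' f g \<cdot> (a \<lhd> (f \<odot> g)) \<cdot> (h \<rhd> vinv e) \<cdot> vinv (runit C h)"
    unfolding unwhisker_right_def using si by (subst vcomp_extend[OF 1]) simp_all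
  also have "\<dots> = runit C h' \<cdot> (h' \<rhd> e) \<cdot> (a \<lhd> (f \<odot> g)) \<cdot> (h \<rhd> vinv e) \<cdot> vinv (runit C h)"
    using si by simp
  also have "\<dots> = runit C h' \<cdot> (a \<lhd> (one C x)) \<cdot> (h \<rhd> e) \<cdot> (h \<rhd> vinv e) \<cdot> vinv (runit C h)"
    using si by (subst vcomp_extend[OF 2]) simp_all
  also have "\<dots> = runit C h' \<cdot> (a \<lhd> (one C x)) \<cdot> vinv (runit C h)"
    using si by (subst vcomp_extend1[OF 3]) simp_all
  also have "\<dots> = a \<cdot> runit C h \<cdot> vinv (runit C h)"
    using si by (subst vcomp_extend[OF 4]) simp_all
  also have "\<dots> = a" using si by simp
  finally show ?thesis .
qed

lemma unwhisker_left:
  assumes "a \<in> D" "src2 C a = h" "tgt2 C a = h'" "h \<in> M" "h' \<in> M" "tgt C h = x" "tgt C h' = x"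
    and "f \<in> M" "g \<in> M" "src C f = x" "tgt C g = x" "src C g = tgt C f"
    and "n \<in> D" "src2 C n = one C x" "tgt2 C n = g \<odot> f"
  shows "unwhisker_left h h' f g n (f \<rhd> a) = a"
proof -
  have x: "x \<in> topspace (Ob C)" using assms(4,6) by auto
  have "src C (src2 C a) = src C (tgt2 C a)" using assms(1) by simp
  then have "src C h' = src C h" using assms(2,3) by simp
  note si = assms x this
  have 1: "assoc C g f h' \<cdot> (g \<rhd> (f \<rhd> a)) = ((g \<odot> f) \<rhd> a) \<cdot> assoc C g f h"
    using si by (intro assoc_natural_right) simp_all
  have 2: "((g \<odot> f) \<rhd> a) \<cdot> (n \<lhd> h) = (n \<lhd> h') \<cdot> ((one C x) \<rhd> a)"
    using si by (intro whisker_exchange) simp_all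
  have 3: "(vinv n \<lhd> h') \<cdot> (n \<lhd> h') = one2 C (one C x \<odot> h')"
    using si by (subst whisker_right_vcomp[symmetric]) simp_all
  have 4: "lunit C h' \<cdot> ((one C x) \<rhd> a) = a \<cdot> lunit C h"
    using si by (intro lunit_nat) simp_all
  have "unwhisker_left h h' f g n (f \<rhd> a) = lunit C h' \<cdot> (vinv n \<lhd> h') \<cdot> ((g \<odot> f) \<rhd> a)
     \<cdot> assoc C g f h \<cdot> vinv (assoc C g f h) \<cdot> (n \<lhd> h) \<cdot> vinv (lunit C h)"
    unfolding unwhisker_left_def using si by (subst vcomp_extend[OF 1]) simp_all
  also have "\<dots> = lunit C h' \<cdot> (vinv n \<lhd> h') \<cdot> ((g \<odot> f) \<rhd> a) \<cdot> (n \<lhd> h) \<cdot> vinv (lunit C h)"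
    using si by simp
  also have "\<dots> = lunit C h' \<cdot> (vinv n \<lhd> h') \<cdot> (n \<lhd> h') \<cdot> ((one C x) \<rhd> a) \<cdot> vinv (lunit C h)"
    using si by (subst vcomp_extend[OF 2]) simp_all
  also have "\<dots> = lunit C h' \<cdot> ((one C x) \<rhd> a) \<cdot> vinv (lunit C h)"
    using si by (subst vcomp_extend1[OF 3]) simp_all
  also have "\<dots> = a \<cdot> lunit C h \<cdot> vinv (lunit C h)"
    using si by (subst vcomp_extend[OF 4]) simp_all
  also have "\<dots> = a" using si by simp
  finally show ?thesis .
qed

text \<open>
  For an adjoint equivalence \<open>f \<stileturn> g\<close> the 2-cells \<open>u \<odot> g \<Rightarrow> h\<close> correspond to the
  2-cells \<open>u \<Rightarrow> h \<odot> f\<close>, and the 2-cells \<open>g \<odot> u \<Rightarrow> h\<close> to the 2-cells \<open>u \<Rightarrow> f \<odot> h\<close>.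
\<close>

definition transpose_right where
  "transpose_right u f g n t = (t \<lhd> f) \<cdot> assoc C u g f \<cdot> (u \<rhd> n) \<cdot> vinv (runit C u)"

definition cotranspose_right where
  "cotranspose_right h f g e w = runit C h \<cdot> (h \<rhd> e) \<cdot> vinv (assoc C h f g) \<cdot> (w \<lhd> g)"

definition transpose_left where
  "transpose_left u f g e t = (f \<rhd> t) \<cdot> vinv (assoc C f g u) \<cdot> (vinv e \<lhd> u) \<cdot> vinv (lunit C u)"

definition cotranspose_left where
  "cotranspose_left h f g n w = lunit C h \<cdot> (vinv n \<lhd> h) \<cdot> assoc C g f h \<cdot> (g \<rhd> w)"

text \<open>The first identity of \<open>adjoint_equivalence\<close>, isolated because both round
  trips below rest on it and because \<open>adjoint_equivalence_exists\<close> uses such a round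
  trip to derive the second identity.\<close>

definition triangle_identity where
  "triangle_identity f g n e \<longleftrightarrow>
     lunit C f \<cdot> (e \<lhd> f) \<cdot> assoc C f g f \<cdot> (f \<rhd> n) \<cdot> vinv (runit C f) = one2 C f"

text \<open>The round trip in the order that lifting demands: a given cell is cotransposed to start
  the lift and transposed back afterwards. Naturality moves \<open>w\<close> to the right end, and
  the pentagon and the unit coherences turn the rest into \<open>h\<close> whiskered with the
  triangle identity.\<close>

lemma transpose_cotranspose_right:
  assumes "f \<in> M" "g \<in> M" "src C f = x" "tgt C f = y" "src C g = y" "tgt C g = x"
    and "n \<in> D" "src2 C n = one C x" "tgt2 C n = g \<odot> f"
    and "e \<in> D" "src2 C e = f \<odot> g" "tgt2 C e = one C y"
    and "triangle_identity f g n e"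
    and "u \<in> M" "h \<in> M" "src C u = x" "src C h = y" "tgt C u = tgt C h"
    and "w \<in> D" "src2 C w = u" "tgt2 C w = h \<odot> f"
  shows "transpose_right u f g n (cotranspose_right h f g e w) = w"
proof -
  have o: "x \<in> topspace (Ob C)" "y \<in> topspace (Ob C)" using assms by auto
  define i j where "i = one C x" and "j = one C y"
  have ij: "i \<in> M" "j \<in> M" "src C i = x" "tgt C i = x" "src C j = y" "tgt C j = y" "one C x = i" "one C y = j"
    using o unfolding i_def j_def by auto
  note si = assms(1-12,14-21) o ij
  have 1: "((w \<lhd> g) \<lhd> f) \<cdot> assoc C u g f = assoc C (h \<odot> f) g f \<cdot> (w \<lhd> (g \<odot> f))"
    using si by (intro assoc_natural_left[symmetric]) simp_all
  have 2: "(w \<lhd> (g \<odot> f)) \<cdot> (u \<rhd> n) = ((h \<odot> f) \<rhd> n) \<cdot> (w \<lhd> i)"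
    using si by (intro whisker_exchange[symmetric]) simp_all
  have "runit C (h \<odot> f) \<cdot> (w \<lhd> i) = w \<cdot> runit C u"
    using si by (intro runit_nat[where x = x, unfolded ij(7)]) simp_all
  from move_inv_square[OF this]
  have 3: "(w \<lhd> i) \<cdot> vinv (runit C u) = vinv (runit C (h \<odot> f)) \<cdot> w"
    using si by simp
  have "runit C (h \<odot> f) \<cdot> assoc C h f i = h \<rhd> runit C f"
    using si runit_comp[of f h x] by simp
  then have "runit C (h \<odot> f) \<cdot> assoc C h f i = one2 C (h \<odot> f) \<cdot> (h \<rhd> runit C f)"
    using si by simp
  from move_inv_square[OF this]
  have 4: "vinv (runit C (h \<odot> f)) = assoc C h f i \<cdot> (h \<rhd> vinv (runit C f))"
    using si by (simp add: vinv_whisker_left)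
  have 5: "((h \<odot> f) \<rhd> n) \<cdot> assoc C h f i = assoc C h f (g \<odot> f) \<cdot> (h \<rhd> (f \<rhd> n))"
    using si by (intro assoc_natural_right[symmetric]) simp_all
  have "assoc C (h \<odot> f) g f \<cdot> assoc C h f (g \<odot> f) =
      (assoc C h f g \<lhd> f) \<cdot> (assoc C h (f \<odot> g) f \<cdot> (h \<rhd> assoc C f g f))"
    using si by (intro pentagon_simp) simp_all
  then have 6: "(vinv (assoc C h f g) \<lhd> f) \<cdot> (assoc C (h \<odot> f) g f \<cdot> assoc C h f (g \<odot> f)) =
      assoc C h (f \<odot> g) f \<cdot> (h \<rhd> assoc C f g f)"
    using si by (simp add: vinv_whisker_right[symmetric])
  have 7: "((h \<rhd> e) \<lhd> f) \<cdot> assoc C h (f \<odot> g) f = assoc C h j f \<cdot> (h \<rhd> (e \<lhd> f))"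
    using si by (intro assoc_natural_middle[symmetric]) simp_all
  have 8: "(runit C h \<lhd> f) \<cdot> assoc C h j f = h \<rhd> lunit C f"
    using si triangle_simp[of f h y] by simp
  have T: "lunit C f \<cdot> (e \<lhd> f) \<cdot> assoc C f g f \<cdot> (f \<rhd> n) \<cdot> vinv (runit C f) = one2 C f"
    using assms(13) unfolding triangle_identity_def .
  let ?z = "(h \<rhd> (f \<rhd> n)) \<cdot> (h \<rhd> vinv (runit C f)) \<cdot> w"
  let ?R = "\<lambda>y. (runit C h \<lhd> f) \<cdot> ((h \<rhd> e) \<lhd> f) \<cdot> y"
  have "transpose_right u f g n (cotranspose_right h f g e w)
    = ?R ((vinv (assoc C h f g) \<lhd> f) \<cdot>
      ((w \<lhd> g) \<lhd> f) \<cdot> assoc C u g f \<cdot> (u \<rhd> n) \<cdot> vinv (runit C u))"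
    unfolding transpose_right_def cotranspose_right_def using si
    by (simp add: whisker_right_vcomp)
  also have "\<dots> = ?R ((vinv (assoc C h f g) \<lhd> f) \<cdot>
      assoc C (h \<odot> f) g f \<cdot> (w \<lhd> (g \<odot> f)) \<cdot> (u \<rhd> n) \<cdot> vinv (runit C u))"
    using si by (subst vcomp_extend[OF 1]) simp_all
  also have "\<dots> = ?R ((vinv (assoc C h f g) \<lhd> f) \<cdot>
      assoc C (h \<odot> f) g f \<cdot> ((h \<odot> f) \<rhd> n) \<cdot> (w \<lhd> i) \<cdot> vinv (runit C u))"
    using si by (subst vcomp_extend[OF 2]) simp_all
  also have "\<dots> = ?R ((vinv (assoc C h f g) \<lhd> f) \<cdot>
      assoc C (h \<odot> f) g f \<cdot> ((h \<odot> f) \<rhd> n) \<cdot> assoc C h f i \<cdot> (h \<rhd> vinv (runit C f)) \<cdot> w)"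
    unfolding 3 unfolding 4 using si by simp
  also have "\<dots> = ?R ((vinv (assoc C h f g) \<lhd> f) \<cdot>
      assoc C (h \<odot> f) g f \<cdot> assoc C h f (g \<odot> f) \<cdot> ?z)"
    using si by (subst vcomp_extend[OF 5]) simp_all
  also have "\<dots> = ?R (((vinv (assoc C h f g) \<lhd> f) \<cdot> (assoc C (h \<odot> f) g f \<cdot> assoc C h f (g \<odot> f))) \<cdot> ?z)"
    using si by simp
  also have "\<dots> = ?R (assoc C h (f \<odot> g) f \<cdot> (h \<rhd> assoc C f g f) \<cdot> ?z)"
    unfolding 6 using si by simp
  also have "\<dots> = (runit C h \<lhd> f) \<cdot> assoc C h j f \<cdot> (h \<rhd> (e \<lhd> f)) \<cdot> (h \<rhd> assoc C f g f) \<cdot> ?z"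
    using si by (subst vcomp_extend[OF 7]) simp_all
  also have "\<dots> = (h \<rhd> lunit C f) \<cdot> (h \<rhd> (e \<lhd> f)) \<cdot> (h \<rhd> assoc C f g f) \<cdot> ?z"
    using si by (subst vcomp_extend1[OF 8]) simp_all
  also have "\<dots> = (h \<rhd> (lunit C f \<cdot> (e \<lhd> f) \<cdot> assoc C f g f \<cdot> (f \<rhd> n) \<cdot> vinv (runit C f))) \<cdot> w"
    using si by (simp add: whisker_left_vcomp)
  also have "\<dots> = w" unfolding T using si by simp
  finally show ?thesis .
qed

text \<open>Again \<open>w\<close> is moved to the right end. Now the transpositions contain the
  inverses of \<open>e\<close> and \<open>n\<close>, so the triangle identity appears only after
  passing to the inverse of the remaining cell.\<close>

lemma transpose_cotranspose_left:
  assumes "f \<in> M" "g \<in> M" "src C f = x" "tgt C f = y" "src C g = y" "tgt C g = x"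
    and "n \<in> D" "src2 C n = one C x" "tgt2 C n = g \<odot> f"
    and "e \<in> D" "src2 C e = f \<odot> g" "tgt2 C e = one C y"
    and "triangle_identity f g n e"
    and "u \<in> M" "h \<in> M" "tgt C u = y" "tgt C h = x" "src C u = src C h"
    and "w \<in> D" "src2 C w = u" "tgt2 C w = f \<odot> h"
  shows "transpose_left u f g e (cotranspose_left h f g n w) = w"
proof -
  have o: "x \<in> topspace (Ob C)" "y \<in> topspace (Ob C)" using assms by auto
  define i j where "i = one C x" and "j = one C y"
  have ij: "i \<in> M" "j \<in> M" "src C i = x" "tgt C i = x" "src C j = y" "tgt C j = y" "one C x = i" "one C y = j"
    using o unfolding i_def j_def by auto
  note si = assms(1-12,14-21) o ij
  have "assoc C f g (f \<odot> h) \<cdot> (f \<rhd> (g \<rhd> w)) = ((f \<odot> g) \<rhd> w) \<cdot> assoc C f g u"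
    using si by (intro assoc_natural_right) simp_all
  from move_inv_square[OF this]
  have 1: "(f \<rhd> (g \<rhd> w)) \<cdot> vinv (assoc C f g u) = vinv (assoc C f g (f \<odot> h)) \<cdot> ((f \<odot> g) \<rhd> w)"
    using si by simp
  have 2: "((f \<odot> g) \<rhd> w) \<cdot> (vinv e \<lhd> u) = (vinv e \<lhd> (f \<odot> h)) \<cdot> (j \<rhd> w)"
    using si by (intro whisker_exchange) simp_all
  have "lunit C (f \<odot> h) \<cdot> (j \<rhd> w) = w \<cdot> lunit C u"
    using si by (intro lunit_nat[where y = y, unfolded ij(8)]) simp_all
  from move_inv_square[OF this]
  have 3: "(j \<rhd> w) \<cdot> vinv (lunit C u) = vinv (lunit C (f \<odot> h)) \<cdot> w"
    using si by simp
  \<comment> \<open>\<open>Y\<close> is what is left once \<open>w\<close> has been moved out.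
    \<open>Z\<close> is its inverse, written with \<open>n\<close> and \<open>e\<close> themselves,
    so that the triangle identity whiskered by \<open>h\<close> applies to it.\<close>
  define Z where "Z = lunit C (f \<odot> h) \<cdot> (e \<lhd> (f \<odot> h)) \<cdot> assoc C f g (f \<odot> h) \<cdot> (f \<rhd> vinv (assoc C g f h))
    \<cdot> (f \<rhd> (n \<lhd> h)) \<cdot> (f \<rhd> vinv (lunit C h))"
  define Y where "Y = (f \<rhd> lunit C h) \<cdot> (f \<rhd> (vinv n \<lhd> h)) \<cdot> (f \<rhd> assoc C g f h)
    \<cdot> vinv (assoc C f g (f \<odot> h)) \<cdot> (vinv e \<lhd> (f \<odot> h)) \<cdot> vinv (lunit C (f \<odot> h))"
  have Yty: "Y \<in> D" "src2 C Y = f \<odot> h" "tgt2 C Y = f \<odot> h" unfolding Y_def using si by simp_all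
  have "Y \<cdot> Z = one2 C (f \<odot> h)"
    unfolding Y_def Z_def using si by (simp add: vinv_whisker_left[symmetric] vinv_whisker_right[symmetric])
  moreover have "Z = one2 C (f \<odot> h)"
  proof -
    have a: "lunit C (f \<odot> h) = (lunit C f \<lhd> h) \<cdot> assoc C j f h"
      using si lunit_comp[of f h y] by simp
    have b: "assoc C j f h \<cdot> (e \<lhd> (f \<odot> h)) = ((e \<lhd> f) \<lhd> h) \<cdot> assoc C (f \<odot> g) f h"
      using si by (intro assoc_natural_left) simp_all
    have c: "assoc C (f \<odot> g) f h \<cdot> assoc C f g (f \<odot> h) =
      (assoc C f g f \<lhd> h) \<cdot> (assoc C f (g \<odot> f) h \<cdot> (f \<rhd> assoc C g f h))"
      using si by (intro pentagon_simp) simp_all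
    have d: "assoc C f (g \<odot> f) h \<cdot> (f \<rhd> (n \<lhd> h)) = ((f \<rhd> n) \<lhd> h) \<cdot> assoc C f i h"
      using si by (intro assoc_natural_middle) simp_all
    have "(runit C f \<lhd> h) \<cdot> assoc C f i h = one2 C (f \<odot> h) \<cdot> (f \<rhd> lunit C h)"
      using si triangle_simp[of h f x] by simp
    from move_inv_square[OF this]
    have t: "assoc C f i h \<cdot> (f \<rhd> vinv (lunit C h)) = vinv (runit C f) \<lhd> h"
      using si by (simp add: vinv_whisker_left vinv_whisker_right)
    have T: "lunit C f \<cdot> (e \<lhd> f) \<cdot> assoc C f g f \<cdot> (f \<rhd> n) \<cdot> vinv (runit C f) = one2 C f"
      using assms(13) unfolding triangle_identity_def .
    let ?z = "(f \<rhd> (n \<lhd> h)) \<cdot> (f \<rhd> vinv (lunit C h))"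
    let ?R = "\<lambda>y. (lunit C f \<lhd> h) \<cdot> ((e \<lhd> f) \<lhd> h) \<cdot> y"
    have "Z = (lunit C f \<lhd> h) \<cdot> assoc C j f h \<cdot> (e \<lhd> (f \<odot> h)) \<cdot> assoc C f g (f \<odot> h) \<cdot> (f \<rhd> vinv (assoc C g f h)) \<cdot> ?z"
      unfolding Z_def a using si by simp
    also have "\<dots> = ?R (assoc C (f \<odot> g) f h \<cdot> assoc C f g (f \<odot> h) \<cdot> (f \<rhd> vinv (assoc C g f h)) \<cdot> ?z)"
      using si by (subst vcomp_extend[OF b]) simp_all
    also have "\<dots> = ?R ((assoc C f g f \<lhd> h) \<cdot> (assoc C f (g \<odot> f) h \<cdot> (f \<rhd> assoc C g f h)) \<cdot> (f \<rhd> vinv (assoc C g f h)) \<cdot> ?z)"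
      using si by (subst vcomp_extend[OF c]) simp_all
    also have "\<dots> = ?R ((assoc C f g f \<lhd> h) \<cdot> assoc C f (g \<odot> f) h \<cdot> ?z)"
      using si by (simp add: vinv_whisker_left[symmetric])
    also have "\<dots> = ?R ((assoc C f g f \<lhd> h) \<cdot> ((f \<rhd> n) \<lhd> h) \<cdot> assoc C f i h \<cdot> (f \<rhd> vinv (lunit C h)))"
      using si by (subst vcomp_extend[OF d]) simp_all
    also have "\<dots> = ?R ((assoc C f g f \<lhd> h) \<cdot> ((f \<rhd> n) \<lhd> h) \<cdot> (vinv (runit C f) \<lhd> h))"
      unfolding t ..
    also have "\<dots> = (lunit C f \<cdot> (e \<lhd> f) \<cdot> assoc C f g f \<cdot> (f \<rhd> n) \<cdot> vinv (runit C f)) \<lhd> h"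
      using si by (simp add: whisker_right_vcomp)
    also have "\<dots> = one2 C (f \<odot> h)" unfolding T using si by simp
    finally show ?thesis .
  qed
  ultimately have Y: "Y = one2 C (f \<odot> h)" using Yty by simp
  let ?L = "\<lambda>y. (f \<rhd> lunit C h) \<cdot> (f \<rhd> (vinv n \<lhd> h)) \<cdot> (f \<rhd> assoc C g f h) \<cdot> y"
  have "transpose_left u f g e (cotranspose_left h f g n w)
    = ?L ((f \<rhd> (g \<rhd> w))
      \<cdot> vinv (assoc C f g u) \<cdot> (vinv e \<lhd> u) \<cdot> vinv (lunit C u))"
    unfolding transpose_left_def cotranspose_left_def using si
    by (simp add: whisker_left_vcomp)
  also have "\<dots> = ?L (vinv (assoc C f g (f \<odot> h))
      \<cdot> ((f \<odot> g) \<rhd> w) \<cdot> (vinv e \<lhd> u) \<cdot> vinv (lunit C u))"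
    using si by (subst vcomp_extend[OF 1]) simp_all
  also have "\<dots> = ?L (vinv (assoc C f g (f \<odot> h))
      \<cdot> (vinv e \<lhd> (f \<odot> h)) \<cdot> (j \<rhd> w) \<cdot> vinv (lunit C u))"
    using si by (subst vcomp_extend[OF 2]) simp_all
  also have "\<dots> = Y \<cdot> w"
    unfolding 3 Y_def using si by simp
  also have "\<dots> = w" unfolding Y using si by simp
  finally show ?thesis .
qed

end

section \<open>Improving a quasi-inverse to an adjoint equivalence\<close>

context bigroupoid
begin

text \<open>The unit \<open>n\<close> is kept, and fullness of precomposition with \<open>f\<close>
  yields a counit for which the first triangle identity holds. The left side \<open>t\<close> of the
  second one then satisfies \<open>(t \<lhd> f) \<cdot> n = n\<close>; cancelling \<open>n\<close>
  and afterwards the whiskering by \<open>f\<close> leaves the identity.\<close>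

lemma adjoint_equivalence_exists:
  assumes f: "f \<in> M"
  shows "\<exists>g n e. adjoint_equivalence C f g n e"
proof -
  obtain g n where gn: "g \<in> M" "src C g = tgt C f" "tgt C g = src C f"
    "n \<in> D" "src2 C n = one C (src C f)" "tgt2 C n = g \<odot> f"
    using left_quasi_inverse[OF f] by blast
  define x y where "x = src C f" and "y = tgt C f"
  have xy: "src C f = x" "tgt C f = y" by (simp_all add: x_def y_def)
  have o: "x \<in> topspace (Ob C)" "y \<in> topspace (Ob C)" using f by (simp_all add: x_def y_def)
  define i j where "i = one C x" and "j = one C y"
  have ij: "i \<in> M" "j \<in> M" "src C i = x" "tgt C i = x" "src C j = y" "tgt C j = y" "one C x = i" "one C y = j"
    using o unfolding i_def j_def by auto
  note si = f gn[unfolded xy] xy o ij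
  \<comment> \<open>This is the first triangle identity solved for the whiskered counit
    \<open>e \<lhd> f\<close>.\<close>
  define c where "c = vinv (lunit C f) \<cdot> runit C f \<cdot> vinv (f \<rhd> n) \<cdot> vinv (assoc C f g f)"
  have c: "c \<in> D" "src2 C c = (f \<odot> g) \<odot> f" "tgt2 C c = j \<odot> f" unfolding c_def using si by simp_all
  obtain e where e: "e \<in> D" "src2 C e = f \<odot> g" "tgt2 C e = j" "e \<lhd> f = c"
    by (rule whisker_right_full[of "f \<odot> g" j f c]) (use si c in simp_all)
  have T: "triangle_identity f g n e"
    unfolding triangle_identity_def e(4) unfolding c_def using si e(1-3) by simp
  \<comment> \<open>Unfolding \<open>cotranspose_right\<close> shows that \<open>t\<close> is the
    left side of the second triangle identity.\<close>
  define t where "t = cotranspose_right g f g e n \<cdot> vinv (lunit C g)"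
  have t: "t \<in> D" "src2 C t = g" "tgt2 C t = g"
    unfolding t_def cotranspose_right_def using si e(1-3) by simp_all
  have tl: "t \<cdot> lunit C g = cotranspose_right g f g e n"
    unfolding t_def cotranspose_right_def using si e(1-3) by simp
  \<comment> \<open>The unit is itself a cell from \<open>i\<close> to \<open>g \<odot> f\<close>,
    so the round trip applies to it with \<open>i\<close> and \<open>g\<close> in the roles of
    \<open>u\<close> and \<open>h\<close>.\<close>
  have "n = transpose_right i f g n (cotranspose_right g f g e n)"
    by (rule transpose_cotranspose_right[symmetric, where x = x and y = y]) (use si e(1-3) T in simp_all)
  also have "\<dots> = (t \<lhd> f) \<cdot> (lunit C g \<lhd> f) \<cdot> assoc C i g f \<cdot> (i \<rhd> n) \<cdot> vinv (runit C i)"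
    unfolding transpose_right_def tl[symmetric] using si e(1-3) t by (simp add: whisker_right_vcomp)
  also have "\<dots> = (t \<lhd> f) \<cdot> lunit C (g \<odot> f) \<cdot> (i \<rhd> n) \<cdot> vinv (runit C i)"
    using si t by (subst vcomp_extend1[OF lunit_comp[of g f x, unfolded ij(7)]]) simp_all
  also have "\<dots> = (t \<lhd> f) \<cdot> n \<cdot> lunit C i \<cdot> vinv (runit C i)"
    using si t by (subst vcomp_extend[OF lunit_nat[of n i "g \<odot> f" x, unfolded ij(7)]]) simp_all
  \<comment> \<open>The left unit isomorphism stems from \<open>t\<close>, the right one from the
    transposition. They cancel because they coincide at an identity 1-morphism.\<close>
  also have "\<dots> = (t \<lhd> f) \<cdot> n"
    unfolding lunit_one[OF o(1), unfolded ij(7)] using si t by simp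
  finally have "one2 C (g \<odot> f) \<cdot> n = (t \<lhd> f) \<cdot> n" using si by simp
  then have "one2 C (g \<odot> f) = t \<lhd> f"
    by (rule cancel_right[rotated 5]) (use si t in simp_all)
  then have "g \<rhd> one2 C f = t \<lhd> f" using si by simp
  then have "one2 C g = t"
    by (rule whisker_right_faithful[rotated 6]) (use si t in simp_all)
  then have T2: "runit C g \<cdot> (g \<rhd> e) \<cdot> vinv (assoc C g f g) \<cdot> (n \<lhd> g) \<cdot> vinv (lunit C g) = one2 C g"
    unfolding t_def cotranspose_right_def using si e(1-3) by simp
  have "adjoint_equivalence C f g n e"
    using T T2 si e(1-3) unfolding adjoint_equivalence_def triangle_identity_def
    by (simp add: cell_iff mor_iff iso)
  then show ?thesis by blast
qed

text \<open>This and the next three equivalences make every link in \<open>cocycle_4_simplex\<close>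
  reversible.\<close>

lemma vcomp_left_iff:
  assumes "a \<in> D" "b \<in> D" "c \<in> D" "tgt2 C a = src2 C c" "tgt2 C b = src2 C c"
  shows "c \<cdot> a = c \<cdot> b \<longleftrightarrow> a = b"
  using cancel_left[OF assms] by blast

lemma vcomp_right_iff:
  assumes "a \<in> D" "b \<in> D" "c \<in> D" "src2 C a = tgt2 C c" "src2 C b = tgt2 C c"
  shows "a \<cdot> c = b \<cdot> c \<longleftrightarrow> a = b"
  using cancel_right[OF assms] by blast

lemma whisker_right_iff:
  assumes "a \<in> D" "b \<in> D" "src2 C a = src2 C b" "tgt2 C a = tgt2 C b" "f \<in> M" "tgt C f = src C (src2 C a)"
  shows "a \<lhd> f = b \<lhd> f \<longleftrightarrow> a = b"
  using whisker_right_faithful[OF assms] by blast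

lemma whisker_left_iff:
  assumes "a \<in> D" "b \<in> D" "src2 C a = src2 C b" "tgt2 C a = tgt2 C b" "f \<in> M" "src C f = tgt C (src2 C a)"
  shows "f \<rhd> a = f \<rhd> b \<longleftrightarrow> a = b"
  using whisker_left_faithful[OF assms] by blast

end

section \<open>The cocycle condition\<close>

text \<open>The condition of the nerve for a single tetrahedron, so that it can be known for some
  faces of a simplex and be open for another.\<close>

definition cocycle :: "('o, 'm, 'c) bicat \<Rightarrow> (nat \<times> nat \<Rightarrow> 'm) \<Rightarrow> (nat \<times> nat \<times> nat \<Rightarrow> 'c) \<Rightarrow> nat \<Rightarrow> nat \<Rightarrow> nat \<Rightarrow> nat \<Rightarrow> bool"
  where "cocycle C u w i j k l \<longleftrightarrow>
    assoc C (u (k, l)) (u (j, k)) (u (i, j)) \<cdot>\<^bsub>C\<^esub> (one2 C (u (k, l)) \<star>\<^bsub>C\<^esub> w (i, j, k)) \<cdot>\<^bsub>C\<^esub> w (i, k, l) =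
    (w (j, k, l) \<star>\<^bsub>C\<^esub> one2 C (u (i, j))) \<cdot>\<^bsub>C\<^esub> w (i, j, l)"

context bigroupoid
begin

text \<open>
  Both sides of the pentagon for a 4-simplex are joined by five steps, each of which is a
  cocycle condition composed and whiskered with invertible 2-cells. So each of the five
  conditions follows from the other four.
\<close>

lemma cocycle_4_simplex:
  fixes x :: "nat \<Rightarrow> 'a"
  assumes u: "\<And>i j. i < j \<Longrightarrow> j \<le> 4 \<Longrightarrow> mor C (u (i, j)) (x i) (x j)"
    and w: "\<And>i j l. \<lbrakk>i < j; j < l; l \<le> 4\<rbrakk> \<Longrightarrow> cell C (w (i, j, l)) (u (i, l)) (u (j, l) \<odot> u (i, j))"
  shows
    "\<lbrakk>cocycle C u w 0 2 3 4; cocycle C u w 0 1 3 4; cocycle C u w 0 1 2 4; cocycle C u w 0 1 2 3\<rbrakk> \<Longrightarrow> cocycle C u w 1 2 3 4" (is "PROP ?P1")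
    "\<lbrakk>cocycle C u w 1 2 3 4; cocycle C u w 0 1 3 4; cocycle C u w 0 1 2 4; cocycle C u w 0 1 2 3\<rbrakk> \<Longrightarrow> cocycle C u w 0 2 3 4" (is "PROP ?P2")
    "\<lbrakk>cocycle C u w 1 2 3 4; cocycle C u w 0 2 3 4; cocycle C u w 0 1 2 4; cocycle C u w 0 1 2 3\<rbrakk> \<Longrightarrow> cocycle C u w 0 1 3 4" (is "PROP ?P3")
    "\<lbrakk>cocycle C u w 1 2 3 4; cocycle C u w 0 2 3 4; cocycle C u w 0 1 3 4; cocycle C u w 0 1 2 3\<rbrakk> \<Longrightarrow> cocycle C u w 0 1 2 4" (is "PROP ?P4")
    "\<lbrakk>cocycle C u w 1 2 3 4; cocycle C u w 0 2 3 4; cocycle C u w 0 1 3 4; cocycle C u w 0 1 2 4\<rbrakk> \<Longrightarrow> cocycle C u w 0 1 2 3" (is "PROP ?P5")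
proof -
  note m = u[unfolded mor_iff, THEN conjunct1] u[unfolded mor_iff, THEN conjunct2, THEN conjunct1]
    u[unfolded mor_iff, THEN conjunct2, THEN conjunct2]
  note c = w[unfolded cell_iff, THEN conjunct1] w[unfolded cell_iff, THEN conjunct2, THEN conjunct1]
    w[unfolded cell_iff, THEN conjunct2, THEN conjunct2]
  let ?a = "u (0, 1)" and ?b = "u (1, 2)" and ?c = "u (2, 3)" and ?d = "u (3, 4)"
  \<comment> \<open>The ten cells stand around a cycle. The pairs (K1, K10), (K2, K3), (K4, K5),
    (K6, K7), (K8, K9) agree by naturality, exchange, functoriality of whiskering and the pentagon.
    Each of the other five neighbouring pairs agrees if and only if one of the five cocycle
    conditions holds.\<close>
  define K1 where "K1 = assoc C (?d \<odot> ?c) ?b ?a \<cdot> ((?d \<odot> ?c) \<rhd> w (0, 1, 2)) \<cdot>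
     (assoc C ?d ?c (u (0, 2)) \<cdot> (?d \<rhd> w (0, 2, 3)) \<cdot> w (0, 3, 4))"
  define K2 where "K2 = assoc C (?d \<odot> ?c) ?b ?a \<cdot> ((?d \<odot> ?c) \<rhd> w (0, 1, 2)) \<cdot>
     ((w (2, 3, 4) \<lhd> u (0, 2)) \<cdot> w (0, 2, 4))"
  define K3 where "K3 = ((w (2, 3, 4) \<lhd> ?b) \<lhd> ?a) \<cdot>
     (assoc C (u (2, 4)) ?b ?a \<cdot> (u (2, 4) \<rhd> w (0, 1, 2)) \<cdot> w (0, 2, 4))"
  define K4 where "K4 = ((w (2, 3, 4) \<lhd> ?b) \<lhd> ?a) \<cdot> ((w (1, 2, 4) \<lhd> ?a) \<cdot> w (0, 1, 4))"
  define K5 where "K5 = (((w (2, 3, 4) \<lhd> ?b) \<cdot> w (1, 2, 4)) \<lhd> ?a) \<cdot> w (0, 1, 4)"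
  define K6 where "K6 = ((assoc C ?d ?c ?b \<cdot> (?d \<rhd> w (1, 2, 3)) \<cdot> w (1, 3, 4)) \<lhd> ?a) \<cdot> w (0, 1, 4)"
  define K7 where "K7 = (assoc C ?d ?c ?b \<lhd> ?a) \<cdot> ((?d \<rhd> w (1, 2, 3)) \<lhd> ?a) \<cdot>
     ((w (1, 3, 4) \<lhd> ?a) \<cdot> w (0, 1, 4))"
  define K8 where "K8 = (assoc C ?d ?c ?b \<lhd> ?a) \<cdot> ((?d \<rhd> w (1, 2, 3)) \<lhd> ?a) \<cdot>
     (assoc C ?d (u (1, 3)) ?a \<cdot> (?d \<rhd> w (0, 1, 3)) \<cdot> w (0, 3, 4))"
  define K9 where "K9 = (assoc C ?d ?c ?b \<lhd> ?a) \<cdot> assoc C ?d (?c \<odot> ?b) ?a \<cdot>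
     (?d \<rhd> ((w (1, 2, 3) \<lhd> ?a) \<cdot> w (0, 1, 3))) \<cdot> w (0, 3, 4)"
  define K10 where "K10 = (assoc C ?d ?c ?b \<lhd> ?a) \<cdot> assoc C ?d (?c \<odot> ?b) ?a \<cdot>
     (?d \<rhd> (assoc C ?c ?b ?a \<cdot> (?c \<rhd> w (0, 1, 2)) \<cdot> w (0, 2, 3))) \<cdot> w (0, 3, 4)"
  have n1: "assoc C ?d ?c (?b \<odot> ?a) \<cdot> (?d \<rhd> (?c \<rhd> w (0, 1, 2))) = ((?d \<odot> ?c) \<rhd> w (0, 1, 2)) \<cdot> assoc C ?d ?c (u (0, 2))"
    by (intro assoc_natural_right) (simp_all add: m c del: One_nat_def)
  have n2: "((?d \<odot> ?c) \<rhd> w (0, 1, 2)) \<cdot> (w (2, 3, 4) \<lhd> u (0, 2)) = (w (2, 3, 4) \<lhd> (?b \<odot> ?a)) \<cdot> (u (2, 4) \<rhd> w (0, 1, 2))"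
    by (intro whisker_exchange) (simp_all add: m c del: One_nat_def)
  have n3: "assoc C (?d \<odot> ?c) ?b ?a \<cdot> (w (2, 3, 4) \<lhd> (?b \<odot> ?a)) = ((w (2, 3, 4) \<lhd> ?b) \<lhd> ?a) \<cdot> assoc C (u (2, 4)) ?b ?a"
    by (intro assoc_natural_left) (simp_all add: m c del: One_nat_def)
  have n4: "assoc C ?d (?c \<odot> ?b) ?a \<cdot> (?d \<rhd> (w (1, 2, 3) \<lhd> ?a)) = ((?d \<rhd> w (1, 2, 3)) \<lhd> ?a) \<cdot> assoc C ?d (u (1, 3)) ?a"
    by (intro assoc_natural_middle) (simp_all add: m c del: One_nat_def)
  have n5: "assoc C (?d \<odot> ?c) ?b ?a \<cdot> assoc C ?d ?c (?b \<odot> ?a) = (assoc C ?d ?c ?b \<lhd> ?a) \<cdot> (assoc C ?d (?c \<odot> ?b) ?a \<cdot> (?d \<rhd> assoc C ?c ?b ?a))"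
    by (intro pentagon_simp) (simp_all add: m c del: One_nat_def)
  have e1: "K1 = K10"
  proof -
    have "K1 = assoc C (?d \<odot> ?c) ?b ?a \<cdot> assoc C ?d ?c (?b \<odot> ?a) \<cdot> (?d \<rhd> (?c \<rhd> w (0, 1, 2))) \<cdot> (?d \<rhd> w (0, 2, 3)) \<cdot> w (0, 3, 4)"
      unfolding K1_def by (subst vcomp_extend[OF n1[symmetric]]) (simp_all add: m c del: One_nat_def)
    also have "\<dots> = K10"
      unfolding K10_def by (subst vcomp_extend[OF n5]) (simp_all add: m c whisker_left_vcomp del: One_nat_def)
    finally show ?thesis .
  qed
  have e2: "K2 = K3"
  proof -
    have "K2 = assoc C (?d \<odot> ?c) ?b ?a \<cdot> (w (2, 3, 4) \<lhd> (?b \<odot> ?a)) \<cdot> (u (2, 4) \<rhd> w (0, 1, 2)) \<cdot> w (0, 2, 4)"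
      unfolding K2_def by (subst vcomp_extend[OF n2]) (simp_all add: m c del: One_nat_def)
    also have "\<dots> = K3"
      unfolding K3_def by (subst vcomp_extend[OF n3]) (simp_all add: m c del: One_nat_def)
    finally show ?thesis .
  qed
  have e3: "K4 = K5" unfolding K4_def K5_def by (simp add: m c whisker_right_vcomp del: One_nat_def)
  have e4: "K6 = K7" unfolding K6_def K7_def by (simp add: m c whisker_right_vcomp del: One_nat_def)
  have e5: "K8 = K9"
  proof -
    have "K9 = (assoc C ?d ?c ?b \<lhd> ?a) \<cdot> assoc C ?d (?c \<odot> ?b) ?a \<cdot>
     (?d \<rhd> (w (1, 2, 3) \<lhd> ?a)) \<cdot> (?d \<rhd> w (0, 1, 3)) \<cdot> w (0, 3, 4)"
      unfolding K9_def by (simp add: m c whisker_left_vcomp del: One_nat_def)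
    also have "\<dots> = K8" unfolding K8_def by (subst vcomp_extend[OF n4]) (simp_all add: m c del: One_nat_def)
    finally show ?thesis by simp
  qed
  have i1: "K1 = K2 \<longleftrightarrow> cocycle C u w 0 2 3 4"
    unfolding K1_def K2_def cocycle_def
    by (simp add: m c vcomp_left_iff del: vcomp_assoc_simp One_nat_def)
  have i2: "K3 = K4 \<longleftrightarrow> cocycle C u w 0 1 2 4"
    unfolding K3_def K4_def cocycle_def
    by (simp add: m c vcomp_left_iff del: vcomp_assoc_simp One_nat_def)
  have i3: "K5 = K6 \<longleftrightarrow> cocycle C u w 1 2 3 4"
    unfolding K5_def K6_def cocycle_def
    by (simp add: m c vcomp_right_iff whisker_right_iff eq_commute del: vcomp_assoc_simp One_nat_def)
  have i4: "K7 = K8 \<longleftrightarrow> cocycle C u w 0 1 3 4"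
    unfolding K7_def K8_def cocycle_def
    by (simp add: m c vcomp_left_iff eq_commute del: vcomp_assoc_simp One_nat_def)
  have i5: "K9 = K10 \<longleftrightarrow> cocycle C u w 0 1 2 3"
    unfolding K9_def K10_def cocycle_def
    by (simp add: m c vcomp_left_iff vcomp_right_iff whisker_left_iff eq_commute del: vcomp_assoc_simp One_nat_def)
  \<comment> \<open>The cycle closes up: the five unconditional equalities and any four of the links
    force the remaining link.\<close>
  note E = i1[symmetric] i2[symmetric] i3[symmetric] i4[symmetric] i5[symmetric] e1 e2 e3 e4 e5
  show "PROP ?P1" "PROP ?P2" "PROP ?P3" "PROP ?P4" "PROP ?P5"
    unfolding E by simp_all
qed

end

section \<open>Lifting maps from cubes\<close>

abbreviation unit_interval :: "real topology" where
  "unit_interval \<equiv> top_of_set {0..1}"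

abbreviation cylinder :: "nat \<Rightarrow> ((nat \<Rightarrow> real) \<times> real) topology" where
  "cylinder n \<equiv> prod_topology (cube n) unit_interval"

lemma continuous_map_mem: "continuous_map X Y f \<Longrightarrow> x \<in> topspace X \<Longrightarrow> f x \<in> topspace Y"
  using continuous_map_image_subset_topspace by blast

lemma topspace_cube_0: "topspace (cube 0) = {\<lambda>_. undefined}"
  by (simp add: cube_def PiE_eq_singleton)

text \<open>Together with \<open>continuous_map_prod_of_cube_Suc\<close> this identifies the cube of
  dimension n + 1 with the cylinder over the cube of dimension n. The coordinate with index
  \<open>n\<close> is the time.\<close>

lemma continuous_map_cube_Suc_of_prod:
  "continuous_map (cylinder n) (cube (Suc n)) (\<lambda>(s, t). s(n := t))"
  unfolding cube_def
proof (subst continuous_map_componentwise, intro conjI ballI)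
  show "(\<lambda>(s, t). s(n := t)) ` topspace (prod_topology (product_topology (\<lambda>_. unit_interval) {..<n}) unit_interval)
      \<subseteq> extensional {..<Suc n}"
    by (auto simp: extensional_def PiE_def)
next
  fix k assume k: "k \<in> {..<Suc n}"
  show "continuous_map (prod_topology (product_topology (\<lambda>_. unit_interval) {..<n}) unit_interval) unit_interval
      (\<lambda>x. (case x of (s, t) \<Rightarrow> s(n := t)) k)"
  proof (cases "k = n")
    case True
    then show ?thesis
      using continuous_map_snd by (simp add: case_prod_unfold)
  next
    case False
    then have "k \<in> {..<n}" using k by auto
    from continuous_map_compose[OF continuous_map_fst continuous_map_product_projection[OF this]] False
    show ?thesis by (simp add: case_prod_unfold o_def)
  qed
qed

lemma continuous_map_prod_of_cube_Suc:
  "continuous_map (cube (Suc n)) (cylinder n) (\<lambda>z. (restrict z {..<n}, z n))"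
proof (rule continuous_map_pairedI)
  show "continuous_map (cube (Suc n)) unit_interval (\<lambda>z. z n)"
    unfolding cube_def by (rule continuous_map_product_projection) simp
  show "continuous_map (cube (Suc n)) (cube n) (\<lambda>z. restrict z {..<n})"
    unfolding cube_def
    by (subst continuous_map_componentwise) (auto intro: continuous_map_product_projection)
qed

lemma cube_Suc_eta: "z \<in> topspace (cube (Suc n)) \<Longrightarrow> (restrict z {..<n})(n := z n) = z"
  by (auto simp: cube_def fun_eq_iff PiE_def extensional_def)

lemma Serre_fibrationD:
  assumes "Serre_fibration E B p" "continuous_map (cube n) E f"
    "continuous_map (cylinder n) B H"
    "\<And>s. s \<in> topspace (cube n) \<Longrightarrow> H (s, 0) = p (f s)"
  obtains K where "continuous_map (cylinder n) E K"
    "\<And>s. s \<in> topspace (cube n) \<Longrightarrow> K (s, 0) = f s"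
    "\<And>s t. s \<in> topspace (cube n) \<Longrightarrow> t \<in> {0..1} \<Longrightarrow> p (K (s, t)) = H (s, t)"
proof -
  have "\<forall>s \<in> topspace (cube n). H (s, 0) = p (f s)" using assms(4) by blast
  from assms(1)[unfolded Serre_fibration_def, THEN conjunct2, rule_format, OF assms(2,3), rule_format, OF this[rule_format]]
  show thesis using that by blast
qed

lemma continuous_map_slice:
  assumes "continuous_map (cylinder n) B H" "t \<in> {0..1}"
  shows "continuous_map (cube n) B (\<lambda>s. H (s, t))"
proof -
  have "continuous_map (cube n) (cylinder n) (\<lambda>s. (s, t))"
    using assms(2) by (intro continuous_map_pairedI) auto
  from continuous_map_compose[OF this assms(1)] show ?thesis by (simp add: o_def)
qed

text \<open>A cube arises from a point by iterated cylinders: surjectivity lifts the point, and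
  every further coordinate is a homotopy to be lifted. No initial lift is prescribed.\<close>

lemma lift_over_cube:
  assumes p: "Serre_fibration E B p" and surj: "p ` topspace E = topspace B"
    and H: "continuous_map (cube n) B H"
  shows "\<exists>K. continuous_map (cube n) E K \<and> (\<forall>s \<in> topspace (cube n). p (K s) = H s)"
  using H
proof (induction n arbitrary: H)
  case 0
  define z :: "nat \<Rightarrow> real" where "z = (\<lambda>_. undefined)"
  have "H z \<in> topspace B"
    using 0 continuous_map_image_subset_topspace topspace_cube_0 z_def by fastforce
  then obtain y where "y \<in> topspace E" "p y = H z" using surj by (metis imageE)
  then show ?case
    by (intro exI[of _ "\<lambda>_. y"]) (auto simp: topspace_cube_0 z_def)
next
  case (Suc n)
  have c: "continuous_map (cylinder n) B (\<lambda>(s, t). H (s(n := t)))"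
    using continuous_map_compose[OF continuous_map_cube_Suc_of_prod Suc.prems]
    by (simp add: o_def case_prod_unfold)
  have "continuous_map (cube n) B (\<lambda>s. H (s(n := 0)))"
    using continuous_map_slice[OF c, of 0] by simp
  from Suc.IH[OF this] obtain f where f: "continuous_map (cube n) E f"
    "\<And>s. s \<in> topspace (cube n) \<Longrightarrow> p (f s) = H (s(n := 0))" by blast
  obtain K where K: "continuous_map (cylinder n) E K"
    "\<And>s t. s \<in> topspace (cube n) \<Longrightarrow> t \<in> {0..1} \<Longrightarrow> p (K (s, t)) = H (s(n := t))"
    by (rule Serre_fibrationD[OF p f(1) c]) (use f(2) in auto)
  have "p (K (restrict z {..<n}, z n)) = H z" if "z \<in> topspace (cube (Suc n))" for z
  proof -
    have "(restrict z {..<n}, z n) \<in> topspace (cylinder n)"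
      by (rule continuous_map_mem[OF continuous_map_prod_of_cube_Suc that])
    then show ?thesis using K(2) cube_Suc_eta[OF that] by auto
  qed
  with continuous_map_compose[OF continuous_map_prod_of_cube_Suc K(1)] show ?case
    by (auto simp: o_def)
qed

lemma lift_over_cylinder:
  assumes p: "Serre_fibration E B p" and surj: "p ` topspace E = topspace B"
    and H: "continuous_map (cylinder n) B H"
  obtains K where "continuous_map (cylinder n) E K"
    "\<And>z. z \<in> topspace (cylinder n) \<Longrightarrow> p (K z) = H z"
proof -
  obtain f where f: "continuous_map (cube n) E f" "\<And>s. s \<in> topspace (cube n) \<Longrightarrow> p (f s) = H (s, 0)"
    using lift_over_cube[OF p surj continuous_map_slice[OF H, of 0]] by auto
  obtain K where "continuous_map (cylinder n) E K"
    "\<And>s t. s \<in> topspace (cube n) \<Longrightarrow> t \<in> {0..1} \<Longrightarrow> p (K (s, t)) = H (s, t)"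
    by (rule Serre_fibrationD[OF p f(1) H]) (use f(2) in auto)
  then show thesis using that by auto
qed

text \<open>For injective \<open>p\<close> every lift has the prescribed initial value, because both
  have the same image under \<open>p\<close>. Surjectivity is the lifting of constant maps. The horn
  maps of dimension at least three are of this kind.\<close>

lemma Serre_fibration_surjective_of_lifts:
  assumes c: "continuous_map E B p" and inj: "inj_on p (topspace E)"
    and lift: "\<And>n H. continuous_map (cylinder n) B H \<Longrightarrow>
      \<exists>K. continuous_map (cylinder n) E K \<and>
        (\<forall>z \<in> topspace (cylinder n). p (K z) = H z)"
  shows "Serre_fibration E B p" "p ` topspace E = topspace B"
proof -
  show "Serre_fibration E B p"
    unfolding Serre_fibration_def
  proof (intro conjI c allI impI)
    fix n f H
    assume f: "continuous_map (cube n) E f"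
      and H: "continuous_map (cylinder n) B H"
      and fH: "\<forall>s \<in> topspace (cube n). H (s, 0) = p (f s)"
    obtain K where K: "continuous_map (cylinder n) E K"
      "\<forall>z \<in> topspace (cylinder n). p (K z) = H z"
      using lift[OF H] by blast
    have "K (s, 0) = f s" if s: "s \<in> topspace (cube n)" for s
    proof (rule inj_onD[OF inj])
      have z: "(s, 0) \<in> topspace (cylinder n)" using s by simp
      show "p (K (s, 0)) = p (f s)" using K(2) z fH s by simp
      show "K (s, 0) \<in> topspace E" by (rule continuous_map_mem[OF K(1) z])
      show "f s \<in> topspace E" by (rule continuous_map_mem[OF f s])
    qed
    then show "\<exists>K. continuous_map (cylinder n) E K \<and>
        (\<forall>s \<in> topspace (cube n). K (s, 0) = f s) \<and>
        (\<forall>s \<in> topspace (cube n). \<forall>t \<in> {0..1}. p (K (s, t)) = H (s, t))"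
      using K by (intro exI[of _ K]) auto
  qed
  show "p ` topspace E = topspace B"
  proof
    show "p ` topspace E \<subseteq> topspace B" by (rule continuous_map_image_subset_topspace[OF c])
    show "topspace B \<subseteq> p ` topspace E"
    proof
      fix b assume b: "b \<in> topspace B"
      then obtain K where K: "continuous_map (cylinder 0) E K"
        "\<forall>z \<in> topspace (cylinder 0). p (K z) = b"
        using lift[of 0 "\<lambda>_. b"] by auto
      \<comment> \<open>The one point of the cube of dimension 0 is the function that is
        \<open>undefined\<close> everywhere.\<close>
      have z: "(\<lambda>_. undefined, 0) \<in> topspace (cylinder 0)"
        by (simp add: topspace_cube_0)
      then have "p (K (\<lambda>_. undefined, 0)) = b" using K(2) by blast
      moreover have "K (\<lambda>_. undefined, 0) \<in> topspace E"
        by (rule continuous_map_mem[OF K(1) z])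
      ultimately show "b \<in> p ` topspace E" by blast
    qed
  qed
qed

section \<open>Continuity of the structure maps\<close>

locale topological_bigroupoid = topological_bicategory + bigroupoid +
  assumes Serre_src: "Serre_fibration (Mor C) (Ob C) (src C)"
    and Serre_tgt: "Serre_fibration (Mor C) (Ob C) (tgt C)"
    and Serre_src2: "Serre_fibration (Cell C) (Mor C) (src2 C)"
    and Serre_tgt2: "Serre_fibration (Cell C) (Mor C) (tgt2 C)"
    and continuous_inv: "continuous_map (Cell C) (Cell C) (inv_cell C)"
    and Serre_AdEq: "Serre_fibration (AdEq C) (Mor C) (\<lambda>(f, g, \<eta>, \<epsilon>). f)"
begin

lemma continuous_unary:
  assumes "continuous_map X Y F" "continuous_map T X a"
  shows "continuous_map T Y (\<lambda>t. F (a t))"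
  using continuous_map_compose[OF assms(2,1)] by (simp add: o_def)

lemmas continuous_src' = continuous_unary[OF continuous_src]
lemmas continuous_tgt' = continuous_unary[OF continuous_tgt]
lemmas continuous_src2' = continuous_unary[OF continuous_src2]
lemmas continuous_tgt2' = continuous_unary[OF continuous_tgt2]
lemmas continuous_one' = continuous_unary[OF continuous_one]
lemmas continuous_one2' = continuous_unary[OF continuous_one2]
lemmas continuous_lunit' = continuous_unary[OF continuous_lunit]
lemmas continuous_runit' = continuous_unary[OF continuous_runit]
lemmas continuous_inv' = continuous_unary[OF continuous_inv]

text \<open>Compositions are continuous on the subspace of composable pairs, so each use leaves a
  composability condition at every point of \<open>T\<close>.\<close>

lemma continuous_binary:
  assumes "continuous_map (subtopology (prod_topology X Y) S) Z (\<lambda>(b, a). F b a)"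
    and "continuous_map T X b" "continuous_map T Y a" "\<And>t. t \<in> topspace T \<Longrightarrow> (b t, a t) \<in> S"
  shows "continuous_map T Z (\<lambda>t. F (b t) (a t))"
proof -
  have "continuous_map T (subtopology (prod_topology X Y) S) (\<lambda>t. (b t, a t))"
    using assms(2-4) by (auto intro!: continuous_map_into_subtopology continuous_map_pairedI)
  from continuous_map_compose[OF this assms(1)] show ?thesis by (simp add: o_def)
qed

lemma continuous_vcomp':
  assumes "continuous_map T (Cell C) b" "continuous_map T (Cell C) a"
    "\<And>t. t \<in> topspace T \<Longrightarrow> src2 C (b t) = tgt2 C (a t)"
  shows "continuous_map T (Cell C) (\<lambda>t. b t \<cdot> a t)"
  using assms by (intro continuous_binary[OF continuous_vcomp[unfolded vcomposable_def]]) auto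

lemma continuous_hcomp':
  assumes "continuous_map T (Cell C) b" "continuous_map T (Cell C) a"
    "\<And>t. t \<in> topspace T \<Longrightarrow> src C (src2 C (b t)) = tgt C (src2 C (a t))"
  shows "continuous_map T (Cell C) (\<lambda>t. b t \<star> a t)"
  using assms by (intro continuous_binary[OF continuous_hcomp[unfolded hcomposable_def]]) auto

lemma continuous_comp1':
  assumes "continuous_map T (Mor C) g" "continuous_map T (Mor C) f"
    "\<And>t. t \<in> topspace T \<Longrightarrow> src C (g t) = tgt C (f t)"
  shows "continuous_map T (Mor C) (\<lambda>t. g t \<odot> f t)"
  using assms by (intro continuous_binary[OF continuous_comp1[unfolded composable1_def]]) auto

lemma continuous_assoc':
  assumes "continuous_map T (Mor C) h" "continuous_map T (Mor C) g" "continuous_map T (Mor C) f"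
    "\<And>t. t \<in> topspace T \<Longrightarrow> src C (h t) = tgt C (g t)"
    "\<And>t. t \<in> topspace T \<Longrightarrow> src C (g t) = tgt C (f t)"
  shows "continuous_map T (Cell C) (\<lambda>t. assoc C (h t) (g t) (f t))"
proof -
  have "continuous_map T (composable1_3 C) (\<lambda>t. (h t, g t, f t))"
    using assms unfolding composable1_3_def
    by (auto intro!: continuous_map_into_subtopology continuous_map_pairedI)
  from continuous_map_compose[OF this continuous_assoc] show ?thesis by (simp add: o_def)
qed

text \<open>As introduction rules these reduce the continuity of a pasting of cells to the
  continuity of its ingredients and the matching of sources and targets.\<close>

lemmas continuous_operations = continuous_vcomp' continuous_hcomp' continuous_comp1' continuous_assoc'
  continuous_src' continuous_tgt' continuous_src2' continuous_tgt2' continuous_one' continuous_one2'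
  continuous_lunit' continuous_runit' continuous_inv'

lemma AdEq_surjective: "(\<lambda>(f, g, \<eta>, \<epsilon>). f) ` topspace (AdEq C) = M"
proof
  show "(\<lambda>(f, g, \<eta>, \<epsilon>). f) ` topspace (AdEq C) \<subseteq> M" by (auto simp: AdEq_def)
  show "M \<subseteq> (\<lambda>(f, g, \<eta>, \<epsilon>). f) ` topspace (AdEq C)"
  proof
    fix f assume "f \<in> M"
    then obtain g n e where a: "adjoint_equivalence C f g n e" using adjoint_equivalence_exists by blast
    then have "(f, g, n, e) \<in> topspace (AdEq C)"
      by (auto simp: AdEq_def adjoint_equivalence_def mor_iff cell_iff)
    then show "f \<in> (\<lambda>(f, g, \<eta>, \<epsilon>). f) ` topspace (AdEq C)" by force
  qed
qed

lemma adjoint_equivalenceD: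
  assumes "adjoint_equivalence C f g n e" "src C f = x" "tgt C f = y"
  shows "g \<in> M" "src C g = y" "tgt C g = x" "n \<in> D" "src2 C n = one C x" "tgt2 C n = g \<odot> f"
    "e \<in> D" "src2 C e = f \<odot> g" "tgt2 C e = one C y" "triangle_identity f g n e"
  using assms unfolding adjoint_equivalence_def triangle_identity_def by (auto simp: mor_iff cell_iff)

text \<open>A continuous choice of adjoint inverses along a family of 1-morphisms. Nothing is
  prescribed at time 0: the adjoint data are auxiliary and do not occur in the simplices to be
  lifted.\<close>

lemma continuous_adjoint_equivalence:
  assumes "continuous_map (cylinder m) (Mor C) f"
  obtains g n e where "continuous_map (cylinder m) (Mor C) g"
    "continuous_map (cylinder m) (Cell C) n"
    "continuous_map (cylinder m) (Cell C) e"
    "\<And>t. t \<in> topspace (cylinder m) \<Longrightarrow> adjoint_equivalence C (f t) (g t) (n t) (e t)"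
proof -
  let ?T = "cylinder m"
  obtain K where K: "continuous_map ?T (AdEq C) K"
    "\<And>t. t \<in> topspace ?T \<Longrightarrow> (\<lambda>(f, g, \<eta>, \<epsilon>). f) (K t) = f t"
    using lift_over_cylinder[OF Serre_AdEq AdEq_surjective assms] by blast
  have c: "continuous_map ?T (prod_topology (Mor C) (prod_topology (Mor C) (prod_topology (Cell C) (Cell C)))) K"
    using K(1) unfolding AdEq_def by (simp add: continuous_map_in_subtopology)
  have a: "K t \<in> {(f, g, \<eta>, \<epsilon>). adjoint_equivalence C f g \<eta> \<epsilon>}" if "t \<in> topspace ?T" for t
  proof -
    have "K t \<in> topspace (AdEq C)" by (rule continuous_map_mem[OF K(1) that])
    then show ?thesis unfolding AdEq_def by simp
  qed
  show thesis
  proof (rule that[of "\<lambda>t. fst (snd (K t))" "\<lambda>t. fst (snd (snd (K t)))" "\<lambda>t. snd (snd (snd (K t)))"])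
    show "continuous_map ?T (Mor C) (\<lambda>t. fst (snd (K t)))"
      "continuous_map ?T (Cell C) (\<lambda>t. fst (snd (snd (K t))))"
      "continuous_map ?T (Cell C) (\<lambda>t. snd (snd (snd (K t))))"
      using c by (simp_all add: continuous_map_pairwise o_def)
    fix t assume t: "t \<in> topspace ?T"
    show "adjoint_equivalence C (f t) (fst (snd (K t))) (fst (snd (snd (K t)))) (snd (snd (snd (K t))))"
      using a[OF t] K(2)[OF t] by (auto simp: case_prod_unfold)
  qed
qed

end

section \<open>Faces and horns of the nerve\<close>

abbreviation nerve where "nerve \<equiv> geometric_nerve"
abbreviation vertex :: "('o, 'm, 'c) nerve_simplex \<Rightarrow> nat \<Rightarrow> 'o" where "vertex s \<equiv> fst s"
abbreviation edge :: "('o, 'm, 'c) nerve_simplex \<Rightarrow> nat \<times> nat \<Rightarrow> 'm" where "edge s \<equiv> fst (snd s)"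
abbreviation triangle :: "('o, 'm, 'c) nerve_simplex \<Rightarrow> nat \<times> nat \<times> nat \<Rightarrow> 'c" where "triangle s \<equiv> snd (snd s)"

text \<open>The inverse of \<open>coface i\<close> on the indices other than \<open>i\<close>: it
  renumbers the vertices of the face opposite to \<open>i\<close>.\<close>

definition cod :: "nat \<Rightarrow> nat \<Rightarrow> nat" where
  "cod i v = (if v < i then v else v - 1)"

lemma cod_coface [simp]: "cod i (coface i l) = l"
  by (simp add: cod_def coface_def)

lemma coface_cod: "v \<noteq> i \<Longrightarrow> coface i (cod i v) = v"
  by (auto simp: cod_def coface_def)

lemma coface_neq [simp]: "coface i l \<noteq> i" "i \<noteq> coface i l"
  by (simp_all add: coface_def)

lemma coface_eq_iff [simp]: "coface i l = coface i l' \<longleftrightarrow> l = l'"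
  by (metis cod_coface)

lemma coface_less: "a < b \<Longrightarrow> coface i a < coface i b"
  by (simp add: coface_def)

lemma cod_less: "a < b \<Longrightarrow> a \<noteq> i \<Longrightarrow> b \<noteq> i \<Longrightarrow> cod i a < cod i b"
  by (auto simp: cod_def)

lemma coface_le: "l \<le> n - 1 \<Longrightarrow> 1 \<le> n \<Longrightarrow> coface i l \<le> n"
  by (auto simp: coface_def)

lemma cod_le: "v \<le> n \<Longrightarrow> v \<noteq> i \<Longrightarrow> i \<le> n \<Longrightarrow> cod i v \<le> n - 1"
  by (auto simp: cod_def)

lemma cod_cod:
  assumes "i < j" "v \<noteq> i" "v \<noteq> j"
  shows "coface i (cod i (cod j v)) = cod j v" "coface (j - 1) (cod i (cod j v)) = cod i v"
  using assms by (auto simp: cod_def coface_def)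

lemma coface_coface: "i < j \<Longrightarrow> coface j (coface i l) = coface i (coface (j - 1) l)"
  by (auto simp: coface_def)

context
  fixes C :: "('o, 'm, 'c) bicat"
begin

lemma face_vertex: "l \<le> n - 1 \<Longrightarrow> vertex (face (nerve C) n i s) l = vertex s (coface i l)"
  by (cases s) (simp add: face_def geometric_nerve_def nerve_act_def Let_def)

text \<open>\<open>coface i\<close> is injective, so the branches of \<open>nerve_act\<close> for
  repeated indices are not taken and a face is a mere reindexing.\<close>

lemma face_edge:
  "(a, b) \<in> pairs (n - 1) \<Longrightarrow> edge (face (nerve C) n i s) (a, b) = edge s (coface i a, coface i b)"
  by (cases s) (auto simp: face_def geometric_nerve_def nerve_act_def Let_def pairs_def)

lemma face_triangle:
  "(a, b, c) \<in> triples (n - 1) \<Longrightarrow>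
    triangle (face (nerve C) n i s) (a, b, c) = triangle s (coface i a, coface i b, coface i c)"
  by (cases s) (auto simp: face_def geometric_nerve_def nerve_act_def Let_def triples_def)

text \<open>Points of a product topology are functions that are \<open>undefined\<close> off the
  index set. Under this condition a simplex is determined by its entries.\<close>

definition nerve_extensional :: "nat \<Rightarrow> ('o, 'm, 'c) nerve_simplex \<Rightarrow> bool" where
  "nerve_extensional n s \<longleftrightarrow>
    vertex s \<in> extensional {0..n} \<and> edge s \<in> extensional (pairs n) \<and> triangle s \<in> extensional (triples n)"

lemma face_extensional: "nerve_extensional (n - 1) (face (nerve C) n i s)"
  by (cases s) (simp add: face_def geometric_nerve_def nerve_act_def Let_def nerve_extensional_def)

lemma nerve_simplex_eqI:
  assumes "nerve_extensional n s" "nerve_extensional n s'"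
    and "\<And>v. v \<le> n \<Longrightarrow> vertex s v = vertex s' v"
    and "\<And>a b. a < b \<Longrightarrow> b \<le> n \<Longrightarrow> edge s (a, b) = edge s' (a, b)"
    and "\<And>a b c. a < b \<Longrightarrow> b < c \<Longrightarrow> c \<le> n \<Longrightarrow> triangle s (a, b, c) = triangle s' (a, b, c)"
  shows "s = s'"
proof (intro prod_eqI)
  show "vertex s = vertex s'"
    by (rule extensionalityI[of _ "{0..n}"]) (use assms in \<open>auto simp: nerve_extensional_def\<close>)
  show "edge s = edge s'"
    by (rule extensionalityI[of _ "pairs n"]) (use assms in \<open>auto simp: nerve_extensional_def pairs_def\<close>)
  show "triangle s = triangle s'"
    by (rule extensionalityI[of _ "triples n"]) (use assms in \<open>auto simp: nerve_extensional_def triples_def\<close>)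
qed

lemma is_nerve_simplex_iff:
  "is_nerve_simplex C n s \<longleftrightarrow>
    (\<forall>a b. a < b \<and> b \<le> n \<longrightarrow> mor C (edge s (a, b)) (vertex s a) (vertex s b)) \<and>
    (\<forall>a b c. a < b \<and> b < c \<and> c \<le> n \<longrightarrow>
       cell C (triangle s (a, b, c)) (edge s (a, c)) (edge s (b, c) \<odot>\<^bsub>C\<^esub> edge s (a, b))) \<and>
    (\<forall>a b c d. a < b \<and> b < c \<and> c < d \<and> d \<le> n \<longrightarrow> cocycle C (edge s) (triangle s) a b c d)"
  by (cases s) (simp add: is_nerve_simplex_def cocycle_def)

lemma topspace_nerve:
  "s \<in> topspace (nerve_space C n) \<longleftrightarrow>
    nerve_extensional n s \<and> (\<forall>v \<le> n. vertex s v \<in> topspace (Ob C)) \<and>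
    (\<forall>a b. a < b \<and> b \<le> n \<longrightarrow> edge s (a, b) \<in> topspace (Mor C)) \<and>
    (\<forall>a b c. a < b \<and> b < c \<and> c \<le> n \<longrightarrow> triangle s (a, b, c) \<in> topspace (Cell C)) \<and>
    is_nerve_simplex C n s"
  by (cases s) (auto simp: nerve_space_def nerve_extensional_def PiE_iff pairs_def triples_def)

lemma continuous_nerveI:
  assumes "\<And>v. v \<le> n \<Longrightarrow> continuous_map T (Ob C) (\<lambda>t. vertex (F t) v)"
    and "\<And>a b. a < b \<Longrightarrow> b \<le> n \<Longrightarrow> continuous_map T (Mor C) (\<lambda>t. edge (F t) (a, b))"
    and "\<And>a b c. a < b \<Longrightarrow> b < c \<Longrightarrow> c \<le> n \<Longrightarrow> continuous_map T (Cell C) (\<lambda>t. triangle (F t) (a, b, c))"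
    and "\<And>t. t \<in> topspace T \<Longrightarrow> nerve_extensional n (F t)"
    and "\<And>t. t \<in> topspace T \<Longrightarrow> is_nerve_simplex C n (F t)"
  shows "continuous_map T (nerve_space C n) F"
  unfolding nerve_space_def
proof (rule continuous_map_into_subtopology)
  show "F \<in> topspace T \<rightarrow> {s. is_nerve_simplex C n s}" using assms(5) by auto
  show "continuous_map T (prod_topology (product_topology (\<lambda>_. Ob C) {0..n})
     (prod_topology (product_topology (\<lambda>_. Mor C) (pairs n)) (product_topology (\<lambda>_. Cell C) (triples n)))) F"
    unfolding continuous_map_pairwise continuous_map_componentwise o_def
    using assms(1-4) by (auto simp: nerve_extensional_def pairs_def triples_def)
qed

lemma continuous_nerveD:
  assumes "continuous_map T (nerve_space C n) F"
  shows "v \<le> n \<Longrightarrow> continuous_map T (Ob C) (\<lambda>t. vertex (F t) v)" (is "PROP ?P0")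
    "a < b \<Longrightarrow> b \<le> n \<Longrightarrow> continuous_map T (Mor C) (\<lambda>t. edge (F t) (a, b))" (is "PROP ?P1")
    "a < b \<Longrightarrow> b < c \<Longrightarrow> c \<le> n \<Longrightarrow> continuous_map T (Cell C) (\<lambda>t. triangle (F t) (a, b, c))" (is "PROP ?P2")
    "t \<in> topspace T \<Longrightarrow> F t \<in> topspace (nerve_space C n)" (is "PROP ?P3")
proof -
  have "continuous_map T (prod_topology (product_topology (\<lambda>_. Ob C) {0..n})
     (prod_topology (product_topology (\<lambda>_. Mor C) (pairs n)) (product_topology (\<lambda>_. Cell C) (triples n)))) F"
    using assms unfolding nerve_space_def by (rule continuous_map_into_fulltopology)
  then show "PROP ?P0" "PROP ?P1" "PROP ?P2"
    unfolding continuous_map_pairwise continuous_map_componentwise o_def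
    by (auto simp: pairs_def triples_def)
  show "PROP ?P3"
    using continuous_map_image_subset_topspace[OF assms] by blast
qed

lemma is_nerve_simplex_face:
  assumes "is_nerve_simplex C n s" "1 \<le> n"
  shows "is_nerve_simplex C (n - 1) (face (nerve C) n i s)"
  using assms
  by (simp add: is_nerve_simplex_iff cocycle_def face_vertex face_edge face_triangle pairs_def triples_def
      coface_less coface_le)

text \<open>Entries whose indices avoid \<open>i\<close> are entries of the face opposite to
  \<open>i\<close>, renumbered by \<open>cod i\<close>.\<close>

lemma is_nerve_simplex_faceD:
  assumes s: "is_nerve_simplex C (n - 1) (face (nerve C) n i s)" and i: "i \<le> n"
  shows "\<lbrakk>a < b; b \<le> n; i \<notin> {a, b}\<rbrakk> \<Longrightarrow> mor C (edge s (a, b)) (vertex s a) (vertex s b)"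
    "\<lbrakk>a < b; b < c; c \<le> n; i \<notin> {a, b, c}\<rbrakk> \<Longrightarrow>
       cell C (triangle s (a, b, c)) (edge s (a, c)) (edge s (b, c) \<odot>\<^bsub>C\<^esub> edge s (a, b))"
    "\<lbrakk>a < b; b < c; c < d; d \<le> n; i \<notin> {a, b, c, d}\<rbrakk> \<Longrightarrow> cocycle C (edge s) (triangle s) a b c d"
proof -
  note s = s[unfolded is_nerve_simplex_iff]
  note c1 = s[THEN conjunct1, rule_format]
    and c2 = s[THEN conjunct2, THEN conjunct1, rule_format]
    and c3 = s[THEN conjunct2, THEN conjunct2, rule_format]
  note f = face_vertex face_edge face_triangle pairs_def triples_def coface_cod
  show "mor C (edge s (a, b)) (vertex s a) (vertex s b)" if "a < b" "b \<le> n" "i \<notin> {a, b}"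
    using c1[of "cod i a" "cod i b"] that i cod_less[of a b i] cod_le[of a n i] cod_le[of b n i]
    by (simp add: f)
  show "cell C (triangle s (a, b, c)) (edge s (a, c)) (edge s (b, c) \<odot>\<^bsub>C\<^esub> edge s (a, b))"
    if "a < b" "b < c" "c \<le> n" "i \<notin> {a, b, c}"
    using c2[of "cod i a" "cod i b" "cod i c"] that i cod_less[of a b i] cod_less[of b c i] cod_less[of a c i]
      cod_le[of a n i] cod_le[of b n i] cod_le[of c n i]
    by (simp add: f)
  show "cocycle C (edge s) (triangle s) a b c d"
    if "a < b" "b < c" "c < d" "d \<le> n" "i \<notin> {a, b, c, d}"
    using c3[of "cod i a" "cod i b" "cod i c" "cod i d"] that i cod_less[of a b i] cod_less[of b c i] cod_less[of c d i]
      cod_le[of a n i] cod_le[of b n i] cod_le[of c n i] cod_le[of d n i]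
    by (simp add: f cocycle_def)
qed

lemma face_face:
  assumes "i < j" "2 \<le> n"
  shows "face (nerve C) (n - 1) i (face (nerve C) n j s) =
    face (nerve C) (n - 1) (j - 1) (face (nerve C) n i s)"
  using assms coface_le[of _ "n - 1"]
  by (intro nerve_simplex_eqI[OF face_extensional face_extensional])
    (simp_all add: face_vertex face_edge face_triangle pairs_def triples_def coface_less coface_coface[OF assms(1)])

lemma continuous_face:
  assumes "1 \<le> n"
  shows "continuous_map (nerve_space C n) (nerve_space C (n - 1)) (face (nerve C) n i)"
proof (rule continuous_nerveI)
  have id: "continuous_map (nerve_space C n) (nerve_space C n) (\<lambda>s. s)" by simp
  note D = continuous_nerveD[OF this]
  show "continuous_map (nerve_space C n) (Ob C) (\<lambda>s. vertex (face (nerve C) n i s) v)" if "v \<le> n - 1" for v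
    using that assms by (simp add: face_vertex D coface_le)
  show "continuous_map (nerve_space C n) (Mor C) (\<lambda>s. edge (face (nerve C) n i s) (a, b))"
    if "a < b" "b \<le> n - 1" for a b
    using that assms by (simp add: face_edge pairs_def D coface_le coface_less)
  show "continuous_map (nerve_space C n) (Cell C) (\<lambda>s. triangle (face (nerve C) n i s) (a, b, c))"
    if "a < b" "b < c" "c \<le> n - 1" for a b c
    using that assms by (simp add: face_triangle triples_def D coface_le coface_less)
  show "nerve_extensional (n - 1) (face (nerve C) n i s)" for s
    by (rule face_extensional)
  show "is_nerve_simplex C (n - 1) (face (nerve C) n i s)" if "s \<in> topspace (nerve_space C n)" for s
    using that assms by (intro is_nerve_simplex_face) (simp_all only: topspace_nerve)
qed

lemma simplices_nerve [simp]: "simplices (nerve C) = nerve_space C"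
  by (simp add: geometric_nerve_def)

lemma continuous_horn_map:
  assumes "1 \<le> n" "k \<le> n"
  shows "continuous_map (nerve_space C n) (horn (nerve C) n k) (horn_map (nerve C) n k)"
  unfolding horn_def
proof (rule continuous_map_into_subtopology)
  have "horn_map (nerve C) n k s i = face (nerve C) n i s" if "i \<in> {0..n} - {k}" for s i
    using that by (simp add: horn_map_def)
  then show "continuous_map (nerve_space C n)
      (product_topology (\<lambda>_. simplices (nerve C) (n - 1)) ({0..n} - {k})) (horn_map (nerve C) n k)"
    using continuous_face[OF assms(1)]
    by (auto simp: continuous_map_componentwise horn_map_def)
  have "face (nerve C) (n - 1) i (face (nerve C) n j s) =
    face (nerve C) (n - 1) (j - 1) (face (nerve C) n i s)"
    if "i < j" "i \<in> {0..n} - {k}" "j \<in> {0..n} - {k}" for i j and s :: "('o, 'm, 'c) nerve_simplex"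
  proof (cases "n = 1")
    \<comment> \<open>A horn of dimension one has a single face, so there is no pair i < j to
      compare.\<close>
    case True
    with that assms(2) have False by auto
    then show ?thesis ..
  next
    case False
    with assms that show ?thesis by (intro face_face) auto
  qed
  then show "horn_map (nerve C) n k \<in> topspace (nerve_space C n) \<rightarrow>
     {z. \<forall>i \<in> {0..n} - {k}. \<forall>j \<in> {0..n} - {k}. i < j \<longrightarrow>
             face (nerve C) (n - 1) i (z j) = face (nerve C) (n - 1) (j - 1) (z i)}"
    by (auto simp: horn_map_def)
qed

lemma continuous_horn_component:
  assumes "continuous_map T (horn (nerve C) n k) H" "i \<le> n" "i \<noteq> k"
  shows "continuous_map T (nerve_space C (n - 1)) (\<lambda>t. H t i)"
proof -
  have "continuous_map T (product_topology (\<lambda>_. nerve_space C (n - 1)) ({0..n} - {k})) H"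
    using assms(1) unfolding horn_def simplices_nerve by (rule continuous_map_into_fulltopology)
  then show ?thesis using assms by (simp add: continuous_map_componentwise)
qed

text \<open>
  The faces of a horn agree on the common indices and hence are the faces of one collection of
  objects, 1-morphisms and 2-morphisms.  At the index sets that contain all of \<open>{0..n} - {k}\<close>
  this collection is junk, and \<open>LEAST\<close> is taken of the empty predicate.
\<close>

definition horn_index :: "nat \<Rightarrow> nat \<Rightarrow> nat set \<Rightarrow> nat" where
  "horn_index n k S = (LEAST i. i \<le> n \<and> i \<noteq> k \<and> i \<notin> S)"

definition glue :: "nat \<Rightarrow> nat \<Rightarrow> (nat \<Rightarrow> ('o, 'm, 'c) nerve_simplex) \<Rightarrow> ('o, 'm, 'c) nerve_simplex" where
  "glue n k z =
    (\<lambda>v. let i = horn_index n k {v} in vertex (z i) (cod i v),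
     \<lambda>(a, b). let i = horn_index n k {a, b} in edge (z i) (cod i a, cod i b),
     \<lambda>(a, b, c). let i = horn_index n k {a, b, c} in triangle (z i) (cod i a, cod i b, cod i c))"

lemma horn_index:
  assumes "i \<le> n" "i \<noteq> k" "i \<notin> S"
  shows "horn_index n k S \<le> n" "horn_index n k S \<noteq> k" "horn_index n k S \<notin> S"
  using LeastI[of "\<lambda>i. i \<le> n \<and> i \<noteq> k \<and> i \<notin> S" i] assms unfolding horn_index_def by auto

text \<open>The compatibility condition for i < j compares two faces on the vertex sets that avoid
  both i and j, and \<open>cod_cod\<close> translates the double renumbering. Hence an entry does
  not depend on the face from which it is read.\<close>

lemma horn_agree:
  assumes z: "z \<in> topspace (horn (nerve C) n k)"
    and ij: "i \<le> n" "i \<noteq> k" "j \<le> n" "j \<noteq> k"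
  shows "\<lbrakk>v \<le> n; i \<notin> {v}; j \<notin> {v}\<rbrakk> \<Longrightarrow> vertex (z i) (cod i v) = vertex (z j) (cod j v)"
    "\<lbrakk>a < b; b \<le> n; i \<notin> {a, b}; j \<notin> {a, b}\<rbrakk> \<Longrightarrow> edge (z i) (cod i a, cod i b) = edge (z j) (cod j a, cod j b)"
    "\<lbrakk>a < b; b < c; c \<le> n; i \<notin> {a, b, c}; j \<notin> {a, b, c}\<rbrakk> \<Longrightarrow>
      triangle (z i) (cod i a, cod i b, cod i c) = triangle (z j) (cod j a, cod j b, cod j c)"
proof -
  have comp: "face (nerve C) (n - 1) i (z j) = face (nerve C) (n - 1) (j - 1) (z i)"
    if "i < j" "i \<le> n" "i \<noteq> k" "j \<le> n" "j \<noteq> k" for i j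
    using z that by (simp add: horn_def)
  have le: "cod i (cod j v) \<le> n - 1 - 1" if "i < j" "j \<le> n" "v \<le> n" "v \<noteq> i" "v \<noteq> j" for i j v
    using that by (auto simp: cod_def)
  have lt: "cod i (cod j a) < cod i (cod j b)" if "i < j" "a < b" "i \<notin> {a, b}" "j \<notin> {a, b}" for i j a b
    using that by (auto simp: cod_def)
  have V: "vertex (z i) (cod i v) = vertex (z j) (cod j v)"
    if "i < j" "i \<le> n" "i \<noteq> k" "j \<le> n" "j \<noteq> k" "v \<le> n" "i \<notin> {v}" "j \<notin> {v}" for i j v
  proof -
    have "vertex (face (nerve C) (n - 1) i (z j)) (cod i (cod j v)) =
      vertex (face (nerve C) (n - 1) (j - 1) (z i)) (cod i (cod j v))"
      using comp that by simp
    then show ?thesis using that le[of i j v] cod_cod[of i j v] by (simp add: face_vertex)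
  qed
  have E: "edge (z i) (cod i a, cod i b) = edge (z j) (cod j a, cod j b)"
    if "i < j" "i \<le> n" "i \<noteq> k" "j \<le> n" "j \<noteq> k" "a < b" "b \<le> n" "i \<notin> {a, b}" "j \<notin> {a, b}" for i j a b
  proof -
    have "edge (face (nerve C) (n - 1) i (z j)) (cod i (cod j a), cod i (cod j b)) =
      edge (face (nerve C) (n - 1) (j - 1) (z i)) (cod i (cod j a), cod i (cod j b))"
      using comp that by simp
    then show ?thesis
      using that le[of i j b] lt[of i j a b] cod_cod[of i j a] cod_cod[of i j b]
      by (simp add: face_edge pairs_def)
  qed
  have W: "triangle (z i) (cod i a, cod i b, cod i c) = triangle (z j) (cod j a, cod j b, cod j c)"
    if "i < j" "i \<le> n" "i \<noteq> k" "j \<le> n" "j \<noteq> k" "a < b" "b < c" "c \<le> n" "i \<notin> {a, b, c}" "j \<notin> {a, b, c}" for i j a b c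
  proof -
    have "triangle (face (nerve C) (n - 1) i (z j)) (cod i (cod j a), cod i (cod j b), cod i (cod j c)) =
      triangle (face (nerve C) (n - 1) (j - 1) (z i)) (cod i (cod j a), cod i (cod j b), cod i (cod j c))"
      using comp that by simp
    then show ?thesis
      using that le[of i j c] lt[of i j a b] lt[of i j b c] cod_cod[of i j a] cod_cod[of i j b] cod_cod[of i j c]
      by (simp add: face_triangle triples_def)
  qed
  show "vertex (z i) (cod i v) = vertex (z j) (cod j v)"
    if p: "v \<le> n" "i \<notin> {v}" "j \<notin> {v}"
  proof (rule linorder_cases[of i j])
    assume "i < j"
    from V[OF this ij p] show ?thesis .
  next
    assume "j < i"
    from V[OF this ij(3,4,1,2) p(1,3,2)] show ?thesis by (rule sym)
  qed simp
  show "edge (z i) (cod i a, cod i b) = edge (z j) (cod j a, cod j b)"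
    if p: "a < b" "b \<le> n" "i \<notin> {a, b}" "j \<notin> {a, b}"
  proof (rule linorder_cases[of i j])
    assume "i < j"
    from E[OF this ij p] show ?thesis .
  next
    assume "j < i"
    from E[OF this ij(3,4,1,2) p(1,2,4,3)] show ?thesis by (rule sym)
  qed simp
  show "triangle (z i) (cod i a, cod i b, cod i c) = triangle (z j) (cod j a, cod j b, cod j c)"
    if p: "a < b" "b < c" "c \<le> n" "i \<notin> {a, b, c}" "j \<notin> {a, b, c}"
  proof (rule linorder_cases[of i j])
    assume "i < j"
    from W[OF this ij p] show ?thesis .
  next
    assume "j < i"
    from W[OF this ij(3,4,1,2) p(1,2,3,5,4)] show ?thesis by (rule sym)
  qed simp
qed

text \<open>\<open>horn_index\<close> may select a face other than \<open>i\<close>; but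
  \<open>i\<close> witnesses that an admissible face exists, and \<open>horn_agree\<close> compares
  the two.\<close>

lemma face_glue:
  assumes z: "z \<in> topspace (horn (nerve C) n k)" and n: "1 \<le> n" and i: "i \<le> n" "i \<noteq> k"
  shows "face (nerve C) n i (glue n k z) = z i"
proof (rule nerve_simplex_eqI[OF face_extensional])
  have "z i \<in> topspace (nerve_space C (n - 1))" using z i by (auto simp: horn_def)
  then show "nerve_extensional (n - 1) (z i)" by (simp add: topspace_nerve)
  show "vertex (face (nerve C) n i (glue n k z)) v = vertex (z i) v" if v: "v \<le> n - 1" for v
  proof -
    have "i \<notin> {coface i v}" by simp
    note p = horn_index[OF i this]
    show ?thesis
      using horn_agree(1)[OF z p(1,2) i, of "coface i v"] p(3) v n by (simp add: face_vertex glue_def Let_def coface_le)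
  qed
  show "edge (face (nerve C) n i (glue n k z)) (a, b) = edge (z i) (a, b)" if ab: "a < b" "b \<le> n - 1" for a b
  proof -
    have "i \<notin> {coface i a, coface i b}" by simp
    note p = horn_index[OF i this]
    show ?thesis
      using horn_agree(2)[OF z p(1,2) i, of "coface i a" "coface i b"] p(3) ab n
      by (simp add: face_edge pairs_def glue_def Let_def coface_le coface_less)
  qed
  show "triangle (face (nerve C) n i (glue n k z)) (a, b, c) = triangle (z i) (a, b, c)"
    if abc: "a < b" "b < c" "c \<le> n - 1" for a b c
  proof -
    have "i \<notin> {coface i a, coface i b, coface i c}" by simp
    note p = horn_index[OF i this]
    show ?thesis
      using horn_agree(3)[OF z p(1,2) i, of "coface i a" "coface i b" "coface i c"] p(3) abc n
      by (simp add: face_triangle triples_def glue_def Let_def coface_le coface_less)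
  qed
qed

text \<open>The face from which an entry is read depends on its indices and not on \<open>t\<close>,
  so each entry is a fixed coordinate of the horn.\<close>

lemma continuous_glue:
  assumes H: "continuous_map T (horn (nerve C) n k) H" and i: "i \<le> n" "i \<noteq> k"
  shows "\<lbrakk>v \<le> n; i \<notin> {v}\<rbrakk> \<Longrightarrow> continuous_map T (Ob C) (\<lambda>t. vertex (glue n k (H t)) v)"
    "\<lbrakk>a < b; b \<le> n; i \<notin> {a, b}\<rbrakk> \<Longrightarrow> continuous_map T (Mor C) (\<lambda>t. edge (glue n k (H t)) (a, b))"
    "\<lbrakk>a < b; b < c; c \<le> n; i \<notin> {a, b, c}\<rbrakk> \<Longrightarrow>
      continuous_map T (Cell C) (\<lambda>t. triangle (glue n k (H t)) (a, b, c))"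
proof -
  show "continuous_map T (Ob C) (\<lambda>t. vertex (glue n k (H t)) v)" if "v \<le> n" "i \<notin> {v}"
  proof -
    note p = horn_index[OF i that(2)]
    show ?thesis
      using continuous_nerveD(1)[OF continuous_horn_component[OF H p(1,2)] cod_le[of v n]] that p
      by (simp add: glue_def Let_def)
  qed
  show "continuous_map T (Mor C) (\<lambda>t. edge (glue n k (H t)) (a, b))" if "a < b" "b \<le> n" "i \<notin> {a, b}"
  proof -
    note p = horn_index[OF i that(3)]
    show ?thesis
      using continuous_nerveD(2)[OF continuous_horn_component[OF H p(1,2)] cod_less[of a b] cod_le[of b n]] that p
      by (simp add: glue_def Let_def)
  qed
  show "continuous_map T (Cell C) (\<lambda>t. triangle (glue n k (H t)) (a, b, c))" if "a < b" "b < c" "c \<le> n" "i \<notin> {a, b, c}"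
  proof -
    note p = horn_index[OF i that(4)]
    show ?thesis
      using continuous_nerveD(3)[OF continuous_horn_component[OF H p(1,2)] cod_less[of a b] cod_less[of b c] cod_le[of c n]] that p
      by (simp add: glue_def Let_def)
  qed
qed

lemma glue_simplex:
  assumes z: "z \<in> topspace (horn (nerve C) n k)" and n: "1 \<le> n" and i: "i \<le> n" "i \<noteq> k"
  shows "is_nerve_simplex C (n - 1) (face (nerve C) n i (glue n k z))"
proof -
  have "z i \<in> topspace (nerve_space C (n - 1))" using z i by (auto simp: horn_def)
  then show ?thesis unfolding face_glue[OF assms] by (simp add: topspace_nerve)
qed

definition restrict_simplex :: "nat \<Rightarrow> ('o, 'm, 'c) nerve_simplex \<Rightarrow> ('o, 'm, 'c) nerve_simplex" where
  "restrict_simplex n s = (restrict (vertex s) {0..n}, restrict (edge s) (pairs n), restrict (triangle s) (triples n))"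

lemma restrict_simplex_simps [simp]:
  "v \<le> n \<Longrightarrow> vertex (restrict_simplex n s) v = vertex s v"
  "a < b \<Longrightarrow> b \<le> n \<Longrightarrow> edge (restrict_simplex n s) (a, b) = edge s (a, b)"
  "a < b \<Longrightarrow> b < c \<Longrightarrow> c \<le> n \<Longrightarrow> triangle (restrict_simplex n s) (a, b, c) = triangle s (a, b, c)"
  "nerve_extensional n (restrict_simplex n s)"
  by (auto simp: restrict_simplex_def pairs_def triples_def nerve_extensional_def)

lemma is_nerve_simplex_restrict [simp]:
  "is_nerve_simplex C n (restrict_simplex n s) \<longleftrightarrow> is_nerve_simplex C n s"
proof -
  have c: "cocycle C (edge (restrict_simplex n s)) (triangle (restrict_simplex n s)) a b c d \<longleftrightarrow>
    cocycle C (edge s) (triangle s) a b c d" if "a < b \<and> b < c \<and> c < d \<and> d \<le> n" for a b c d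
    using that by (simp add: cocycle_def)
  show ?thesis
    unfolding is_nerve_simplex_iff
    by (intro conj_cong all_cong) (auto simp: c)
qed

lemma horn_map_eqI:
  assumes z: "z \<in> topspace (horn (nerve C) n k)" and n: "1 \<le> n"
    and "\<And>v i. \<lbrakk>v \<le> n; i \<le> n; i \<noteq> k; i \<notin> {v}\<rbrakk> \<Longrightarrow> vertex s v = vertex (glue n k z) v"
    and "\<And>a b i. \<lbrakk>a < b; b \<le> n; i \<le> n; i \<noteq> k; i \<notin> {a, b}\<rbrakk> \<Longrightarrow> edge s (a, b) = edge (glue n k z) (a, b)"
    and "\<And>a b c i. \<lbrakk>a < b; b < c; c \<le> n; i \<le> n; i \<noteq> k; i \<notin> {a, b, c}\<rbrakk> \<Longrightarrow>
       triangle s (a, b, c) = triangle (glue n k z) (a, b, c)"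
  shows "horn_map (nerve C) n k s = z"
proof (rule extensionalityI[of _ "{0..n} - {k}"])
  show "horn_map (nerve C) n k s \<in> extensional ({0..n} - {k})" by (simp add: horn_map_def)
  show "z \<in> extensional ({0..n} - {k})" using z by (auto simp: horn_def PiE_iff)
  fix i assume i: "i \<in> {0..n} - {k}"
  have "face (nerve C) n i s = face (nerve C) n i (glue n k z)"
  proof (rule nerve_simplex_eqI[OF face_extensional face_extensional])
    show "vertex (face (nerve C) n i s) v = vertex (face (nerve C) n i (glue n k z)) v"
      if "v \<le> n - 1" for v
      using that assms(3)[of "coface i v" i] i n by (simp add: face_vertex coface_le)
    show "edge (face (nerve C) n i s) (a, b) = edge (face (nerve C) n i (glue n k z)) (a, b)"
      if "a < b" "b \<le> n - 1" for a b
      using that assms(4)[of "coface i a" "coface i b" i] i n by (simp add: face_edge pairs_def coface_le coface_less)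
    show "triangle (face (nerve C) n i s) (a, b, c) = triangle (face (nerve C) n i (glue n k z)) (a, b, c)"
      if "a < b" "b < c" "c \<le> n - 1" for a b c
      using that assms(5)[of "coface i a" "coface i b" "coface i c" i] i n
      by (simp add: face_triangle triples_def coface_le coface_less)
  qed
  also have "\<dots> = z i" using i by (intro face_glue[OF z n]) auto
  finally show "horn_map (nerve C) n k s i = z i" using i by (simp add: horn_map_def)
qed

lemma horn_map_eqD:
  assumes "horn_map (nerve C) n k s = horn_map (nerve C) n k s'" and i: "i \<le> n" "i \<noteq> k"
  shows "\<lbrakk>v \<le> n; i \<notin> {v}\<rbrakk> \<Longrightarrow> vertex s v = vertex s' v"
    "\<lbrakk>a < b; b \<le> n; i \<notin> {a, b}\<rbrakk> \<Longrightarrow> edge s (a, b) = edge s' (a, b)"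
    "\<lbrakk>a < b; b < c; c \<le> n; i \<notin> {a, b, c}\<rbrakk> \<Longrightarrow> triangle s (a, b, c) = triangle s' (a, b, c)"
proof -
  have f: "face (nerve C) n i s = face (nerve C) n i s'"
    using fun_cong[OF assms(1), of i] i by (simp add: horn_map_def)
  show "vertex s v = vertex s' v" if "v \<le> n" "i \<notin> {v}"
    using face_vertex[of "cod i v" n i s] face_vertex[of "cod i v" n i s'] that i f
    by (simp del: One_nat_def add: cod_le coface_cod)
  show "edge s (a, b) = edge s' (a, b)" if "a < b" "b \<le> n" "i \<notin> {a, b}"
    using face_edge[of "cod i a" "cod i b" n i s] face_edge[of "cod i a" "cod i b" n i s'] that i f
    by (simp del: One_nat_def add: cod_le cod_less coface_cod pairs_def)
  show "triangle s (a, b, c) = triangle s' (a, b, c)" if "a < b" "b < c" "c \<le> n" "i \<notin> {a, b, c}"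
    using face_triangle[of "cod i a" "cod i b" "cod i c" n i s] face_triangle[of "cod i a" "cod i b" "cod i c" n i s'] that i f
    by (simp del: One_nat_def add: cod_le cod_less coface_cod triples_def)
qed

end

text \<open>Says that the entry at \<open>S\<close> is part of the horn: \<open>S\<close> lies in
  the face opposite to some index other than \<open>k\<close>. The lemmas that follow decide by
  counting which entries a filler has to supply.\<close>

definition free_index :: "nat \<Rightarrow> nat \<Rightarrow> nat set \<Rightarrow> bool" where
  "free_index n k S \<longleftrightarrow> (\<exists>i \<le> n. i \<noteq> k \<and> i \<notin> S)"

lemma free_index_of_card:
  assumes "finite S" "card (insert k S) \<le> n"
  shows "free_index n k S"
proof (rule ccontr)
  assume "\<not> free_index n k S"
  then have "{0..n} \<subseteq> insert k S" by (auto simp: free_index_def)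
  then have "card {0..n} \<le> card (insert k S)" using assms(1) by (intro card_mono) auto
  then show False using assms(2) by simp
qed

lemma free_index_1: "2 \<le> n \<Longrightarrow> free_index n k {v}"
  using card_length[of "[k, v]"] by (intro free_index_of_card) simp_all

lemma free_index_2: "3 \<le> n \<Longrightarrow> free_index n k {a, b}"
  using card_length[of "[k, a, b]"] by (intro free_index_of_card) simp_all

lemma free_index_3: "4 \<le> n \<Longrightarrow> free_index n k {a, b, c}"
  using card_length[of "[k, a, b, c]"] by (intro free_index_of_card) simp_all

lemma free_index_mem:
  assumes "k \<in> S" "finite S" "card S \<le> n"
  shows "free_index n k S"
  using assms by (intro free_index_of_card) (auto simp: insert_absorb)

text \<open>Under these assumptions \<open>S\<close> is the whole vertex set of the face opposite to
  \<open>k\<close>, which is the face absent from the horn.\<close>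

lemma not_free_index:
  assumes "k \<notin> S" "S \<subseteq> {0..n}" "card S = n" "k \<le> n"
  shows "\<not> free_index n k S"
proof -
  have "finite S" using assms(2) finite_subset by blast
  have "S = {0..n} - {k}"
    using assms by (intro card_subset_eq) auto
  then show ?thesis by (auto simp: free_index_def)
qed

text \<open>One 1-morphism and one 2-morphism suffice in every dimension from two on. For n = 2 the
  edge opposite to \<open>k\<close> and the triangle are missing, for n = 3 the triangle opposite to
  \<open>k\<close>, and for n >= 4 neither an edge nor a triangle.\<close>

definition fill :: "nat \<Rightarrow> nat \<Rightarrow> (nat \<Rightarrow> ('o, 'm, 'c) nerve_simplex) \<Rightarrow> 'm \<Rightarrow> 'c \<Rightarrow> ('o, 'm, 'c) nerve_simplex" where
  "fill n k z u w = restrict_simplex n (vertex (glue n k z),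
     \<lambda>(a, b). if free_index n k {a, b} then edge (glue n k z) (a, b) else u,
     \<lambda>(a, b, c). if free_index n k {a, b, c} then triangle (glue n k z) (a, b, c) else w)"

lemma fill_simps:
  "v \<le> n \<Longrightarrow> vertex (fill n k z u w) v = vertex (glue n k z) v"
  "a < b \<Longrightarrow> b \<le> n \<Longrightarrow> edge (fill n k z u w) (a, b) = (if free_index n k {a, b} then edge (glue n k z) (a, b) else u)"
  "a < b \<Longrightarrow> b < c \<Longrightarrow> c \<le> n \<Longrightarrow> triangle (fill n k z u w) (a, b, c) =
     (if free_index n k {a, b, c} then triangle (glue n k z) (a, b, c) else w)"
  "nerve_extensional n (fill n k z u w)"
  unfolding fill_def by simp_all

lemma horn_map_fill:
  assumes "z \<in> topspace (horn (nerve C) n k)" "1 \<le> n"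
  shows "horn_map (nerve C) n k (fill n k z u w) = z"
  by (rule horn_map_eqI[OF assms]) (auto simp: fill_simps free_index_def)

lemma glueD:
  assumes z: "z \<in> topspace (horn (nerve C) n k)" and n: "1 \<le> n"
  shows "\<lbrakk>a < b; b \<le> n; free_index n k {a, b}\<rbrakk> \<Longrightarrow>
      mor C (edge (glue n k z) (a, b)) (vertex (glue n k z) a) (vertex (glue n k z) b)"
    "\<lbrakk>a < b; b < c; c \<le> n; free_index n k {a, b, c}\<rbrakk> \<Longrightarrow>
       cell C (triangle (glue n k z) (a, b, c)) (edge (glue n k z) (a, c))
         (edge (glue n k z) (b, c) \<odot>\<^bsub>C\<^esub> edge (glue n k z) (a, b))"
    "\<lbrakk>a < b; b < c; c < d; d \<le> n; free_index n k {a, b, c, d}\<rbrakk> \<Longrightarrow>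
       cocycle C (edge (glue n k z)) (triangle (glue n k z)) a b c d"
  unfolding free_index_def
  using is_nerve_simplex_faceD[OF glue_simplex[OF z n]] by metis+

lemma continuous_fill:
  assumes H: "continuous_map T (horn (nerve C) n k) H" and n: "2 \<le> n"
    and u: "continuous_map T (Mor C) u" and w: "continuous_map T (Cell C) w"
    and s: "\<And>t. t \<in> topspace T \<Longrightarrow> is_nerve_simplex C n (fill n k (H t) (u t) (w t))"
  shows "continuous_map T (nerve_space C n) (\<lambda>t. fill n k (H t) (u t) (w t))"
proof (rule continuous_nerveI)
  show "continuous_map T (Ob C) (\<lambda>t. vertex (fill n k (H t) (u t) (w t)) v)" if "v \<le> n" for v
    using continuous_glue(1)[OF H] free_index_1[OF n, of k v] that
    by (auto simp: fill_simps free_index_def)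
  show "continuous_map T (Mor C) (\<lambda>t. edge (fill n k (H t) (u t) (w t)) (a, b))" if "a < b" "b \<le> n" for a b
    using continuous_glue(2)[OF H _ _ that] u that
    by (cases "free_index n k {a, b}") (auto simp: fill_simps free_index_def)
  show "continuous_map T (Cell C) (\<lambda>t. triangle (fill n k (H t) (u t) (w t)) (a, b, c))" if "a < b" "b < c" "c \<le> n" for a b c
    using continuous_glue(3)[OF H _ _ that] w that
    by (cases "free_index n k {a, b, c}") (auto simp: fill_simps free_index_def)
qed (simp_all add: fill_simps s)

definition Kan_at :: "('o, 'm, 'c) bicat \<Rightarrow> nat \<Rightarrow> nat \<Rightarrow> bool" where
  "Kan_at C n k \<longleftrightarrow>
    Serre_fibration (nerve_space C n) (horn (nerve C) n k) (horn_map (nerve C) n k) \<and>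
    horn_map (nerve C) n k ` topspace (nerve_space C n) = topspace (horn (nerve C) n k)"

text \<open>Where the horn determines the simplex, fillers have to be found in continuous families
  but without regard to an initial value.\<close>

lemma Kan_at_of_unique_fill:
  assumes n: "2 \<le> n" and k: "k \<le> n"
    and inj: "inj_on (horn_map (nerve C) n k) (topspace (nerve_space C n))"
    and lift: "\<And>m H. continuous_map (cylinder m) (horn (nerve C) n k) H \<Longrightarrow>
      \<exists>u w. continuous_map (cylinder m) (Mor C) u \<and>
         continuous_map (cylinder m) (Cell C) w \<and>
         (\<forall>t \<in> topspace (cylinder m). is_nerve_simplex C n (fill n k (H t) (u t) (w t)))"
  shows "Kan_at C n k"
proof -
  have "\<exists>K. continuous_map (cylinder m) (nerve_space C n) K \<and>
      (\<forall>t \<in> topspace (cylinder m). horn_map (nerve C) n k (K t) = H t)"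
    if H: "continuous_map (cylinder m) (horn (nerve C) n k) H" for m H
  proof -
    let ?T = "cylinder m"
    obtain u w where u: "continuous_map ?T (Mor C) u" and w: "continuous_map ?T (Cell C) w"
      and s: "\<And>t. t \<in> topspace ?T \<Longrightarrow> is_nerve_simplex C n (fill n k (H t) (u t) (w t))"
      using lift[OF H] by blast
    have "horn_map (nerve C) n k (fill n k (H t) (u t) (w t)) = H t" if "t \<in> topspace ?T" for t
    proof (rule horn_map_fill)
      show "H t \<in> topspace (horn (nerve C) n k)"
        by (rule continuous_map_mem[OF H that])
    qed (use n in simp)
    with continuous_fill[OF H n u w s] show ?thesis by blast
  qed
  moreover have "continuous_map (nerve_space C n) (horn (nerve C) n k) (horn_map (nerve C) n k)"
    using n k by (intro continuous_horn_map) auto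
  ultimately show ?thesis
    unfolding Kan_at_def using Serre_fibration_surjective_of_lifts[OF _ inj] by blast
qed

section \<open>Horns of dimension at least four\<close>

context bigroupoid
begin

text \<open>The hypothesis covers the tetrahedra containing \<open>k\<close>. The one left over is
  opposite to \<open>k\<close>, and \<open>cocycle_4_simplex\<close> supplies its condition.\<close>

lemma is_nerve_simplex_of_horn_4:
  assumes k: "k \<le> 4"
    and e: "\<And>a b. a < b \<Longrightarrow> b \<le> 4 \<Longrightarrow> mor C (edge s (a, b)) (vertex s a) (vertex s b)"
    and t: "\<And>a b c. \<lbrakk>a < b; b < c; c \<le> 4\<rbrakk> \<Longrightarrow>
       cell C (triangle s (a, b, c)) (edge s (a, c)) (edge s (b, c) \<odot> edge s (a, b))"
    and c: "\<And>a b c d. \<lbrakk>a < b; b < c; c < d; d \<le> 4; k \<in> {a, b, c, d}\<rbrakk> \<Longrightarrow> cocycle C (edge s) (triangle s) a b c d"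
  shows "is_nerve_simplex C 4 s"
proof -
  note P = cocycle_4_simplex[where u = "edge s" and w = "triangle s" and x = "vertex s"]
  \<comment> \<open>Listed by the omitted vertex 0, ..., 4, like the conclusions of the five parts
    of \<open>P\<close>.\<close>
  note cs = c[of 1 2 3 4] c[of 0 2 3 4] c[of 0 1 3 4] c[of 0 1 2 4] c[of 0 1 2 3]
  have k': "k = 0 \<or> k = 1 \<or> k = 2 \<or> k = 3 \<or> k = 4" using k by auto
  have all: "cocycle C (edge s) (triangle s) 1 2 3 4 \<and> cocycle C (edge s) (triangle s) 0 2 3 4 \<and>
    cocycle C (edge s) (triangle s) 0 1 3 4 \<and> cocycle C (edge s) (triangle s) 0 1 2 4 \<and>
    cocycle C (edge s) (triangle s) 0 1 2 3"
    using k'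
  proof (elim disjE)
    assume "k = 0"
    then show ?thesis using P(1) cs by (simp add: e t del: One_nat_def)
  next
    assume "k = 1"
    then show ?thesis using P(2) cs by (simp add: e t del: One_nat_def)
  next
    assume "k = 2"
    then show ?thesis using P(3) cs by (simp add: e t del: One_nat_def)
  next
    assume "k = 3"
    then show ?thesis using P(4) cs by (simp add: e t del: One_nat_def)
  next
    assume "k = 4"
    then show ?thesis using P(5) cs by (simp add: e t del: One_nat_def)
  qed
  have cc: "cocycle C (edge s) (triangle s) a b c d" if "a < b" "b < c" "c < d" "d \<le> 4" for a b c d
  proof -
    have "a = 0 \<or> a = 1" "b = 1 \<or> b = 2" "c = 2 \<or> c = 3" "d = 3 \<or> d = 4"
      using that by linarith+
    then show ?thesis using all that by (elim disjE conjE) simp_all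
  qed
  show ?thesis
    unfolding is_nerve_simplex_iff by (intro conjI allI impI; elim conjE; rule e t cc)
qed

end

context topological_bigroupoid
begin

text \<open>All edges and triangles come from the horn. For n >= 5 all tetrahedra do as well; for n
  = 4 the one opposite to \<open>k\<close> is the business of
  \<open>is_nerve_simplex_of_horn_4\<close>.\<close>

lemma is_nerve_simplex_fill_4:
  assumes z: "z \<in> topspace (horn (nerve C) n k)" and n: "4 \<le> n" and k: "k \<le> n"
  shows "is_nerve_simplex C n (fill n k z u w)"
proof -
  have n1: "1 \<le> n" using n by simp
  let ?s = "fill n k z u w"
  have f: "vertex ?s v = vertex (glue n k z) v" if "v \<le> n" for v
    using that by (simp add: fill_simps)
  have g: "edge ?s (a, b) = edge (glue n k z) (a, b)" if "a < b" "b \<le> n" for a b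
    using that n by (simp add: fill_simps free_index_2)
  have h: "triangle ?s (a, b, c) = triangle (glue n k z) (a, b, c)" if "a < b" "b < c" "c \<le> n" for a b c
    using that n by (simp add: fill_simps free_index_3)
  have e: "mor C (edge ?s (a, b)) (vertex ?s a) (vertex ?s b)" if "a < b" "b \<le> n" for a b
    using glueD(1)[OF z n1 that free_index_2] n that by (simp add: f g)
  have t: "cell C (triangle ?s (a, b, c)) (edge ?s (a, c)) (edge ?s (b, c) \<odot> edge ?s (a, b))"
    if "a < b" "b < c" "c \<le> n" for a b c
    using glueD(2)[OF z n1 that free_index_3] n that by (simp add: g h)
  have c: "cocycle C (edge ?s) (triangle ?s) a b c d"
    if "a < b" "b < c" "c < d" "d \<le> n" "free_index n k {a, b, c, d}" for a b c d
    using glueD(3)[OF z n1 that] that by (simp add: g h cocycle_def)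
  show ?thesis
  proof (cases "n = 4")
    case True
    have "free_index n k {a, b, c, d}" if "k \<in> {a, b, c, d}" "a < b" "b < c" "c < d" for a b c d
      using that True by (intro free_index_mem) auto
    then have c': "cocycle C (edge ?s) (triangle ?s) a b c d"
      if "a < b" "b < c" "c < d" "d \<le> n" "k \<in> {a, b, c, d}" for a b c d
      using c[OF that(1-4)] that by blast
    show ?thesis
      unfolding True by (rule is_nerve_simplex_of_horn_4[OF k[unfolded True] e[unfolded True] t[unfolded True] c'[unfolded True]])
  next
    case False
    have "5 \<le> n" using n False by linarith
    then have f: "free_index n k {a, b, c, d}" for a b c d
      using card_length[of "[k, a, b, c, d]"] by (intro free_index_of_card) simp_all
    show ?thesis
      unfolding is_nerve_simplex_iff by (intro conjI allI impI; elim conjE; rule e t c[OF _ _ _ _ f])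
  qed
qed

lemma Kan_at_ge_4:
  assumes n: "4 \<le> n" and k: "k \<le> n"
  shows "Kan_at C n k"
proof (rule Kan_at_of_unique_fill)
  show "inj_on (horn_map (nerve C) n k) (topspace (nerve_space C n))"
  proof (rule inj_onI)
    fix s s' assume s: "s \<in> topspace (nerve_space C n)" "s' \<in> topspace (nerve_space C n)"
      and eq: "horn_map (nerve C) n k s = horn_map (nerve C) n k s'"
    show "s = s'"
    proof (rule nerve_simplex_eqI[of n])
      show "vertex s v = vertex s' v" if "v \<le> n" for v
        using horn_map_eqD(1)[OF eq _ _ that] free_index_1[of n k v] n unfolding free_index_def by auto
      show "edge s (a, b) = edge s' (a, b)" if "a < b" "b \<le> n" for a b
        using horn_map_eqD(2)[OF eq _ _ that] free_index_2[of n k a b] n unfolding free_index_def by auto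
      show "triangle s (a, b, c) = triangle s' (a, b, c)" if "a < b" "b < c" "c \<le> n" for a b c
        using horn_map_eqD(3)[OF eq _ _ that] free_index_3[of n k a b c] n unfolding free_index_def by auto
    qed (use s in \<open>simp_all only: topspace_nerve\<close>)
  qed
next
  fix m H
  let ?T = "cylinder m"
  assume H: "continuous_map ?T (horn (nerve C) n k) H"
  have Hz: "H t \<in> topspace (horn (nerve C) n k)" if "t \<in> topspace ?T" for t
    by (rule continuous_map_mem[OF H that])
  \<comment> \<open>For n >= 4 an edge and a triangle of the horn serve as continuous placeholders
    for the arguments of \<open>fill\<close>.\<close>
  have "continuous_map ?T (Mor C) (\<lambda>t. edge (glue n k (H t)) (0, 1))"
    using continuous_glue(2)[OF H, of _ 0 1] free_index_2[of n k 0 1] n unfolding free_index_def by auto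
  moreover have "continuous_map ?T (Cell C) (\<lambda>t. triangle (glue n k (H t)) (0, 1, 2))"
    using continuous_glue(3)[OF H, of _ 0 1 2] free_index_3[of n k 0 1 2] n unfolding free_index_def by auto
  ultimately show "\<exists>u w. continuous_map ?T (Mor C) u \<and> continuous_map ?T (Cell C) w \<and>
      (\<forall>t \<in> topspace ?T. is_nerve_simplex C n (fill n k (H t) (u t) (w t)))"
    using is_nerve_simplex_fill_4[OF Hz n k] by blast
qed (use assms in auto)

end

section \<open>Horns of dimension three\<close>

context bigroupoid
begin

lemma vcomp_solve_left:
  assumes "c \<in> D" "a \<in> D" "b \<in> D" "tgt2 C a = src2 C c" "tgt2 C b = tgt2 C c"
  shows "c \<cdot> a = b \<longleftrightarrow> a = vinv c \<cdot> b"
proof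
  assume "a = vinv c \<cdot> b"
  then show "c \<cdot> a = b" using assms(1,3,5) by simp
qed (use assms in \<open>auto intro: move_inv_left\<close>)

lemma vcomp_solve_right:
  assumes "c \<in> D" "a \<in> D" "b \<in> D" "src2 C a = tgt2 C c" "src2 C b = src2 C c"
  shows "a \<cdot> c = b \<longleftrightarrow> a = b \<cdot> vinv c"
  using vcomp_right_iff[of a "b \<cdot> vinv c" c] assms by simp

text \<open>\<open>unwhisker_right\<close> is a left inverse of whiskering. Fullness provides some
  \<open>b\<close> with \<open>b \<lhd> f = c\<close>; the formula returns this \<open>b\<close>,
  and so it is the unique solution.\<close>

lemma whisker_right_solve:
  assumes "f \<in> M" "g \<in> M" "h \<in> M" "h' \<in> M" "src C h = x" "src C h' = x" "src C g = x" "tgt C f = x"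
    "tgt C g = src C f" "tgt C h' = tgt C h" "e \<in> D" "src2 C e = f \<odot> g" "tgt2 C e = one C x"
    and c: "c \<in> D" "src2 C c = h \<odot> f" "tgt2 C c = h' \<odot> f"
  shows "cell C a h h' \<and> a \<lhd> f = c \<longleftrightarrow> a = unwhisker_right h h' f g e c"
proof -
  obtain b where b: "b \<in> D" "src2 C b = h" "tgt2 C b = h'" "b \<lhd> f = c"
    by (rule whisker_right_full[of h h' f c]) (use assms in simp_all)
  have u: "unwhisker_right h h' f g e (a \<lhd> f) = a" if "a \<in> D" "src2 C a = h" "tgt2 C a = h'" for a
    by (rule unwhisker_right[where x = x]) (use assms that in simp_all)
  show ?thesis using u[OF b(1-3)] u[of a] b by (auto simp: cell_iff)
qed

lemma whisker_left_solve:
  assumes "f \<in> M" "g \<in> M" "h \<in> M" "h' \<in> M" "tgt C h = x" "tgt C h' = x" "src C f = x" "tgt C g = x"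
    "src C g = tgt C f" "src C h' = src C h" "n \<in> D" "src2 C n = one C x" "tgt2 C n = g \<odot> f"
    and c: "c \<in> D" "src2 C c = f \<odot> h" "tgt2 C c = f \<odot> h'"
  shows "cell C a h h' \<and> f \<rhd> a = c \<longleftrightarrow> a = unwhisker_left h h' f g n c"
proof -
  obtain b where b: "b \<in> D" "src2 C b = h" "tgt2 C b = h'" "f \<rhd> b = c"
    by (rule whisker_left_full[of h h' f c]) (use assms in simp_all)
  have u: "unwhisker_left h h' f g n (f \<rhd> a) = a" if "a \<in> D" "src2 C a = h" "tgt2 C a = h'" for a
    by (rule unwhisker_left[where x = x]) (use assms that in simp_all)
  show ?thesis using u[OF b(1-3)] u[of a] b by (auto simp: cell_iff)
qed

text \<open>The cocycle equation solved for each of its triangles: \<open>p\<close>,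
  \<open>q\<close>, \<open>r\<close>, \<open>s\<close> are those at 012, 023, 123, 013. For
  \<open>q\<close> and \<open>s\<close>, which belong to the inner horns, inverse cells are enough;
  \<open>r\<close> and \<open>p\<close> occur whiskered by \<open>a\<close> and \<open>c\<close>,
  and the whiskering has to be undone.\<close>

lemma tetrahedron:
  fixes a b c u02 u13 u03
  assumes "a \<in> M" "b \<in> M" "c \<in> M" "u02 \<in> M" "u13 \<in> M" "u03 \<in> M"
    and "src C a = x0" "src C b = x1" "src C c = x2" "src C u02 = x0" "src C u13 = x1" "src C u03 = x0"
    and "tgt C a = x1" "tgt C b = x2" "tgt C c = x3" "tgt C u02 = x2" "tgt C u13 = x3" "tgt C u03 = x3"
  defines "E p q r s \<equiv> assoc C c b a \<cdot> (c \<rhd> p) \<cdot> q = (r \<lhd> a) \<cdot> s"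
  shows
    "\<lbrakk>cell C p u02 (b \<odot> a); cell C r u13 (c \<odot> b); cell C s u03 (u13 \<odot> a)\<rbrakk> \<Longrightarrow>
      cell C q u03 (c \<odot> u02) \<and> E p q r s \<longleftrightarrow>
      q = vinv (c \<rhd> p) \<cdot> vinv (assoc C c b a) \<cdot> (r \<lhd> a) \<cdot> s"
    "\<lbrakk>cell C p u02 (b \<odot> a); cell C q u03 (c \<odot> u02); cell C r u13 (c \<odot> b)\<rbrakk> \<Longrightarrow>
      cell C s u03 (u13 \<odot> a) \<and> E p q r s \<longleftrightarrow>
      s = vinv (r \<lhd> a) \<cdot> assoc C c b a \<cdot> (c \<rhd> p) \<cdot> q"
    "\<lbrakk>cell C p u02 (b \<odot> a); cell C q u03 (c \<odot> u02); cell C s u03 (u13 \<odot> a);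
      g \<in> M; src C g = x1; tgt C g = x0; e \<in> D; src2 C e = a \<odot> g; tgt2 C e = one C x1\<rbrakk> \<Longrightarrow>
      cell C r u13 (c \<odot> b) \<and> E p q r s \<longleftrightarrow>
      r = unwhisker_right u13 (c \<odot> b) a g e ((assoc C c b a \<cdot> (c \<rhd> p) \<cdot> q) \<cdot> vinv s)"
    "\<lbrakk>cell C q u03 (c \<odot> u02); cell C r u13 (c \<odot> b); cell C s u03 (u13 \<odot> a);
      g' \<in> M; src C g' = x3; tgt C g' = x2; n \<in> D; src2 C n = one C x2; tgt2 C n = g' \<odot> c\<rbrakk> \<Longrightarrow>
      cell C p u02 (b \<odot> a) \<and> E p q r s \<longleftrightarrow>
      p = unwhisker_left u02 (b \<odot> a) c g' n ((vinv (assoc C c b a) \<cdot> (r \<lhd> a) \<cdot> s) \<cdot> vinv q)"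
proof -
  note e = assms(1-18)
  show "cell C q u03 (c \<odot> u02) \<and> E p q r s \<longleftrightarrow> q = vinv (c \<rhd> p) \<cdot> vinv (assoc C c b a) \<cdot> (r \<lhd> a) \<cdot> s" (is "_ \<longleftrightarrow> q = ?q")
    if "cell C p u02 (b \<odot> a)" "cell C r u13 (c \<odot> b)" "cell C s u03 (u13 \<odot> a)"
  proof -
    have "cell C ?q u03 (c \<odot> u02)" using e that unfolding cell_iff by simp
    moreover have "E p q r s \<longleftrightarrow> q = ?q" if "cell C q u03 (c \<odot> u02)"
      using e that \<open>cell C p u02 (b \<odot> a)\<close> \<open>cell C r u13 (c \<odot> b)\<close> \<open>cell C s u03 (u13 \<odot> a)\<close>
      unfolding cell_iff E_def by (simp add: vcomp_solve_left)
    ultimately show ?thesis by blast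
  qed
  show "cell C s u03 (u13 \<odot> a) \<and> E p q r s \<longleftrightarrow> s = vinv (r \<lhd> a) \<cdot> assoc C c b a \<cdot> (c \<rhd> p) \<cdot> q" (is "_ \<longleftrightarrow> s = ?s")
    if "cell C p u02 (b \<odot> a)" "cell C q u03 (c \<odot> u02)" "cell C r u13 (c \<odot> b)"
  proof -
    have "cell C ?s u03 (u13 \<odot> a)" using e that unfolding cell_iff by simp
    moreover have "E p q r s \<longleftrightarrow> (r \<lhd> a) \<cdot> s = assoc C c b a \<cdot> (c \<rhd> p) \<cdot> q" unfolding E_def by (rule eq_commute)
    moreover have "\<dots> \<longleftrightarrow> s = ?s" if "cell C s u03 (u13 \<odot> a)"
      by (rule vcomp_solve_left) (use e that \<open>cell C p u02 (b \<odot> a)\<close> \<open>cell C q u03 (c \<odot> u02)\<close> \<open>cell C r u13 (c \<odot> b)\<close>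
        in \<open>simp_all add: cell_iff\<close>)
    ultimately show ?thesis by blast
  qed
  show "cell C r u13 (c \<odot> b) \<and> E p q r s \<longleftrightarrow>
      r = unwhisker_right u13 (c \<odot> b) a g e ((assoc C c b a \<cdot> (c \<rhd> p) \<cdot> q) \<cdot> vinv s)"
    if "cell C p u02 (b \<odot> a)" "cell C q u03 (c \<odot> u02)" and s: "cell C s u03 (u13 \<odot> a)"
      and g: "g \<in> M" "src C g = x1" "tgt C g = x0" "e \<in> D" "src2 C e = a \<odot> g" "tgt2 C e = one C x1"
  proof -
    let ?c = "assoc C c b a \<cdot> (c \<rhd> p) \<cdot> q"
    have c: "?c \<in> D" "src2 C ?c = u03" "tgt2 C ?c = (c \<odot> b) \<odot> a"
      using e that(1,2) unfolding cell_iff by simp_all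
    have "E p q r s \<longleftrightarrow> (r \<lhd> a) \<cdot> s = ?c" unfolding E_def by (rule eq_commute)
    moreover have "\<dots> \<longleftrightarrow> r \<lhd> a = ?c \<cdot> vinv s" if "cell C r u13 (c \<odot> b)"
      by (rule vcomp_solve_right) (use e c s that in \<open>simp_all add: cell_iff\<close>)
    moreover have "cell C r u13 (c \<odot> b) \<and> r \<lhd> a = ?c \<cdot> vinv s \<longleftrightarrow> r = unwhisker_right u13 (c \<odot> b) a g e (?c \<cdot> vinv s)"
      by (rule whisker_right_solve) (use e c s g in \<open>simp_all add: cell_iff del: vcomp_assoc_simp\<close>)
    ultimately show ?thesis by blast
  qed
  show "cell C p u02 (b \<odot> a) \<and> E p q r s \<longleftrightarrow>
      p = unwhisker_left u02 (b \<odot> a) c g' n ((vinv (assoc C c b a) \<cdot> (r \<lhd> a) \<cdot> s) \<cdot> vinv q)"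
    if q: "cell C q u03 (c \<odot> u02)" and "cell C r u13 (c \<odot> b)" "cell C s u03 (u13 \<odot> a)"
      and g: "g' \<in> M" "src C g' = x3" "tgt C g' = x2" "n \<in> D" "src2 C n = one C x2" "tgt2 C n = g' \<odot> c"
  proof -
    let ?c = "vinv (assoc C c b a) \<cdot> (r \<lhd> a) \<cdot> s"
    have c: "(r \<lhd> a) \<cdot> s \<in> D" "tgt2 C ((r \<lhd> a) \<cdot> s) = (c \<odot> b) \<odot> a" "?c \<in> D" "src2 C ?c = u03" "tgt2 C ?c = c \<odot> (b \<odot> a)"
      using e that(2,3) unfolding cell_iff by simp_all
    have "E p q r s \<longleftrightarrow> (c \<rhd> p) \<cdot> q = ?c" if "cell C p u02 (b \<odot> a)"
      unfolding E_def by (rule vcomp_solve_left) (use e c q that in \<open>simp_all add: cell_iff\<close>)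
    moreover have "(c \<rhd> p) \<cdot> q = ?c \<longleftrightarrow> c \<rhd> p = ?c \<cdot> vinv q" if "cell C p u02 (b \<odot> a)"
      by (rule vcomp_solve_right) (use e c q that in \<open>simp_all add: cell_iff\<close>)
    moreover have "cell C p u02 (b \<odot> a) \<and> c \<rhd> p = ?c \<cdot> vinv q \<longleftrightarrow> p = unwhisker_left u02 (b \<odot> a) c g' n (?c \<cdot> vinv q)"
      by (rule whisker_left_solve) (use e c q g in \<open>simp_all add: cell_iff del: vcomp_assoc_simp\<close>)
    ultimately show ?thesis by blast
  qed
qed

end

lemma free_index_3_iff:
  assumes "k \<le> 3" "a < b" "b < c" "c \<le> 3"
  shows "free_index 3 k {a, b, c} \<longleftrightarrow> k \<in> {a, b, c}"
  using free_index_mem[of k "{a, b, c}" 3] not_free_index[of k "{a, b, c}" 3] assms by auto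

context topological_bigroupoid
begin

definition missing_triangle :: "nat \<Rightarrow> nat \<times> nat \<times> nat" where
  "missing_triangle k = (if k = 0 then (1, 2, 3) else if k = 1 then (0, 2, 3) else if k = 2 then (0, 1, 3) else (0, 1, 2))"

text \<open>The four solutions of \<open>tetrahedron\<close>, selected by the horn. In the
  applications \<open>g\<close>, \<open>n\<close>, \<open>e\<close> are adjoint data for the edge 23
  if k = 3 and for the edge 01 otherwise.\<close>

definition solve_cocycle ::
  "nat \<Rightarrow> (nat \<times> nat \<Rightarrow> 'b) \<Rightarrow> (nat \<times> nat \<times> nat \<Rightarrow> 'c) \<Rightarrow> 'b \<Rightarrow> 'c \<Rightarrow> 'c \<Rightarrow> 'c" where
  "solve_cocycle k u w g n e = (let a = u (0, 1); b = u (1, 2); c = u (2, 3);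
      p = w (0, 1, 2); q = w (0, 2, 3); r = w (1, 2, 3); s = w (0, 1, 3) in
    if k = 0 then unwhisker_right (u (1, 3)) (c \<odot> b) a g e ((assoc C c b a \<cdot> (c \<rhd> p) \<cdot> q) \<cdot> vinv s)
    else if k = 1 then vinv (c \<rhd> p) \<cdot> vinv (assoc C c b a) \<cdot> (r \<lhd> a) \<cdot> s
    else if k = 2 then vinv (r \<lhd> a) \<cdot> assoc C c b a \<cdot> (c \<rhd> p) \<cdot> q
    else unwhisker_left (u (0, 2)) (b \<odot> a) c g n ((vinv (assoc C c b a) \<cdot> (r \<lhd> a) \<cdot> s) \<cdot> vinv q))"

lemma triples_3: "(a::nat) < b \<Longrightarrow> b < c \<Longrightarrow> c \<le> 3 \<Longrightarrow> (a, b, c) \<in> {(0, 1, 2), (0, 2, 3), (1, 2, 3), (0, 1, 3)}"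
proof -
  assume abc: "a < b" "b < c" "c \<le> 3"
  then have "a = 0 \<or> a = 1" "b = 1 \<or> b = 2" "c = 2 \<or> c = 3" by linarith+
  then show ?thesis using abc by (elim disjE) simp_all
qed

text \<open>\<open>T\<close> selects the triangles whose type is known: those containing
  \<open>k\<close> for a horn, \<open>UNIV\<close> for a complete simplex.\<close>

definition triangles_typed ::
  "(nat \<times> nat \<Rightarrow> 'b) \<Rightarrow> (nat \<times> nat \<times> nat \<Rightarrow> 'c) \<Rightarrow> (nat \<times> nat \<times> nat) set \<Rightarrow> bool" where
  "triangles_typed u w T \<longleftrightarrow> (\<forall>i j l. i < j \<and> j < l \<and> l \<le> 3 \<and> (i, j, l) \<in> T \<longrightarrow>
    cell C (w (i, j, l)) (u (i, l)) (u (j, l) \<odot> u (i, j)))"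

lemma triangles_typed_iff:
  "triangles_typed u w T \<longleftrightarrow>
    ((0, 1, 2) \<in> T \<longrightarrow> cell C (w (0, 1, 2)) (u (0, 2)) (u (1, 2) \<odot> u (0, 1))) \<and>
    ((0, 2, 3) \<in> T \<longrightarrow> cell C (w (0, 2, 3)) (u (0, 3)) (u (2, 3) \<odot> u (0, 2))) \<and>
    ((1, 2, 3) \<in> T \<longrightarrow> cell C (w (1, 2, 3)) (u (1, 3)) (u (2, 3) \<odot> u (1, 2))) \<and>
    ((0, 1, 3) \<in> T \<longrightarrow> cell C (w (0, 1, 3)) (u (0, 3)) (u (1, 3) \<odot> u (0, 1)))" (is "_ \<longleftrightarrow> ?R")
proof
  assume R: ?R
  have "cell C (w (i, j, l)) (u (i, l)) (u (j, l) \<odot> u (i, j))"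
    if "i < j" "j < l" "l \<le> 3" "(i, j, l) \<in> T" for i j l
    using triples_3[OF that(1-3)] that(4) R by (elim insertE emptyE Pair_inject) simp_all
  then show "triangles_typed u w T" unfolding triangles_typed_def by blast
qed (simp add: triangles_typed_def)

text \<open>Both directions are used: from left to right fillers are unique, from right to left the
  formula is one. The type of the missing triangle stands on the left side because the formula
  already enforces it.\<close>

lemma cocycle_iff_solve_cocycle:
  assumes k: "k \<le> 3"
    and u: "\<And>i j. i < j \<Longrightarrow> j \<le> 3 \<Longrightarrow> mor C (u (i, j)) (x i) (x j)"
    and w: "triangles_typed u w {(i, j, l). k \<in> {i, j, l}}"
    and ad: "adjoint_equivalence C (if k = 3 then u (2, 3) else u (0, 1)) g n e"
  shows "triangles_typed u w UNIV \<and> cocycle C u w 0 1 2 3 \<longleftrightarrow>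
    w (missing_triangle k) = solve_cocycle k u w g n e"
proof -
  have m: "u (0, 1) \<in> M" "u (1, 2) \<in> M" "u (2, 3) \<in> M" "u (0, 2) \<in> M" "u (1, 3) \<in> M" "u (0, 3) \<in> M"
    "src C (u (0, 1)) = x 0" "src C (u (1, 2)) = x 1" "src C (u (2, 3)) = x 2"
    "src C (u (0, 2)) = x 0" "src C (u (1, 3)) = x 1" "src C (u (0, 3)) = x 0"
    "tgt C (u (0, 1)) = x 1" "tgt C (u (1, 2)) = x 2" "tgt C (u (2, 3)) = x 3"
    "tgt C (u (0, 2)) = x 2" "tgt C (u (1, 3)) = x 3" "tgt C (u (0, 3)) = x 3"
    using u[of 0 1] u[of 1 2] u[of 2 3] u[of 0 2] u[of 1 3] u[of 0 3] unfolding mor_iff by simp_all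
  note tet = tetrahedron[OF m]
  have "k = 0 \<or> k = 1 \<or> k = 2 \<or> k = 3" using k by linarith
  then show ?thesis
  proof (elim disjE)
    assume k: "k = 0"
    have ad: "adjoint_equivalence C (u (0, 1)) g n e" using ad k by simp
    have c: "cell C (w (0, 1, 2)) (u (0, 2)) (u (1, 2) \<odot> u (0, 1))" "cell C (w (0, 2, 3)) (u (0, 3)) (u (2, 3) \<odot> u (0, 2))"
      "cell C (w (0, 1, 3)) (u (0, 3)) (u (1, 3) \<odot> u (0, 1))"
      using w unfolding triangles_typed_iff k by simp_all
    note ad = adjoint_equivalenceD[OF ad m(7,13)]
    show ?thesis
      using tet(3)[OF c ad(1-3,7-9), of "w (1, 2, 3)"] c
      unfolding triangles_typed_iff cocycle_def solve_cocycle_def missing_triangle_def Let_def k by simp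
  next
    assume k: "k = 1"
    have c: "cell C (w (0, 1, 2)) (u (0, 2)) (u (1, 2) \<odot> u (0, 1))" "cell C (w (1, 2, 3)) (u (1, 3)) (u (2, 3) \<odot> u (1, 2))"
      "cell C (w (0, 1, 3)) (u (0, 3)) (u (1, 3) \<odot> u (0, 1))"
      using w unfolding triangles_typed_iff k by simp_all
    show ?thesis
      using tet(1)[OF c, of "w (0, 2, 3)"] c
      unfolding triangles_typed_iff cocycle_def solve_cocycle_def missing_triangle_def Let_def k by simp
  next
    assume k: "k = 2"
    have c: "cell C (w (0, 1, 2)) (u (0, 2)) (u (1, 2) \<odot> u (0, 1))" "cell C (w (0, 2, 3)) (u (0, 3)) (u (2, 3) \<odot> u (0, 2))"
      "cell C (w (1, 2, 3)) (u (1, 3)) (u (2, 3) \<odot> u (1, 2))"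
      using w unfolding triangles_typed_iff k by simp_all
    show ?thesis
      using tet(2)[OF c, of "w (0, 1, 3)"] c
      unfolding triangles_typed_iff cocycle_def solve_cocycle_def missing_triangle_def Let_def k by simp
  next
    assume k: "k = 3"
    have ad: "adjoint_equivalence C (u (2, 3)) g n e" using ad k by simp
    have c: "cell C (w (0, 2, 3)) (u (0, 3)) (u (2, 3) \<odot> u (0, 2))" "cell C (w (1, 2, 3)) (u (1, 3)) (u (2, 3) \<odot> u (1, 2))"
      "cell C (w (0, 1, 3)) (u (0, 3)) (u (1, 3) \<odot> u (0, 1))"
      using w unfolding triangles_typed_iff k by simp_all
    note ad = adjoint_equivalenceD[OF ad m(9,15)]
    show ?thesis
      using tet(4)[OF c ad(1-6), of "w (0, 1, 2)"] c
      unfolding triangles_typed_iff cocycle_def solve_cocycle_def missing_triangle_def Let_def k by simp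
  qed
qed

text \<open>The formula reads the edges and the triangles that contain \<open>k\<close>, hence data
  of the horn; a candidate for the missing triangle does not influence it.\<close>

lemma solve_cocycle_cong:
  assumes k: "k \<le> 3"
    and u: "\<And>i j. i < j \<Longrightarrow> j \<le> 3 \<Longrightarrow> u (i, j) = u' (i, j)"
    and w: "\<And>i j l. \<lbrakk>i < j; j < l; l \<le> 3; k \<in> {i, j, l}\<rbrakk> \<Longrightarrow> w (i, j, l) = w' (i, j, l)"
  shows "solve_cocycle k u w g n e = solve_cocycle k u' w' g n e"
proof -
  have "k = 0 \<or> k = 1 \<or> k = 2 \<or> k = 3" using k by linarith
  then show ?thesis
    by (elim disjE) (simp_all add: solve_cocycle_def u w)
qed

lemma continuous_solve_cocycle:
  assumes k: "k \<le> 3"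
    and uc: "\<And>i j. i < j \<Longrightarrow> j \<le> 3 \<Longrightarrow> continuous_map T (Mor C) (\<lambda>t. u t (i, j))"
    and wc: "\<And>i j l. \<lbrakk>i < j; j < l; l \<le> 3; k \<in> {i, j, l}\<rbrakk> \<Longrightarrow> continuous_map T (Cell C) (\<lambda>t. w t (i, j, l))"
    and gc: "continuous_map T (Mor C) g" "continuous_map T (Cell C) n" "continuous_map T (Cell C) e"
    and u: "\<And>t i j. \<lbrakk>t \<in> topspace T; i < j; j \<le> 3\<rbrakk> \<Longrightarrow> mor C (u t (i, j)) (x t i) (x t j)"
    and w: "\<And>t. t \<in> topspace T \<Longrightarrow> triangles_typed (u t) (w t) {(i, j, l). k \<in> {i, j, l}}"
    and ad: "\<And>t. t \<in> topspace T \<Longrightarrow> adjoint_equivalence C (if k = 3 then u t (2, 3) else u t (0, 1)) (g t) (n t) (e t)"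
  shows "continuous_map T (Cell C) (\<lambda>t. solve_cocycle k (u t) (w t) (g t) (n t) (e t))"
proof -
  have m: "u t (i, j) \<in> M" "src C (u t (i, j)) = x t i" "tgt C (u t (i, j)) = x t j"
    if "t \<in> topspace T" "i < j" "j \<le> 3" for t i j
    using u[OF that] unfolding mor_iff by simp_all
  have o: "x t i \<in> topspace (Ob C)" if "t \<in> topspace T" "i < 3" for t i
    using src_tgt_simps(1)[OF m(1)[OF that(1), of i 3]] m(2)[OF that(1), of i 3] that(2) by simp
  have c: "w t (i, j, l) \<in> D" "src2 C (w t (i, j, l)) = u t (i, l)" "tgt2 C (w t (i, j, l)) = u t (j, l) \<odot> u t (i, j)"
    if "t \<in> topspace T" "i < j" "j < l" "l \<le> 3" "k \<in> {i, j, l}" for t i j l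
    using w[OF that(1)] that unfolding triangles_typed_def cell_iff by blast+
  have ad': "g t \<in> M" "src C (g t) = (if k = 3 then x t 3 else x t 1)" "tgt C (g t) = (if k = 3 then x t 2 else x t 0)"
    "n t \<in> D" "src2 C (n t) = one C (if k = 3 then x t 2 else x t 0)" "tgt2 C (n t) = g t \<odot> (if k = 3 then u t (2, 3) else u t (0, 1))"
    "e t \<in> D" "src2 C (e t) = (if k = 3 then u t (2, 3) else u t (0, 1)) \<odot> g t" "tgt2 C (e t) = one C (if k = 3 then x t 3 else x t 1)"
    if t: "t \<in> topspace T" for t
    using adjoint_equivalenceD[OF ad[OF t] refl refl] m[OF t, of 2 3] m[OF t, of 0 1] by (auto split: if_splits)
  have "k = 0 \<or> k = 1 \<or> k = 2 \<or> k = 3" using k by linarith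
  then show ?thesis
    by (elim disjE; simp only: solve_cocycle_def Let_def unwhisker_right_def unwhisker_left_def if_True if_False
          zero_neq_one one_neq_zero zero_neq_numeral numeral_eq_iff numeral_eq_one_iff one_eq_numeral_iff semiring_norm simp_thms;
        intro continuous_operations uc wc gc; simp add: m o c ad' del: One_nat_def)
qed

lemma is_nerve_simplex_fill_3:
  assumes z: "z \<in> topspace (horn (nerve C) 3 k)" and k: "k \<le> 3"
    and w: "triangles_typed (edge (glue 3 k z)) w' UNIV" "cocycle C (edge (glue 3 k z)) w' 0 1 2 3"
    and w': "w' = (\<lambda>(a, b, c). if k \<in> {a, b, c} then triangle (glue 3 k z) (a, b, c) else w)"
  shows "is_nerve_simplex C 3 (fill 3 k z u w)"
proof -
  let ?s = "fill 3 k z u w"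
  have g: "edge ?s (a, b) = edge (glue 3 k z) (a, b)" if "a < b" "b \<le> 3" for a b
    using that by (simp add: fill_simps free_index_2)
  have h: "triangle ?s (a, b, c) = w' (a, b, c)" if "a < b" "b < c" "c \<le> 3" for a b c
    unfolding w' case_prod_conv free_index_3_iff[OF k that, symmetric] using that by (simp add: fill_simps)
  have "mor C (edge ?s (a, b)) (vertex ?s a) (vertex ?s b)" if "a < b" "b \<le> 3" for a b
    using glueD(1)[OF z _ that free_index_2] that by (simp add: g fill_simps(1))
  moreover have "cell C (triangle ?s (a, b, c)) (edge ?s (a, c)) (edge ?s (b, c) \<odot> edge ?s (a, b))"
    if "a < b" "b < c" "c \<le> 3" for a b c
    using w(1)[unfolded triangles_typed_def, rule_format, of a b c] that by (simp add: g h)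
  moreover have "cocycle C (edge ?s) (triangle ?s) 0 1 2 3"
    using w(2) unfolding cocycle_def by (simp add: g h del: One_nat_def)
  moreover have "a = 0 \<and> b = 1 \<and> c = 2 \<and> d = 3" if "a < b" "b < c" "c < d" "d \<le> 3" for a b c d :: nat
    using that by linarith
  ultimately show ?thesis unfolding is_nerve_simplex_iff by blast
qed

lemma missing_triangle_mem:
  assumes "k \<le> 3"
  shows "a < b \<Longrightarrow> b < c \<Longrightarrow> c \<le> 3 \<Longrightarrow> k \<in> {a, b, c} \<or> (a, b, c) = missing_triangle k"
    "(case missing_triangle k of (a, b, c) \<Rightarrow> if k \<in> {a, b, c} then v (a, b, c) else w) = w"
proof -
  have k: "k = 0 \<or> k = 1 \<or> k = 2 \<or> k = 3" using assms by linarith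
  then show "(case missing_triangle k of (a, b, c) \<Rightarrow> if k \<in> {a, b, c} then v (a, b, c) else w) = w"
    by (elim disjE) (simp_all add: missing_triangle_def)
  show "a < b \<Longrightarrow> b < c \<Longrightarrow> c \<le> 3 \<Longrightarrow> k \<in> {a, b, c} \<or> (a, b, c) = missing_triangle k"
    using k triples_3[of a b c] by (elim disjE) (auto simp: missing_triangle_def)
qed

lemma Kan_at_3:
  assumes k: "k \<le> 3"
  shows "Kan_at C 3 k"
proof (rule Kan_at_of_unique_fill)
  show "inj_on (horn_map (nerve C) 3 k) (topspace (nerve_space C 3))"
  proof (rule inj_onI)
    fix s s' assume s: "s \<in> topspace (nerve_space C 3)" "s' \<in> topspace (nerve_space C 3)"
      and eq: "horn_map (nerve C) 3 k s = horn_map (nerve C) 3 k s'"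
    have v: "vertex s v = vertex s' v" if "v \<le> 3" for v
      using horn_map_eqD(1)[OF eq _ _ that] free_index_1[of 3 k v] unfolding free_index_def by auto
    have e: "edge s (a, b) = edge s' (a, b)" if "a < b" "b \<le> 3" for a b
      using horn_map_eqD(2)[OF eq _ _ that] free_index_2[of 3 k a b] unfolding free_index_def by auto
    have t: "triangle s (a, b, c) = triangle s' (a, b, c)" if "a < b" "b < c" "c \<le> 3" "k \<in> {a, b, c}" for a b c
      using horn_map_eqD(3)[OF eq _ _ that(1-3)] free_index_3_iff[OF k that(1-3)] that(4) unfolding free_index_def by auto
    have m: "mor C (edge r (a, b)) (vertex r a) (vertex r b)"
      if "r \<in> topspace (nerve_space C 3)" "a < b" "b \<le> 3" for r a b
      using that unfolding topspace_nerve is_nerve_simplex_iff by blast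
    have c: "triangles_typed (edge r) (triangle r) T" "cocycle C (edge r) (triangle r) 0 1 2 3"
      if "r \<in> topspace (nerve_space C 3)" for r T
    proof -
      have "is_nerve_simplex C 3 r" using that by (simp only: topspace_nerve)
      note * = this[unfolded is_nerve_simplex_iff]
      show "triangles_typed (edge r) (triangle r) T"
        using *[THEN conjunct2, THEN conjunct1] unfolding triangles_typed_def by blast
      show "cocycle C (edge r) (triangle r) 0 1 2 3"
        using *[THEN conjunct2, THEN conjunct2, rule_format, of 0 1 2 3] by simp
    qed
    \<comment> \<open>The edges of \<open>s\<close> and \<open>s'\<close> agree, so one adjoint
      equivalence serves both, and the two missing triangles are values of one formula at the same
      arguments.\<close>
    have "(if k = 3 then edge s (2, 3) else edge s (0, 1)) \<in> M"
      using m[OF s(1), of 2 3] m[OF s(1), of 0 1] unfolding mor_iff by simp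
    from adjoint_equivalence_exists[OF this] obtain g n d
      where ad: "adjoint_equivalence C (if k = 3 then edge s (2, 3) else edge s (0, 1)) g n d" by blast
    have sol: "triangle r (missing_triangle k) = solve_cocycle k (edge r) (triangle r) g n d"
      if r: "r \<in> topspace (nerve_space C 3)"
        and "adjoint_equivalence C (if k = 3 then edge r (2, 3) else edge r (0, 1)) g n d" for r
      using cocycle_iff_solve_cocycle[OF k m[OF r] c(1)[OF r] that(2)] c[OF r] by blast
    have "adjoint_equivalence C (if k = 3 then edge s' (2, 3) else edge s' (0, 1)) g n d"
      using ad e[of 2 3] e[of 0 1] by (auto split: if_splits)
    from sol[OF s(1) ad] sol[OF s(2) this]
    have "triangle s (missing_triangle k) = triangle s' (missing_triangle k)"
      using solve_cocycle_cong[of k "edge s" "edge s'" "triangle s" "triangle s'"] k e t by simp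
    then have "triangle s (a, b, c) = triangle s' (a, b, c)" if "a < b" "b < c" "c \<le> 3" for a b c
      using t[OF that] missing_triangle_mem(1)[OF k that] by auto
    then show "s = s'"
      using v e s by (intro nerve_simplex_eqI[of 3]) (simp_all add: topspace_nerve)
  qed
next
  fix m H
  let ?T = "cylinder m"
  assume H: "continuous_map ?T (horn (nerve C) 3 k) H"
  have Hz: "H t \<in> topspace (horn (nerve C) 3 k)" if "t \<in> topspace ?T" for t
    by (rule continuous_map_mem[OF H that])
  define u w where "u t = edge (glue 3 k (H t))" and "w t = triangle (glue 3 k (H t))" for t
  have uc: "continuous_map ?T (Mor C) (\<lambda>t. u t (a, b))" if "a < b" "b \<le> 3" for a b
    using continuous_glue(2)[OF H _ _ that] free_index_2[of 3 k a b] unfolding free_index_def u_def by auto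
  have wc: "continuous_map ?T (Cell C) (\<lambda>t. w t (a, b, c))" if "a < b" "b < c" "c \<le> 3" "k \<in> {a, b, c}" for a b c
    using continuous_glue(3)[OF H _ _ that(1-3)] free_index_3_iff[OF k that(1-3)] that(4)
    unfolding free_index_def w_def by auto
  have um: "mor C (u t (a, b)) (vertex (glue 3 k (H t)) a) (vertex (glue 3 k (H t)) b)"
    if "t \<in> topspace ?T" "a < b" "b \<le> 3" for t a b
    using glueD(1)[OF Hz[OF that(1)] _ that(2,3) free_index_2] unfolding u_def by simp
  have wt: "triangles_typed (u t) (w t) {(i, j, l). k \<in> {i, j, l}}" if "t \<in> topspace ?T" for t
    unfolding triangles_typed_def u_def w_def
    using glueD(2)[OF Hz[OF that]] free_index_3_iff[OF k] by simp
  have "continuous_map ?T (Mor C) (\<lambda>t. if k = 3 then u t (2, 3) else u t (0, 1))"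
    using uc[of 2 3] uc[of 0 1] by (cases "k = 3") simp_all
  from continuous_adjoint_equivalence[OF this] obtain g n e
    where gc: "continuous_map ?T (Mor C) g" "continuous_map ?T (Cell C) n" "continuous_map ?T (Cell C) e"
      and ad: "\<And>t. t \<in> topspace ?T \<Longrightarrow> adjoint_equivalence C (if k = 3 then u t (2, 3) else u t (0, 1)) (g t) (n t) (e t)"
    by blast
  define v where "v t = solve_cocycle k (u t) (w t) (g t) (n t) (e t)" for t
  have vc: "continuous_map ?T (Cell C) v"
    unfolding v_def by (rule continuous_solve_cocycle[OF k uc wc gc um wt ad])
  have "is_nerve_simplex C 3 (fill 3 k (H t) (u t (0, 1)) (v t))" if t: "t \<in> topspace ?T" for t
  proof -
    \<comment> \<open>The horn completed by \<open>v t\<close>. The triangles that enter the formula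
      are unchanged, so \<open>v t\<close> is also the solution computed from
      \<open>w'\<close>.\<close>
    define w' where "w' = (\<lambda>(a, b, c). if k \<in> {a, b, c} then w t (a, b, c) else v t)"
    have "triangles_typed (u t) w' {(i, j, l). k \<in> {i, j, l}}"
      using wt[OF t] unfolding triangles_typed_def w'_def by simp
    note iff = cocycle_iff_solve_cocycle[OF k _ this ad[OF t]]
    have "w' (missing_triangle k) = v t"
      unfolding w'_def by (rule missing_triangle_mem(2)[OF k])
    also have "\<dots> = solve_cocycle k (u t) w' (g t) (n t) (e t)"
      unfolding v_def by (rule solve_cocycle_cong[OF k]) (simp_all add: w'_def)
    finally have "triangles_typed (u t) w' UNIV \<and> cocycle C (u t) w' 0 1 2 3"
      by (rule iffD2[OF iff, rotated]) (rule um[OF t])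
    then show ?thesis
      unfolding u_def by (elim conjE, intro is_nerve_simplex_fill_3[OF Hz[OF t] k])
        (simp_all only: w'_def w_def)
  qed
  then show "\<exists>u w. continuous_map ?T (Mor C) u \<and> continuous_map ?T (Cell C) w \<and>
      (\<forall>t \<in> topspace ?T. is_nerve_simplex C 3 (fill 3 k (H t) (u t) (w t)))"
    \<comment> \<open>All edges lie in the horn here; the edge at (0, 1) is a placeholder.\<close>
    using vc uc[of 0 1] by (intro exI[of _ "\<lambda>t. u t (0, 1)"] exI[of _ v]) simp
qed (use assms in auto)

end

section \<open>Horns of dimension two\<close>

lemma free_index_2_iff:
  assumes "k \<le> 2" "a < b" "b \<le> 2"
  shows "free_index 2 k {a, b} \<longleftrightarrow> k \<in> {a, b}"
  using free_index_mem[of k "{a, b}" 2] not_free_index[of k "{a, b}" 2] assms by auto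

lemma not_free_index_2: "\<not> free_index 2 k {0, 1, 2}"
proof
  assume "free_index 2 k {0, 1, 2 :: nat}"
  then obtain i :: nat where "i \<le> 2" "i \<noteq> 0" "i \<noteq> 1" "i \<noteq> 2" unfolding free_index_def by auto
  then show False by linarith
qed

lemma fill_2_simps:
  assumes "k \<le> 2"
  shows "a < b \<Longrightarrow> b \<le> 2 \<Longrightarrow> edge (fill 2 k z u w) (a, b) = (if k \<in> {a, b} then edge (glue 2 k z) (a, b) else u)"
    "triangle (fill 2 k z u w) (0, 1, 2) = w"
  using not_free_index_2[of k] by (simp_all add: fill_simps free_index_2_iff[OF assms] del: One_nat_def)

lemma indices_2:
  fixes a b c :: nat
  assumes "a < b" "b < c" "c \<le> 2"
  shows "a = 0" "b = 1" "c = 2"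
  using assms by linarith+

lemma missing_edge_2:
  fixes a b :: nat
  assumes "a < b" "b \<le> 2"
  shows "0 \<notin> {a, b} \<Longrightarrow> a = 1 \<and> b = 2" (is "PROP ?P0") "1 \<notin> {a, b} \<Longrightarrow> a = 0 \<and> b = 2" (is "PROP ?P1")
    "2 \<notin> {a, b} \<Longrightarrow> a = 0 \<and> b = 1" (is "PROP ?P2")
proof -
  have "a = 0 \<or> a = 1" "b = 1 \<or> b = 2" using assms by linarith+
  then show "PROP ?P0" "PROP ?P1" "PROP ?P2"
    using assms by (elim disjE; simp)+
qed

lemma is_nerve_simplex_fill_2:
  assumes z: "z \<in> topspace (horn (nerve C) 2 k)" and k: "k \<le> 2"
    and u: "\<And>a b. \<lbrakk>a < b; b \<le> 2; k \<notin> {a, b}\<rbrakk> \<Longrightarrow> mor C u (vertex (glue 2 k z) a) (vertex (glue 2 k z) b)"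
    and w: "cell C w (edge (fill 2 k z u w) (0, 2)) (edge (fill 2 k z u w) (1, 2) \<odot>\<^bsub>C\<^esub> edge (fill 2 k z u w) (0, 1))"
  shows "is_nerve_simplex C 2 (fill 2 k z u w)"
  unfolding is_nerve_simplex_iff
proof (intro conjI allI impI; elim conjE)
  fix a b :: nat assume ab: "a < b" "b \<le> 2"
  show "mor C (edge (fill 2 k z u w) (a, b)) (vertex (fill 2 k z u w) a) (vertex (fill 2 k z u w) b)"
    using u[OF ab] glueD(1)[OF z _ ab] ab by (simp add: fill_2_simps(1)[OF k] fill_simps(1) free_index_2_iff[OF k])
next
  fix a b c :: nat assume abc: "a < b" "b < c" "c \<le> 2"
  show "cell C (triangle (fill 2 k z u w) (a, b, c)) (edge (fill 2 k z u w) (a, c))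
      (edge (fill 2 k z u w) (b, c) \<odot>\<^bsub>C\<^esub> edge (fill 2 k z u w) (a, b))"
    using w unfolding indices_2[OF abc] fill_2_simps(2)[OF k] .
next
  fix a b c d :: nat assume "a < b" "b < c" "c < d" "d \<le> 2"
  then have False by linarith
  then show "cocycle C (edge (fill 2 k z u w)) (triangle (fill 2 k z u w)) a b c d" ..
qed

text \<open>Any filler of the horn of \<open>s\<close> has the same horn as \<open>s\<close>. So it
  agrees with \<open>s\<close> at the edges of the horn, where \<open>fill\<close> takes its values
  from \<open>glue\<close>.\<close>

lemma glue_horn_map_2:
  assumes z: "horn_map (nerve C) 2 k s \<in> topspace (horn (nerve C) 2 k)" and k: "k \<le> 2"
    and ab: "a < b" "b \<le> 2" "k \<in> {a, b}"
  shows "edge (glue 2 k (horn_map (nerve C) 2 k s)) (a, b) = edge s (a, b)"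
proof -
  let ?z = "horn_map (nerve C) 2 k s"
  obtain i where i: "i \<le> 2" "i \<noteq> k" "i \<notin> {a, b}"
    using free_index_2_iff[OF k ab(1,2)] ab(3) unfolding free_index_def by blast
  have "edge (fill 2 k ?z u w) (a, b) = edge s (a, b)" for u w
    by (rule horn_map_eqD(2)[OF horn_map_fill[OF z]]) (use i ab in simp_all)
  then show ?thesis using ab by (simp only: fill_2_simps(1)[OF k] if_True)
qed

text \<open>Every 2-simplex fills its own horn with its own missing entries. This turns an initial
  condition on simplices into one on the two arguments of \<open>fill\<close>.\<close>

lemma fill_horn_map_2:
  assumes s: "s \<in> topspace (nerve_space C 2)" and k: "k \<le> 2"
    and u: "\<And>a b. \<lbrakk>a < b; b \<le> 2; k \<notin> {a, b}\<rbrakk> \<Longrightarrow> edge s (a, b) = u" and w: "triangle s (0, 1, 2) = w"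
  shows "fill 2 k (horn_map (nerve C) 2 k s) u w = s"
proof (rule nerve_simplex_eqI[of 2])
  let ?z = "horn_map (nerve C) 2 k s"
  have z: "?z \<in> topspace (horn (nerve C) 2 k)"
  proof -
    have "horn_map (nerve C) 2 k ` topspace (nerve_space C 2) \<subseteq> topspace (horn (nerve C) 2 k)"
      by (rule continuous_map_image_subset_topspace[OF continuous_horn_map]) (use k in simp_all)
    then show ?thesis using s by blast
  qed
  have eq: "horn_map (nerve C) 2 k (fill 2 k ?z u w) = horn_map (nerve C) 2 k s"
    by (rule horn_map_fill[OF z]) simp
  show "nerve_extensional 2 (fill 2 k ?z u w)" by (rule fill_simps)
  show "nerve_extensional 2 s" using s by (simp only: topspace_nerve)
  show "vertex (fill 2 k ?z u w) v = vertex s v" if v: "v \<le> 2" for v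
  proof -
    obtain i where "i \<le> 2" "i \<noteq> k" "i \<notin> {v}" using free_index_1[of 2 k v] unfolding free_index_def by auto
    from horn_map_eqD(1)[OF eq this(1,2) v this(3)] show ?thesis .
  qed
  show "edge (fill 2 k ?z u w) (a, b) = edge s (a, b)" if ab: "a < b" "b \<le> 2" for a b
  proof (cases "k \<in> {a, b}")
    case True
    from glue_horn_map_2[OF z k ab this] show ?thesis
      unfolding fill_2_simps(1)[OF k ab] if_P[OF True] .
  next
    case False
    from u[OF ab this] show ?thesis
      unfolding fill_2_simps(1)[OF k ab] if_not_P[OF False] by (rule sym)
  qed
  show "triangle (fill 2 k ?z u w) (a, b, c) = triangle s (a, b, c)" if "a < b" "b < c" "c \<le> 2" for a b c
    unfolding indices_2[OF that] fill_2_simps(2)[OF k] w ..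
qed

text \<open>This is \<open>continuous_fill\<close> over a one-point space.\<close>

lemma fill_in_nerve:
  assumes z: "z \<in> topspace (horn (nerve C) n k)" and n: "2 \<le> n"
    and "u \<in> topspace (Mor C)" "w \<in> topspace (Cell C)" "is_nerve_simplex C n (fill n k z u w)"
  shows "fill n k z u w \<in> topspace (nerve_space C n)"
proof -
  have "continuous_map (discrete_topology {()}) (nerve_space C n) (\<lambda>_. fill n k z u w)"
    using assms by (intro continuous_fill) simp_all
  from continuous_nerveD(4)[OF this, of "()"] show ?thesis by simp
qed

text \<open>Fillers of a horn of dimension two need not be unique, so here the missing entries have
  to be lifted together with their initial values.\<close>

lemma Kan_at_of_fill:
  assumes n: "2 \<le> n" and k: "k \<le> n"
    and fill: "\<And>z. z \<in> topspace (horn (nerve C) n k) \<Longrightarrow>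
      \<exists>u \<in> topspace (Mor C). \<exists>w \<in> topspace (Cell C). is_nerve_simplex C n (fill n k z u w)"
    and lift: "\<And>m f H. \<lbrakk>continuous_map (cube m) (nerve_space C n) f;
        continuous_map (cylinder m) (horn (nerve C) n k) H;
        \<And>s. s \<in> topspace (cube m) \<Longrightarrow> H (s, 0) = horn_map (nerve C) n k (f s);
        \<And>t. t \<in> topspace (cylinder m) \<Longrightarrow> H t \<in> topspace (horn (nerve C) n k);
        \<And>s. s \<in> topspace (cube m) \<Longrightarrow> f s \<in> topspace (nerve_space C n)\<rbrakk> \<Longrightarrow>
      \<exists>u w. continuous_map (cylinder m) (Mor C) u \<and>
         continuous_map (cylinder m) (Cell C) w \<and>
         (\<forall>t \<in> topspace (cylinder m). is_nerve_simplex C n (fill n k (H t) (u t) (w t))) \<and>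
         (\<forall>s \<in> topspace (cube m). fill n k (H (s, 0)) (u (s, 0)) (w (s, 0)) = f s)"
  shows "Kan_at C n k"
  unfolding Kan_at_def Serre_fibration_def
proof (intro conjI allI impI)
  show c: "continuous_map (nerve_space C n) (horn (nerve C) n k) (horn_map (nerve C) n k)"
    using n k by (intro continuous_horn_map) auto
  show "horn_map (nerve C) n k ` topspace (nerve_space C n) = topspace (horn (nerve C) n k)"
  proof
    show "horn_map (nerve C) n k ` topspace (nerve_space C n) \<subseteq> topspace (horn (nerve C) n k)"
      by (rule continuous_map_image_subset_topspace[OF c])
    show "topspace (horn (nerve C) n k) \<subseteq> horn_map (nerve C) n k ` topspace (nerve_space C n)"
    proof
      fix z assume z: "z \<in> topspace (horn (nerve C) n k)"
      from fill[OF z] obtain u w where "u \<in> topspace (Mor C)" "w \<in> topspace (Cell C)"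
        "is_nerve_simplex C n (fill n k z u w)" by blast
      from fill_in_nerve[OF z n this] horn_map_fill[OF z, of u w] n
      show "z \<in> horn_map (nerve C) n k ` topspace (nerve_space C n)" by force
    qed
  qed
  fix m f H
  let ?T = "cylinder m"
  assume f: "continuous_map (cube m) (nerve_space C n) f"
    and H: "continuous_map ?T (horn (nerve C) n k) H"
    and "\<forall>s \<in> topspace (cube m). H (s, 0) = horn_map (nerve C) n k (f s)"
  with lift[OF f H _ continuous_map_mem[OF H] continuous_map_mem[OF f]] obtain u w where u: "continuous_map ?T (Mor C) u" and w: "continuous_map ?T (Cell C) w"
    and s: "\<And>t. t \<in> topspace ?T \<Longrightarrow> is_nerve_simplex C n (fill n k (H t) (u t) (w t))"
    and i: "\<And>s. s \<in> topspace (cube m) \<Longrightarrow> fill n k (H (s, 0)) (u (s, 0)) (w (s, 0)) = f s" by blast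
  have h: "horn_map (nerve C) n k (fill n k (H t) (u t) (w t)) = H t" if "t \<in> topspace ?T" for t
  proof (rule horn_map_fill)
    show "H t \<in> topspace (horn (nerve C) n k)"
      by (rule continuous_map_mem[OF H that])
  qed (use n in simp)
  show "\<exists>K. continuous_map ?T (nerve_space C n) K \<and> (\<forall>s \<in> topspace (cube m). K (s, 0) = f s) \<and>
      (\<forall>s \<in> topspace (cube m). \<forall>t \<in> {0..1}. horn_map (nerve C) n k (K (s, t)) = H (s, t))"
  proof (intro exI conjI ballI)
    show "continuous_map ?T (nerve_space C n) (\<lambda>t. fill n k (H t) (u t) (w t))"
      by (rule continuous_fill[OF H n u w s])
  qed (use i h in auto)
qed

context bigroupoid
begin

lemma transpose_right_cell:
  assumes "f \<in> M" "g \<in> M" "src C f = x" "tgt C f = y" "src C g = y" "tgt C g = x"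
    and "n \<in> D" "src2 C n = one C x" "tgt2 C n = g \<odot> f"
    and "u \<in> M" "src C u = x" "t \<in> D" "src2 C t = u \<odot> g"
  shows "cell C (transpose_right u f g n t) u (tgt2 C t \<odot> f)"
proof -
  have "x \<in> topspace (Ob C)" using assms by auto
  then show ?thesis unfolding transpose_right_def using assms by (simp add: cell_iff)
qed

lemma transpose_left_cell:
  assumes "f \<in> M" "g \<in> M" "src C f = x" "tgt C f = y" "src C g = y" "tgt C g = x"
    and "e \<in> D" "src2 C e = f \<odot> g" "tgt2 C e = one C y"
    and "u \<in> M" "tgt C u = y" "t \<in> D" "src2 C t = g \<odot> u"
  shows "cell C (transpose_left u f g e t) u (f \<odot> tgt2 C t)"
proof -
  have "y \<in> topspace (Ob C)" using assms by auto
  then show ?thesis unfolding transpose_left_def using assms by (simp add: cell_iff)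
qed

lemma src_tgt_of_tgt2:
  assumes "t \<in> D" "src2 C t = v \<odot> u" "u \<in> M" "v \<in> M" "src C v = tgt C u"
  shows "src C (tgt2 C t) = src C u" "tgt C (tgt2 C t) = tgt C v"
  using assms by simp_all

end

context topological_bigroupoid
begin

lemma horn_2_edges:
  assumes "z \<in> topspace (horn (nerve C) 2 k)" "k \<le> 2" "a < b" "b \<le> 2" "k \<in> {a, b}"
  shows "edge (glue 2 k z) (a, b) \<in> M" "src C (edge (glue 2 k z) (a, b)) = vertex (glue 2 k z) a"
    "tgt C (edge (glue 2 k z) (a, b)) = vertex (glue 2 k z) b"
  using glueD(1)[OF assms(1) _ assms(3,4)] free_index_2_iff[OF assms(2-4)] assms(5) by (simp_all add: mor_iff)

lemma continuous_horn_2_edge: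
  assumes H: "continuous_map T (horn (nerve C) 2 k) H" and k: "k \<le> 2" and ab: "a < b" "b \<le> 2" "k \<in> {a, b}"
  shows "continuous_map T (Mor C) (\<lambda>t. edge (glue 2 k (H t)) (a, b))"
  using continuous_glue(2)[OF H _ _ ab(1,2)] free_index_2_iff[OF k ab(1,2)] ab(3) unfolding free_index_def by auto

lemma nerve_2D:
  assumes "s \<in> topspace (nerve_space C 2)"
  shows "a < b \<Longrightarrow> b \<le> 2 \<Longrightarrow> edge s (a, b) \<in> M" (is "PROP ?P1")
    "a < b \<Longrightarrow> b \<le> 2 \<Longrightarrow> src C (edge s (a, b)) = vertex s a" (is "PROP ?P2")
    "a < b \<Longrightarrow> b \<le> 2 \<Longrightarrow> tgt C (edge s (a, b)) = vertex s b" (is "PROP ?P3")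
    "triangle s (0, 1, 2) \<in> D" (is ?Q1) "src2 C (triangle s (0, 1, 2)) = edge s (0, 2)" (is ?Q2)
    "tgt2 C (triangle s (0, 1, 2)) = edge s (1, 2) \<odot> edge s (0, 1)" (is ?Q3)
proof -
  have s: "is_nerve_simplex C 2 s" using assms by (simp only: topspace_nerve)
  show "PROP ?P1" "PROP ?P2" "PROP ?P3"
    using s[unfolded is_nerve_simplex_iff, THEN conjunct1, rule_format, of a b] by (simp_all add: mor_iff)
  show ?Q1 ?Q2 ?Q3
    using s[unfolded is_nerve_simplex_iff, THEN conjunct2, THEN conjunct1, rule_format, of 0 1 2] by (simp_all add: cell_iff)
qed

text \<open>The edge 02 is not chosen separately: it is the source of the lifted triangle, and
  globularity gives it the right end points.\<close>

lemma Kan_at_2_inner: "Kan_at C 2 1"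
proof (rule Kan_at_of_fill)
  have k: "(1::nat) \<le> 2" by simp
  have simplex: "is_nerve_simplex C 2 (fill 2 1 z (src2 C w) w)"
    if z: "z \<in> topspace (horn (nerve C) 2 1)"
      and w: "w \<in> D" "tgt2 C w = edge (glue 2 1 z) (1, 2) \<odot> edge (glue 2 1 z) (0, 1)" for z w
  proof (rule is_nerve_simplex_fill_2[OF z k])
    note e = horn_2_edges[OF z k, of 0 1] horn_2_edges[OF z k, of 1 2]
    have "src C (src2 C w) = src C (tgt2 C w)" "tgt C (src2 C w) = tgt C (tgt2 C w)"
      using w(1) by simp_all
    then have m: "mor C (src2 C w) (vertex (glue 2 1 z) 0) (vertex (glue 2 1 z) 2)"
      using w e unfolding mor_iff w(2) by (simp del: One_nat_def)
    fix a b :: nat assume ab: "a < b" "b \<le> 2" "1 \<notin> {a, b}"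
    have "a = 0" "b = 2" using missing_edge_2(2)[OF ab] by simp_all
    then show "mor C (src2 C w) (vertex (glue 2 1 z) a) (vertex (glue 2 1 z) b)" using m by simp
  next
    show "cell C w (edge (fill 2 1 z (src2 C w) w) (0, 2))
        (edge (fill 2 1 z (src2 C w) w) (1, 2) \<odot> edge (fill 2 1 z (src2 C w) w) (0, 1))"
      using w by (simp add: fill_2_simps(1)[OF k] cell_iff del: One_nat_def)
  qed
  show "\<exists>u \<in> M. \<exists>w \<in> D. is_nerve_simplex C 2 (fill 2 1 z u w)"
    if z: "z \<in> topspace (horn (nerve C) 2 1)" for z
  proof -
    note e = horn_2_edges[OF z k, of 0 1] horn_2_edges[OF z k, of 1 2]
    let ?u = "edge (glue 2 1 z) (1, 2) \<odot> edge (glue 2 1 z) (0, 1)"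
    have u: "?u \<in> M" using e by (simp del: One_nat_def)
    show ?thesis
      using simplex[OF z, of "one2 C ?u"] u by (intro bexI[of _ ?u] bexI[of _ "one2 C ?u"]) simp_all
  qed
  fix m f H
  let ?T = "cylinder m"
  assume f: "continuous_map (cube m) (nerve_space C 2) f"
    and H: "continuous_map ?T (horn (nerve C) 2 1) H"
    and fH: "\<And>s. s \<in> topspace (cube m) \<Longrightarrow> H (s, 0) = horn_map (nerve C) 2 1 (f s)"
    and Hz: "\<And>t. t \<in> topspace ?T \<Longrightarrow> H t \<in> topspace (horn (nerve C) 2 1)"
    and fs: "\<And>s. s \<in> topspace (cube m) \<Longrightarrow> f s \<in> topspace (nerve_space C 2)"
  have i0: "(s, 0) \<in> topspace ?T" if "s \<in> topspace (cube m)" for s using that by simp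
  define B where "B t = edge (glue 2 1 (H t)) (1, 2) \<odot> edge (glue 2 1 (H t)) (0, 1)" for t
  have st: "src C (edge (glue 2 1 (H t)) (1, 2)) = tgt C (edge (glue 2 1 (H t)) (0, 1))" if "t \<in> topspace ?T" for t
    using horn_2_edges(2)[OF Hz[OF that] k, of 1 2] horn_2_edges(3)[OF Hz[OF that] k, of 0 1] by simp
  have B: "continuous_map ?T (Mor C) B"
    unfolding B_def
    by (rule continuous_comp1'[OF continuous_horn_2_edge[OF H k] continuous_horn_2_edge[OF H k] st]) simp_all
  have B0: "B (s, 0) = tgt2 C (triangle (f s) (0, 1, 2))" if "s \<in> topspace (cube m)" for s
    using glue_horn_map_2[OF Hz[OF i0[OF that], unfolded fH[OF that]] k, of 0 1]
      glue_horn_map_2[OF Hz[OF i0[OF that], unfolded fH[OF that]] k, of 1 2] nerve_2D(6)[OF fs[OF that]]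
    unfolding B_def fH[OF that] by simp
  obtain w where w: "continuous_map ?T (Cell C) w"
    "\<And>s. s \<in> topspace (cube m) \<Longrightarrow> w (s, 0) = triangle (f s) (0, 1, 2)"
    "\<And>s t. s \<in> topspace (cube m) \<Longrightarrow> t \<in> {0..1} \<Longrightarrow> tgt2 C (w (s, t)) = B (s, t)"
    by (rule Serre_fibrationD[OF Serre_tgt2 continuous_nerveD(3)[OF f, of 0 1 2] B]) (use B0 in auto)
  show "\<exists>u w. continuous_map ?T (Mor C) u \<and> continuous_map ?T (Cell C) w \<and>
         (\<forall>t \<in> topspace ?T. is_nerve_simplex C 2 (fill 2 1 (H t) (u t) (w t))) \<and>
         (\<forall>s \<in> topspace (cube m). fill 2 1 (H (s, 0)) (u (s, 0)) (w (s, 0)) = f s)"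
  proof (intro exI conjI ballI)
    show "continuous_map ?T (Mor C) (\<lambda>t. src2 C (w t))" by (rule continuous_src2'[OF w(1)])
    show "continuous_map ?T (Cell C) w" by (rule w)
    show "is_nerve_simplex C 2 (fill 2 1 (H t) (src2 C (w t)) (w t))" if t: "t \<in> topspace ?T" for t
    proof (rule simplex[OF Hz[OF t]])
      show "w t \<in> D" by (rule continuous_map_mem[OF w(1) t])
      show "tgt2 C (w t) = edge (glue 2 1 (H t)) (1, 2) \<odot> edge (glue 2 1 (H t)) (0, 1)"
        using w(3) t unfolding B_def by auto
    qed
    show "fill 2 1 (H (s, 0)) (src2 C (w (s, 0))) (w (s, 0)) = f s" if s: "s \<in> topspace (cube m)" for s
      unfolding fH[OF s] w(2)[OF s]
    proof (rule fill_horn_map_2[OF fs[OF s] k])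
      fix a b :: nat assume ab: "a < b" "b \<le> 2" "1 \<notin> {a, b}"
      have "a = 0" "b = 2" using missing_edge_2(2)[OF ab] by simp_all
      then show "edge (f s) (a, b) = src2 C (triangle (f s) (0, 1, 2))"
        using nerve_2D(5)[OF fs[OF s]] by simp
    qed simp
  qed
qed simp_all

text \<open>The missing edge 12 is the target of a cell \<open>t\<close> with source
  \<open>u \<odot> g\<close>, where \<open>g\<close> is an adjoint inverse of the edge 01.
  Transposition sends \<open>t\<close> to a cell from \<open>u\<close> to the composite of that
  target with the edge 01, as the triangle requires.\<close>

lemma Kan_at_2_first: "Kan_at C 2 0"
proof (rule Kan_at_of_fill)
  have k: "(0::nat) \<le> 2" by simp
  have simplex: "is_nerve_simplex C 2 (fill 2 0 z (tgt2 C t) (transpose_right (edge (glue 2 0 z) (0, 2)) (edge (glue 2 0 z) (0, 1)) g n t))"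
    "transpose_right (edge (glue 2 0 z) (0, 2)) (edge (glue 2 0 z) (0, 1)) g n t \<in> D"
    if z: "z \<in> topspace (horn (nerve C) 2 0)"
      and ad: "adjoint_equivalence C (edge (glue 2 0 z) (0, 1)) g n e"
      and t: "t \<in> D" "src2 C t = edge (glue 2 0 z) (0, 2) \<odot> g" for z g n e t
  proof -
    let ?w = "transpose_right (edge (glue 2 0 z) (0, 2)) (edge (glue 2 0 z) (0, 1)) g n t"
    note e = horn_2_edges[OF z k zero_less_one one_le_numeral insertI1] horn_2_edges[OF z k zero_less_numeral order_refl insertI1]
    note ad = adjoint_equivalenceD[OF ad e(2,3)]
    have w: "cell C ?w (edge (glue 2 0 z) (0, 2)) (tgt2 C t \<odot> edge (glue 2 0 z) (0, 1))"
      by (rule transpose_right_cell[OF e(1) ad(1) e(2,3) ad(2-6) e(4,5) t])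
    then show "?w \<in> D" unfolding cell_iff by blast
    have m: "mor C (tgt2 C t) (vertex (glue 2 0 z) 1) (vertex (glue 2 0 z) 2)"
      using src_tgt_of_tgt2[OF t ad(1) e(4)] t(1) ad e unfolding mor_iff by simp
    show "is_nerve_simplex C 2 (fill 2 0 z (tgt2 C t) ?w)"
    proof (rule is_nerve_simplex_fill_2[OF z k])
      fix a b :: nat assume ab: "a < b" "b \<le> 2" "0 \<notin> {a, b}"
      show "mor C (tgt2 C t) (vertex (glue 2 0 z) a) (vertex (glue 2 0 z) b)"
        using m missing_edge_2(1)[OF ab] by simp
    next
      show "cell C ?w (edge (fill 2 0 z (tgt2 C t) ?w) (0, 2))
          (edge (fill 2 0 z (tgt2 C t) ?w) (1, 2) \<odot> edge (fill 2 0 z (tgt2 C t) ?w) (0, 1))"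
        using w by (simp add: fill_2_simps(1)[OF k] del: One_nat_def)
    qed
  qed
  show "\<exists>u \<in> M. \<exists>w \<in> D. is_nerve_simplex C 2 (fill 2 0 z u w)"
    if z: "z \<in> topspace (horn (nerve C) 2 0)" for z
  proof -
    note e = horn_2_edges[OF z k zero_less_one one_le_numeral insertI1] horn_2_edges[OF z k zero_less_numeral order_refl insertI1]
    obtain g n e where ad: "adjoint_equivalence C (edge (glue 2 0 z) (0, 1)) g n e"
      using adjoint_equivalence_exists[OF e(1)] by blast
    \<comment> \<open>For a single horn the identity cell of this composite serves as
      \<open>t\<close>; the composite itself becomes the missing edge.\<close>
    let ?v = "edge (glue 2 0 z) (0, 2) \<odot> g"
    have "?v \<in> M" using e adjoint_equivalenceD[OF ad e(2,3)] by simp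
    then have t: "one2 C ?v \<in> D" "src2 C (one2 C ?v) = ?v" "tgt2 C (one2 C ?v) \<in> M" by simp_all
    from simplex[OF z ad t(1,2)] t(3) show ?thesis by blast
  qed
  fix m f H
  let ?T = "cylinder m"
  assume f: "continuous_map (cube m) (nerve_space C 2) f"
    and H: "continuous_map ?T (horn (nerve C) 2 0) H"
    and fH: "\<And>s. s \<in> topspace (cube m) \<Longrightarrow> H (s, 0) = horn_map (nerve C) 2 0 (f s)"
    and Hz: "\<And>t. t \<in> topspace ?T \<Longrightarrow> H t \<in> topspace (horn (nerve C) 2 0)"
    and fs: "\<And>s. s \<in> topspace (cube m) \<Longrightarrow> f s \<in> topspace (nerve_space C 2)"
  have i0: "(s, 0) \<in> topspace ?T" if "s \<in> topspace (cube m)" for s using that by simp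
  define a u where "a t = edge (glue 2 0 (H t)) (0, 1)" and "u t = edge (glue 2 0 (H t)) (0, 2)" for t
  have ac: "continuous_map ?T (Mor C) a" and uc: "continuous_map ?T (Mor C) u"
    unfolding a_def u_def by (rule continuous_horn_2_edge[OF H k]; simp)+
  define x where "x t = vertex (glue 2 0 (H t))" for t
  have e: "a t \<in> M" "src C (a t) = x t 0" "tgt C (a t) = x t 1" "u t \<in> M" "src C (u t) = x t 0" "tgt C (u t) = x t 2"
    if "t \<in> topspace ?T" for t
    unfolding a_def u_def x_def by (rule horn_2_edges[OF Hz[OF that] k]; simp)+
  have a0: "a (s, 0) = edge (f s) (0, 1)" "u (s, 0) = edge (f s) (0, 2)" if "s \<in> topspace (cube m)" for s
    unfolding a_def u_def fH[OF that]
    by (rule glue_horn_map_2[OF Hz[OF i0[OF that], unfolded fH[OF that]] k]; simp)+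
  obtain g n e where gc: "continuous_map ?T (Mor C) g" and nc: "continuous_map ?T (Cell C) n" and ec: "continuous_map ?T (Cell C) e"
    and ad0: "\<And>t. t \<in> topspace ?T \<Longrightarrow> adjoint_equivalence C (a t) (g t) (n t) (e t)"
    using continuous_adjoint_equivalence[OF ac] by blast
  note ad = adjoint_equivalenceD[OF ad0 e(2,3)]
  have xo: "x t 0 \<in> topspace (Ob C)" "x t 1 \<in> topspace (Ob C)" if "t \<in> topspace ?T" for t
    using src_tgt_simps[OF e(1)[OF that]] e(2,3)[OF that] by simp_all
  define b0 w0 where "b0 s = edge (f s) (1, 2)" and "w0 s = triangle (f s) (0, 1, 2)" for s
  have bc: "continuous_map (cube m) (Mor C) b0" and wc: "continuous_map (cube m) (Cell C) w0"
    unfolding b0_def w0_def by (rule continuous_nerveD[OF f]; simp)+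
  have bw: "b0 s \<in> M" "src C (b0 s) = x (s, 0) 1" "tgt C (u (s, 0)) = tgt C (b0 s)"
    "w0 s \<in> D" "src2 C (w0 s) = u (s, 0)" "tgt2 C (w0 s) = b0 s \<odot> a (s, 0)" if s: "s \<in> topspace (cube m)" for s
    using nerve_2D[OF fs[OF s]] e(3)[OF i0[OF s]] unfolding a0[OF s] b0_def w0_def by (simp_all del: One_nat_def)
  have c0: "continuous_map (cube m) X (\<lambda>s. h (s, 0))" if "continuous_map ?T X h" for X :: "'x topology" and h
    using continuous_map_slice[OF that, of 0] by simp
  \<comment> \<open>The given triangles over time 0, cotransposed with the adjoint data chosen
    there, are the start of the lift.\<close>
  define t0 where "t0 s = cotranspose_right (b0 s) (a (s, 0)) (g (s, 0)) (e (s, 0)) (w0 s)" for s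
  have t0c: "continuous_map (cube m) (Cell C) t0"
    unfolding t0_def cotranspose_right_def
    by (intro continuous_operations bc wc c0[OF ac] c0[OF gc] c0[OF ec])
      (simp_all add: bw e[OF i0] ad[OF i0 i0 i0] xo[OF i0] del: One_nat_def topspace_prod_topology)
  have t0: "src2 C (t0 s) = u (s, 0) \<odot> g (s, 0)" "tgt2 C (t0 s) = b0 s"
    "transpose_right (u (s, 0)) (a (s, 0)) (g (s, 0)) (n (s, 0)) (t0 s) = w0 s" if s: "s \<in> topspace (cube m)" for s
  proof -
    note i = i0[OF s]
    note b = bw[OF s]
    show "src2 C (t0 s) = u (s, 0) \<odot> g (s, 0)" "tgt2 C (t0 s) = b0 s"
      unfolding t0_def cotranspose_right_def using b e[OF i] ad[OF i i i] xo[OF i] by (simp_all del: One_nat_def)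
    show "transpose_right (u (s, 0)) (a (s, 0)) (g (s, 0)) (n (s, 0)) (t0 s) = w0 s"
      unfolding t0_def
      by (rule transpose_cotranspose_right[where x = "x (s, 0) 0" and y = "x (s, 0) 1"])
        (use b e[OF i] ad[OF i i i] in \<open>simp_all del: One_nat_def\<close>)
  qed
  have ugc: "continuous_map ?T (Mor C) (\<lambda>t. u t \<odot> g t)"
    by (intro continuous_operations uc gc) (simp add: e ad)
  \<comment> \<open>Just the source of \<open>t\<close> is prescribed. Its target, the missing edge,
    is carried along by the lift.\<close>
  obtain t where tc: "continuous_map ?T (Cell C) t"
    and t: "\<And>s. s \<in> topspace (cube m) \<Longrightarrow> t (s, 0) = t0 s"
    "\<And>s r. s \<in> topspace (cube m) \<Longrightarrow> r \<in> {0..1} \<Longrightarrow> src2 C (t (s, r)) = u (s, r) \<odot> g (s, r)"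
    by (rule Serre_fibrationD[OF Serre_src2 t0c ugc]) (use t0(1) in auto)
  have tD: "t z \<in> D" "src2 C (t z) = u z \<odot> g z" if "z \<in> topspace ?T" for z
    using continuous_map_image_subset_topspace[OF tc] that t(2) by auto
  show "\<exists>u w. continuous_map ?T (Mor C) u \<and> continuous_map ?T (Cell C) w \<and>
         (\<forall>t \<in> topspace ?T. is_nerve_simplex C 2 (fill 2 0 (H t) (u t) (w t))) \<and>
         (\<forall>s \<in> topspace (cube m). fill 2 0 (H (s, 0)) (u (s, 0)) (w (s, 0)) = f s)"
  proof (intro exI conjI ballI)
    show "continuous_map ?T (Mor C) (\<lambda>z. tgt2 C (t z))" by (rule continuous_tgt2'[OF tc])
    show "continuous_map ?T (Cell C) (\<lambda>z. transpose_right (u z) (a z) (g z) (n z) (t z))"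
      unfolding transpose_right_def
      by (intro continuous_operations uc ac gc nc tc)
        (simp_all add: e ad tD xo del: One_nat_def topspace_prod_topology)
    show "is_nerve_simplex C 2 (fill 2 0 (H z) (tgt2 C (t z)) (transpose_right (u z) (a z) (g z) (n z) (t z)))"
      if z: "z \<in> topspace ?T" for z
      using simplex(1)[OF Hz[OF z] ad0[OF z, unfolded a_def] tD[OF z, unfolded u_def]] unfolding a_def u_def .
    \<comment> \<open>At time 0 the round trip returns the triangle of \<open>f s\<close>, and the
      target of \<open>t0 s\<close> is its missing edge.\<close>
    show "fill 2 0 (H (s, 0)) (tgt2 C (t (s, 0))) (transpose_right (u (s, 0)) (a (s, 0)) (g (s, 0)) (n (s, 0)) (t (s, 0))) = f s"
      if s: "s \<in> topspace (cube m)" for s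
      unfolding fH[OF s] t(1)[OF s] t0(2,3)[OF s]
    proof (rule fill_horn_map_2[OF fs[OF s] k])
      fix a b :: nat assume ab: "a < b" "b \<le> 2" "0 \<notin> {a, b}"
      have "a = 1" "b = 2" using missing_edge_2(1)[OF ab] by simp_all
      then show "edge (f s) (a, b) = b0 s" unfolding b0_def by simp
    qed (simp add: w0_def)
  qed
qed simp_all

text \<open>Mirror image of \<open>Kan_at_2_first\<close>: now the edge 12 is the one with an
  adjoint inverse \<open>g\<close>, and the missing edge 01 is the target of a cell with source
  \<open>g \<odot> u\<close>.\<close>

lemma Kan_at_2_last: "Kan_at C 2 2"
proof (rule Kan_at_of_fill)
  have k: "(2::nat) \<le> 2" by simp
  have l: "(1::nat) < 2" "(2::nat) \<in> {1, 2}" "(2::nat) \<in> {0, 2}" by simp_all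
  have simplex: "is_nerve_simplex C 2 (fill 2 2 z (tgt2 C t) (transpose_left (edge (glue 2 2 z) (0, 2)) (edge (glue 2 2 z) (1, 2)) g e t))"
    "transpose_left (edge (glue 2 2 z) (0, 2)) (edge (glue 2 2 z) (1, 2)) g e t \<in> D"
    if z: "z \<in> topspace (horn (nerve C) 2 2)"
      and ad: "adjoint_equivalence C (edge (glue 2 2 z) (1, 2)) g n e"
      and t: "t \<in> D" "src2 C t = g \<odot> edge (glue 2 2 z) (0, 2)" for z g n e t
  proof -
    let ?w = "transpose_left (edge (glue 2 2 z) (0, 2)) (edge (glue 2 2 z) (1, 2)) g e t"
    note e = horn_2_edges[OF z k l(1) order_refl l(2)] horn_2_edges[OF z k zero_less_numeral order_refl l(3)]
    note ad = adjoint_equivalenceD[OF ad e(2,3)]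
    have w: "cell C ?w (edge (glue 2 2 z) (0, 2)) (edge (glue 2 2 z) (1, 2) \<odot> tgt2 C t)"
      by (rule transpose_left_cell[OF e(1) ad(1) e(2,3) ad(2,3,7-9) e(4,6) t])
    then show "?w \<in> D" unfolding cell_iff by blast
    have m: "mor C (tgt2 C t) (vertex (glue 2 2 z) 0) (vertex (glue 2 2 z) 1)"
      using src_tgt_of_tgt2[OF t e(4) ad(1)] t(1) ad e unfolding mor_iff by simp
    show "is_nerve_simplex C 2 (fill 2 2 z (tgt2 C t) ?w)"
    proof (rule is_nerve_simplex_fill_2[OF z k])
      fix a b :: nat assume ab: "a < b" "b \<le> 2" "2 \<notin> {a, b}"
      show "mor C (tgt2 C t) (vertex (glue 2 2 z) a) (vertex (glue 2 2 z) b)"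
        using m missing_edge_2(3)[OF ab] by simp
    next
      show "cell C ?w (edge (fill 2 2 z (tgt2 C t) ?w) (0, 2))
          (edge (fill 2 2 z (tgt2 C t) ?w) (1, 2) \<odot> edge (fill 2 2 z (tgt2 C t) ?w) (0, 1))"
        using w by (simp add: fill_2_simps(1)[OF k] del: One_nat_def)
    qed
  qed
  show "\<exists>u \<in> M. \<exists>w \<in> D. is_nerve_simplex C 2 (fill 2 2 z u w)"
    if z: "z \<in> topspace (horn (nerve C) 2 2)" for z
  proof -
    note e = horn_2_edges[OF z k l(1) order_refl l(2)] horn_2_edges[OF z k zero_less_numeral order_refl l(3)]
    obtain g n e where ad: "adjoint_equivalence C (edge (glue 2 2 z) (1, 2)) g n e"
      using adjoint_equivalence_exists[OF e(1)] by blast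
    let ?v = "g \<odot> edge (glue 2 2 z) (0, 2)"
    have "?v \<in> M" using e adjoint_equivalenceD[OF ad e(2,3)] by simp
    then have t: "one2 C ?v \<in> D" "src2 C (one2 C ?v) = ?v" "tgt2 C (one2 C ?v) \<in> M" by simp_all
    from simplex[OF z ad t(1,2)] t(3) show ?thesis by blast
  qed
  fix m f H
  let ?T = "cylinder m"
  assume f: "continuous_map (cube m) (nerve_space C 2) f"
    and H: "continuous_map ?T (horn (nerve C) 2 2) H"
    and fH: "\<And>s. s \<in> topspace (cube m) \<Longrightarrow> H (s, 0) = horn_map (nerve C) 2 2 (f s)"
    and Hz: "\<And>t. t \<in> topspace ?T \<Longrightarrow> H t \<in> topspace (horn (nerve C) 2 2)"
    and fs: "\<And>s. s \<in> topspace (cube m) \<Longrightarrow> f s \<in> topspace (nerve_space C 2)"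
  have i0: "(s, 0) \<in> topspace ?T" if "s \<in> topspace (cube m)" for s using that by simp
  define b u where "b t = edge (glue 2 2 (H t)) (1, 2)" and "u t = edge (glue 2 2 (H t)) (0, 2)" for t
  have bc: "continuous_map ?T (Mor C) b" and uc: "continuous_map ?T (Mor C) u"
    unfolding b_def u_def by (rule continuous_horn_2_edge[OF H k]; simp)+
  define x where "x t = vertex (glue 2 2 (H t))" for t
  have e: "b t \<in> M" "src C (b t) = x t 1" "tgt C (b t) = x t 2" "u t \<in> M" "src C (u t) = x t 0" "tgt C (u t) = x t 2"
    if "t \<in> topspace ?T" for t
    unfolding b_def u_def x_def by (rule horn_2_edges[OF Hz[OF that] k]; simp)+
  have b0: "b (s, 0) = edge (f s) (1, 2)" "u (s, 0) = edge (f s) (0, 2)" if "s \<in> topspace (cube m)" for s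
    unfolding b_def u_def fH[OF that]
    by (rule glue_horn_map_2[OF Hz[OF i0[OF that], unfolded fH[OF that]] k]; simp)+
  obtain g n e where gc: "continuous_map ?T (Mor C) g" and nc: "continuous_map ?T (Cell C) n" and ec: "continuous_map ?T (Cell C) e"
    and ad0: "\<And>t. t \<in> topspace ?T \<Longrightarrow> adjoint_equivalence C (b t) (g t) (n t) (e t)"
    using continuous_adjoint_equivalence[OF bc] by blast
  note ad = adjoint_equivalenceD[OF ad0 e(2,3)]
  have xo: "x t 1 \<in> topspace (Ob C)" "x t 2 \<in> topspace (Ob C)" if "t \<in> topspace ?T" for t
    using src_tgt_simps[OF e(1)[OF that]] e(2,3)[OF that] by simp_all
  define a0 w0 where "a0 s = edge (f s) (0, 1)" and "w0 s = triangle (f s) (0, 1, 2)" for s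
  have ac: "continuous_map (cube m) (Mor C) a0" and wc: "continuous_map (cube m) (Cell C) w0"
    unfolding a0_def w0_def by (rule continuous_nerveD[OF f]; simp)+
  have aw: "a0 s \<in> M" "tgt C (a0 s) = x (s, 0) 1" "src C (u (s, 0)) = src C (a0 s)"
    "w0 s \<in> D" "src2 C (w0 s) = u (s, 0)" "tgt2 C (w0 s) = b (s, 0) \<odot> a0 s" if s: "s \<in> topspace (cube m)" for s
    using nerve_2D[OF fs[OF s]] e(2)[OF i0[OF s]] unfolding b0[OF s] a0_def w0_def by (simp_all del: One_nat_def)
  have c0: "continuous_map (cube m) X (\<lambda>s. h (s, 0))" if "continuous_map ?T X h" for X :: "'x topology" and h
    using continuous_map_slice[OF that, of 0] by simp
  \<comment> \<open>Here cotransposition uses the unit and transposition back uses the counit; at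
    the other outer horn it is the other way round.\<close>
  define t0 where "t0 s = cotranspose_left (a0 s) (b (s, 0)) (g (s, 0)) (n (s, 0)) (w0 s)" for s
  have t0c: "continuous_map (cube m) (Cell C) t0"
    unfolding t0_def cotranspose_left_def
    by (intro continuous_operations ac wc c0[OF bc] c0[OF gc] c0[OF nc])
      (simp_all add: aw e[OF i0] ad[OF i0 i0 i0] xo[OF i0] del: One_nat_def topspace_prod_topology)
  have t0: "src2 C (t0 s) = g (s, 0) \<odot> u (s, 0)" "tgt2 C (t0 s) = a0 s"
    "transpose_left (u (s, 0)) (b (s, 0)) (g (s, 0)) (e (s, 0)) (t0 s) = w0 s" if s: "s \<in> topspace (cube m)" for s
  proof -
    note i = i0[OF s]
    note b = aw[OF s]
    show "src2 C (t0 s) = g (s, 0) \<odot> u (s, 0)" "tgt2 C (t0 s) = a0 s"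
      unfolding t0_def cotranspose_left_def using b e[OF i] ad[OF i i i] xo[OF i] by (simp_all del: One_nat_def)
    show "transpose_left (u (s, 0)) (b (s, 0)) (g (s, 0)) (e (s, 0)) (t0 s) = w0 s"
      unfolding t0_def
      by (rule transpose_cotranspose_left[where x = "x (s, 0) 1" and y = "x (s, 0) 2"])
        (use b e[OF i] ad[OF i i i] in \<open>simp_all del: One_nat_def\<close>)
  qed
  have guc: "continuous_map ?T (Mor C) (\<lambda>t. g t \<odot> u t)"
    by (intro continuous_operations uc gc) (simp add: e ad)
  obtain t where tc: "continuous_map ?T (Cell C) t"
    and t: "\<And>s. s \<in> topspace (cube m) \<Longrightarrow> t (s, 0) = t0 s"
    "\<And>s r. s \<in> topspace (cube m) \<Longrightarrow> r \<in> {0..1} \<Longrightarrow> src2 C (t (s, r)) = g (s, r) \<odot> u (s, r)"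
    by (rule Serre_fibrationD[OF Serre_src2 t0c guc]) (use t0(1) in auto)
  have tD: "t z \<in> D" "src2 C (t z) = g z \<odot> u z" if "z \<in> topspace ?T" for z
    using continuous_map_image_subset_topspace[OF tc] that t(2) by auto
  show "\<exists>u w. continuous_map ?T (Mor C) u \<and> continuous_map ?T (Cell C) w \<and>
         (\<forall>t \<in> topspace ?T. is_nerve_simplex C 2 (fill 2 2 (H t) (u t) (w t))) \<and>
         (\<forall>s \<in> topspace (cube m). fill 2 2 (H (s, 0)) (u (s, 0)) (w (s, 0)) = f s)"
  proof (intro exI conjI ballI)
    show "continuous_map ?T (Mor C) (\<lambda>z. tgt2 C (t z))" by (rule continuous_tgt2'[OF tc])
    show "continuous_map ?T (Cell C) (\<lambda>z. transpose_left (u z) (b z) (g z) (e z) (t z))"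
      unfolding transpose_left_def
      by (intro continuous_operations uc bc gc ec tc)
        (simp_all add: e ad tD xo del: One_nat_def topspace_prod_topology)
    show "is_nerve_simplex C 2 (fill 2 2 (H z) (tgt2 C (t z)) (transpose_left (u z) (b z) (g z) (e z) (t z)))"
      if z: "z \<in> topspace ?T" for z
      using simplex(1)[OF Hz[OF z] ad0[OF z, unfolded b_def] tD[OF z, unfolded u_def]] unfolding b_def u_def .
    show "fill 2 2 (H (s, 0)) (tgt2 C (t (s, 0))) (transpose_left (u (s, 0)) (b (s, 0)) (g (s, 0)) (e (s, 0)) (t (s, 0))) = f s"
      if s: "s \<in> topspace (cube m)" for s
      unfolding fH[OF s] t(1)[OF s] t0(2,3)[OF s]
    proof (rule fill_horn_map_2[OF fs[OF s] k])
      fix a b :: nat assume ab: "a < b" "b \<le> 2" "2 \<notin> {a, b}"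
      have "a = 0" "b = 1" using missing_edge_2(3)[OF ab] by simp_all
      then show "edge (f s) (a, b) = a0 s" unfolding a0_def by simp
    qed (simp add: w0_def)
  qed
qed simp_all

section \<open>Horns of dimension one\<close>

text \<open>A 1-simplex is a 1-morphism with its end points recorded, so the space of 1-simplices is
  \<open>Mor C\<close>. This map and the edge at (0, 1) are the two directions of the
  identification.\<close>

definition simplex_1 :: "'b \<Rightarrow> ('a, 'b, 'c) nerve_simplex" where
  "simplex_1 u = restrict_simplex 1 (\<lambda>v. if v = 0 then src C u else tgt C u, \<lambda>_. u, \<lambda>_. undefined)"

lemma simplex_1_simps:
  "vertex (simplex_1 u) 0 = src C u" "vertex (simplex_1 u) 1 = tgt C u" "edge (simplex_1 u) (0, 1) = u"
  by (simp_all add: simplex_1_def del: One_nat_def)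

lemma indices_1: "(a::nat) < b \<Longrightarrow> b \<le> 1 \<Longrightarrow> a = 0 \<and> b = 1"
  by linarith

lemma simplex_1_of_nerve:
  assumes "s \<in> topspace (nerve_space C 1)"
  shows "simplex_1 (edge s (0, 1)) = s"
proof (rule nerve_simplex_eqI[of 1])
  have s: "is_nerve_simplex C 1 s" "nerve_extensional 1 s" using assms by (simp_all only: topspace_nerve)
  show "nerve_extensional 1 (simplex_1 (edge s (0, 1)))" unfolding simplex_1_def by simp
  show "nerve_extensional 1 s" by fact
  have m: "src C (edge s (0, 1)) = vertex s 0" "tgt C (edge s (0, 1)) = vertex s 1"
    using s(1)[unfolded is_nerve_simplex_iff, THEN conjunct1, rule_format, of 0 1] by (simp_all add: mor_iff)
  show "vertex (simplex_1 (edge s (0, 1))) v = vertex s v" if "v \<le> 1" for v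
  proof -
    have "v = 0 \<or> v = 1" using that by linarith
    then show ?thesis using m simplex_1_simps(1,2) by (elim disjE) simp_all
  qed
  show "edge (simplex_1 (edge s (0, 1))) (a, b) = edge s (a, b)" if "a < b" "b \<le> 1" for a b
    using indices_1[OF that] simplex_1_simps(3) by simp
  fix a b c :: nat assume "a < b" "b < c" "c \<le> 1"
  then have False by linarith
  then show "triangle (simplex_1 (edge s (0, 1))) (a, b, c) = triangle s (a, b, c)" ..
qed

lemma continuous_simplex_1:
  assumes u: "continuous_map T (Mor C) u"
  shows "continuous_map T (nerve_space C 1) (\<lambda>t. simplex_1 (u t))"
proof (rule continuous_nerveI)
  show "continuous_map T (Ob C) (\<lambda>t. vertex (simplex_1 (u t)) v)" if "v \<le> 1" for v
  proof -
    have "v = 0 \<or> v = 1" using that by linarith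
    then show ?thesis
      using continuous_src'[OF u] continuous_tgt'[OF u] by (elim disjE) (simp_all only: simplex_1_simps)
  qed
  show "continuous_map T (Mor C) (\<lambda>t. edge (simplex_1 (u t)) (a, b))" if "a < b" "b \<le> 1" for a b
    using indices_1[OF that] u by (simp only: simplex_1_simps)
  show "continuous_map T (Cell C) (\<lambda>t. triangle (simplex_1 (u t)) (a, b, c))" if "a < b" "b < c" "c \<le> 1" for a b c
  proof -
    have False using that by linarith
    then show ?thesis ..
  qed
  show "nerve_extensional 1 (simplex_1 (u t))" for t unfolding simplex_1_def by simp
  show "is_nerve_simplex C 1 (simplex_1 (u t))" if t: "t \<in> topspace T" for t
    unfolding is_nerve_simplex_iff
  proof (intro conjI allI impI; elim conjE)
    have ut: "u t \<in> M" by (rule continuous_map_mem[OF u t])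
    show "mor C (edge (simplex_1 (u t)) (a, b)) (vertex (simplex_1 (u t)) a) (vertex (simplex_1 (u t)) b)"
      if "a < b" "b \<le> 1" for a b
      using indices_1[OF that] ut by (simp only: simplex_1_simps mor_iff simp_thms)
    show "cell C (triangle (simplex_1 (u t)) (a, b, c)) (edge (simplex_1 (u t)) (a, c))
        (edge (simplex_1 (u t)) (b, c) \<odot> edge (simplex_1 (u t)) (a, b))" if "a < b" "b < c" "c \<le> 1" for a b c
    proof -
      have False using that by linarith
      then show ?thesis ..
    qed
    show "cocycle C (edge (simplex_1 (u t))) (triangle (simplex_1 (u t))) a b c d"
      if "a < b" "b < c" "c < d" "d \<le> 1" for a b c d
    proof -
      have False using that by linarith
      then show ?thesis ..
    qed
  qed
qed

text \<open>The single face of such a horn is opposite to \<open>i\<close>, and a 0-simplex is given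
  by its vertex. The index \<open>coface i 0\<close> is the vertex that remains, namely
  \<open>k\<close>.\<close>

lemma horn_map_1_eq_iff:
  assumes z: "z \<in> topspace (horn (nerve C) 1 k)" and ik: "{0..1} - {k} = {i}"
  shows "horn_map (nerve C) 1 k s = z \<longleftrightarrow> vertex s (coface i 0) = vertex (z i) 0"
proof
  assume "horn_map (nerve C) 1 k s = z"
  then have "face (nerve C) 1 i s = z i"
    unfolding horn_map_def ik by (rule subst) simp
  then show "vertex s (coface i 0) = vertex (z i) 0" using face_vertex[of 0 1 C i s] by simp
next
  assume v: "vertex s (coface i 0) = vertex (z i) 0"
  have zi: "z i \<in> topspace (nerve_space C 0)" "z \<in> extensional {i}"
    using z unfolding horn_def ik by (simp_all add: PiE_iff)
  have "face (nerve C) 1 i s = z i"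
  proof (rule nerve_simplex_eqI[of 0])
    show "nerve_extensional 0 (face (nerve C) 1 i s)" using face_extensional[of 1 C i s] by simp
    show "nerve_extensional 0 (z i)" using zi(1) by (simp only: topspace_nerve)
    show "vertex (face (nerve C) 1 i s) l = vertex (z i) l" if "l \<le> 0" for l
      using face_vertex[of 0 1 C i s] v that by simp
  qed simp_all
  then show "horn_map (nerve C) 1 k s = z"
    unfolding horn_map_def ik using zi(2) by (intro extensionalityI[of _ "{i}"]) simp_all
qed

text \<open>Under the identification with \<open>Mor C\<close> the horn map becomes
  \<open>src\<close> for k = 0 and \<open>tgt\<close> for k = 1. Writing \<open>p\<close> for either
  map treats both horns at once.\<close>

lemma Kan_at_1:
  assumes k: "k \<le> 1"
  shows "Kan_at C 1 k"
proof -
  have "k = 0 \<or> k = 1" using k by linarith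
  then obtain i p where ik: "{0..1} - {k} = {i}"
    and p: "Serre_fibration (Mor C) (Ob C) p" "\<And>x. x \<in> topspace (Ob C) \<Longrightarrow> p (one C x) = x"
    and v: "\<And>u. vertex (simplex_1 u) (coface i 0) = p u"
  proof (elim disjE)
    assume k: "k = 0"
    show thesis
    proof (rule that[OF _ Serre_src])
      show "{0..1} - {k} = {1}" unfolding k by auto
      show "vertex (simplex_1 u) (coface 1 0) = src C u" for u
        using simplex_1_simps(1) by (simp add: coface_def)
    qed simp
  next
    assume k: "k = 1"
    show thesis
    proof (rule that[OF _ Serre_tgt])
      show "{0..1} - {k} = {0}" unfolding k by auto
      show "vertex (simplex_1 u) (coface 0 0) = tgt C u" for u
        using simplex_1_simps(2) by (simp add: coface_def)
    qed simp
  qed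
  have "i \<in> {0..1} - {k}" unfolding ik by simp
  then have i: "i \<le> 1" "i \<noteq> k" by simp_all
  have eq: "horn_map (nerve C) 1 k (simplex_1 u) = z \<longleftrightarrow> p u = vertex (z i) 0"
    if "z \<in> topspace (horn (nerve C) 1 k)" for u z
    unfolding horn_map_1_eq_iff[OF that ik] v ..
  have c: "continuous_map (nerve_space C 1) (horn (nerve C) 1 k) (horn_map (nerve C) 1 k)"
    by (rule continuous_horn_map) (use k in simp_all)
  have zx: "vertex (z i) 0 \<in> topspace (Ob C)" if z: "z \<in> topspace (horn (nerve C) 1 k)" for z
  proof -
    have "z i \<in> topspace (nerve_space C 0)" using z unfolding horn_def ik by (simp add: PiE_iff)
    then show ?thesis unfolding topspace_nerve by simp
  qed
  show ?thesis
    unfolding Kan_at_def Serre_fibration_def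
  proof (intro conjI allI impI)
    show "continuous_map (nerve_space C 1) (horn (nerve C) 1 k) (horn_map (nerve C) 1 k)" by (rule c)
    show "horn_map (nerve C) 1 k ` topspace (nerve_space C 1) = topspace (horn (nerve C) 1 k)"
    proof
      show "horn_map (nerve C) 1 k ` topspace (nerve_space C 1) \<subseteq> topspace (horn (nerve C) 1 k)"
        by (rule continuous_map_image_subset_topspace[OF c])
      show "topspace (horn (nerve C) 1 k) \<subseteq> horn_map (nerve C) 1 k ` topspace (nerve_space C 1)"
      proof
        fix z assume z: "z \<in> topspace (horn (nerve C) 1 k)"
        \<comment> \<open>Identity 1-morphisms show that \<open>p\<close> reaches every
          object.\<close>
        let ?u = "one C (vertex (z i) 0)"
        have "continuous_map (discrete_topology {()}) (nerve_space C 1) (\<lambda>_. simplex_1 ?u)"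
          using zx[OF z] by (intro continuous_simplex_1) simp
        from continuous_nerveD(4)[OF this, of "()"] have "simplex_1 ?u \<in> topspace (nerve_space C 1)" by simp
        moreover have "horn_map (nerve C) 1 k (simplex_1 ?u) = z"
          unfolding eq[OF z] by (rule p(2)[OF zx[OF z]])
        ultimately show "z \<in> horn_map (nerve C) 1 k ` topspace (nerve_space C 1)"
          by (intro image_eqI[of _ _ "simplex_1 ?u"]) simp_all
      qed
    qed
    fix m f H
    let ?T = "cylinder m"
    assume f: "continuous_map (cube m) (nerve_space C 1) f"
      and H: "continuous_map ?T (horn (nerve C) 1 k) H"
      and fH: "\<forall>s \<in> topspace (cube m). H (s, 0) = horn_map (nerve C) 1 k (f s)"
    have Hz: "H t \<in> topspace (horn (nerve C) 1 k)" if "t \<in> topspace ?T" for t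
      by (rule continuous_map_mem[OF H that])
    have fs: "f s \<in> topspace (nerve_space C 1)" if "s \<in> topspace (cube m)" for s
      by (rule continuous_map_mem[OF f that])
    have ec: "continuous_map (cube m) (Mor C) (\<lambda>s. edge (f s) (0, 1))"
      by (rule continuous_nerveD(2)[OF f]) simp_all
    have yc: "continuous_map ?T (Ob C) (\<lambda>t. vertex (H t i) 0)"
      by (rule continuous_nerveD(1)[OF continuous_horn_component[OF H i]]) simp
    have y0: "vertex (H (s, 0) i) 0 = p (edge (f s) (0, 1))" if s: "s \<in> topspace (cube m)" for s
    proof -
      have "(s, 0) \<in> topspace ?T" using s by simp
      from eq[OF Hz[OF this], of "edge (f s) (0, 1)"] show ?thesis
        unfolding simplex_1_of_nerve[OF fs[OF s]] using fH s by simp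
    qed
    obtain u where uc: "continuous_map ?T (Mor C) u"
      and u: "\<And>s. s \<in> topspace (cube m) \<Longrightarrow> u (s, 0) = edge (f s) (0, 1)"
      "\<And>s t. s \<in> topspace (cube m) \<Longrightarrow> t \<in> {0..1} \<Longrightarrow> p (u (s, t)) = vertex (H (s, t) i) 0"
      by (rule Serre_fibrationD[OF p(1) ec yc]) (use y0 in auto)
    show "\<exists>K. continuous_map ?T (nerve_space C 1) K \<and> (\<forall>s \<in> topspace (cube m). K (s, 0) = f s) \<and>
        (\<forall>s \<in> topspace (cube m). \<forall>t \<in> {0..1}. horn_map (nerve C) 1 k (K (s, t)) = H (s, t))"
    proof (intro exI conjI ballI)
      show "continuous_map ?T (nerve_space C 1) (\<lambda>t. simplex_1 (u t))" by (rule continuous_simplex_1[OF uc])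
      show "simplex_1 (u (s, 0)) = f s" if "s \<in> topspace (cube m)" for s
        unfolding u(1)[OF that] by (rule simplex_1_of_nerve[OF fs[OF that]])
      show "horn_map (nerve C) 1 k (simplex_1 (u (s, t))) = H (s, t)"
        if "s \<in> topspace (cube m)" "t \<in> {0..1}" for s t
        using eq[OF Hz, of "(s, t)"] u(2) that by simp
    qed
  qed
qed

end

theorem theorem5p10:
  fixes C :: "('o, 'm, 'c) bicat"
  assumes "topological_bicategory C"
    and "two_groupoid C"
    and "Serre_fibration (Mor C) (Ob C) (src C)"
    and "Serre_fibration (Mor C) (Ob C) (tgt C)"
    and "Serre_fibration (Cell C) (Mor C) (src2 C)"
    and "Serre_fibration (Cell C) (Mor C) (tgt2 C)"
    and "continuous_map (Cell C) (Cell C) (inv_cell C)"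
    and "Serre_fibration (AdEq C) (Mor C) (\<lambda>(f, g, \<eta>, \<epsilon>). f)"
  shows "topological_Kan (geometric_nerve C)"
proof -
  interpret topological_bicategory C by fact
  interpret topological_bigroupoid C
    by unfold_locales (fact assms)+
  have "Kan_at C n k" if "1 \<le> n" "k \<le> n" for n k
  proof -
    have "n = 1 \<or> n = 2 \<or> n = 3 \<or> 4 \<le> n" using that(1) by linarith
    moreover have "Kan_at C 2 k" if "k \<le> 2"
    proof -
      have "k = 0 \<or> k = 1 \<or> k = 2" using that by linarith
      then show ?thesis
        using Kan_at_2_first Kan_at_2_inner Kan_at_2_last by (elim disjE) simp_all
    qed
    ultimately show ?thesis
      using that(2) Kan_at_1[of k] Kan_at_3[of k] Kan_at_ge_4[of n k] by (elim disjE) simp_all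
  qed
  then show ?thesis
    unfolding topological_Kan_def Kan_at_def simplices_nerve by blast
qed

end
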